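(* Let $L,\mu,C_f,L_{xy},L_{y^2}>0$ and $\kappa=L/\mu$. There exist positive constants $C_u,C_y,C'$, depending only on $L,\mu,C_f,L_{xy},L_{y^2}$, such that the following holds. Consider the conditional bilevel problem of the context, satisfying the following: each $f(\cdot,\cdot;\xi)$ is (possibly non-convex) $L$-smooth in $(x,y)$, with gradient in $y$ bounded in norm by $C_f$; each $g(\cdot,\cdot;\zeta)$ is $L$-smooth and $\mu$-strongly convex in $y$ for every $x$, and $\nabla_{xy}g(\cdot,\cdot;\zeta)$ and $\nabla_{y^2}g(\cdot,\cdot;\zeta)$ are Lipschitz with constants $L_{xy}$ and $L_{y^2}$; and there is $A$ with $\|\nabla f(x,y;\xi_i)-\nabla f(x,y)\|\le A$, $\|\nabla g(x,y;\zeta_{\xi_i,j})-\nabla g^{(\xi_i)}(x,y)\|\le A$, $\|\nabla^2g(x,y;\zeta_{\xi_i,j})-\nabla^2g^{(\xi_i)}(x,y)\|\le A$ and $\|\nabla h(x;\xi_i)-\nabla h(x)\|\le A$ for all $i,j,x,y$. Let $(x_t)_{0\le t\le T}$ be the outer iterates generated by the algorithm WiOR-CBO described in the context, using an example order for which, with some constants $\alpha$ and $C$, the following averaged-gradient bounds are satisfied for every interval length $s>0$: for every outer step $t$, $$\Big\|\frac1s\sum_{\tau=t}^{t+s-1}\nabla h(x_t;\xi_\tau)-\nabla h(x_t)\Big\|^2\le s^{-\alpha}C^2\quad\text{and}\quad\Big\|\frac1s\sum_{\tau=t}^{t+s-1}\nabla f(x_t,y;\xi_\tau)-\nabla f(x_t,y)\Big\|^2\le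 s^{-\alpha}C^2$$ with $y$ the final inner iterate of outer step $t$; and for every outer step $t$ and inner step $l$, at the inner iterate $y_l$, $$\Big\|\frac1s\sum_{l'=l}^{l+s-1}\nabla g(x_t,y_l;\zeta_{l'})-\nabla g^{(\xi_t)}(x_t,y_l)\Big\|^2\le s^{-\alpha}C^2\quad\text{and}\quad\Big\|\frac1s\sum_{l'=l}^{l+s-1}\nabla^2g(x_t,y_l;\zeta_{l'})-\nabla^2g^{(\xi_t)}(x_t,y_l)\Big\|^2\le s^{-\alpha}C^2,$$ where $\xi_\tau$ and $\zeta_{l'}$ are the outer examples and (within outer step $t$) inner examples in the order used. Let $T=R\times m$ be the total number of outer steps and $T_l=S\times\max_i n_i$ the maximum number of inner steps. Then for any positive integers $E,E_l,k$ with $T=E\times k$ and $T_l=E_l\times k$, with learning rates $\eta_t=\eta=\frac{1}{8k\bar L}$, $\gamma_t=\gamma=\frac{1}{256kL\kappa}$, $\rho_t=\rho=\frac{1}{512kL\kappa}$, $$\frac1E\sum_{e=0}^{E-1}\|\nabla h(x_{ke})\|^2\le\frac{8\Delta_h}{kE\eta}+C_u\Big(1-\frac{k\mu\rho}{2}\Big)^{E_l}\Delta_u+C_y\Big(1-\frac{k\mu\gamma}{2}\Big)^{E_l}\Delta_y+(C')^2C^2k^{-\alpha},$$ where $\Delta_h=h(x_0)-\inf_xh(x)$, and $\Delta_y,\Delta_u$ are upper bounds, over all outer steps $t$, of the initial inner errors $\|y^0-y_{x_t}^{\xi_t}\|^2$ and $\|u^0-u_{x_t}^{\xi_t}\|^2$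 respectively ($\xi_t$ being the outer example used at step $t$).
   Context: **Problem.** Outer dataset $\mathcal D_u=\{\xi_1,\dots,\xi_m\}$; for each $\xi_i$ an inner dataset $\mathcal D_{l,\xi_i}=\{\zeta_{\xi_i,j}: j\in[n_i]\}$ and inner objective $g^{(\xi_i)}(x,y)=\frac1{n_i}\sum_{j=1}^{n_i}g(x,y;\zeta_{\xi_i,j})$, $x\in\mathbb R^p$, $y\in\mathbb R^d$. Put $y_x^{\xi_i}=\arg\min_{y}g^{(\xi_i)}(x,y)$, $u_x^{\xi_i}=[\nabla_{y^2}g^{(\xi_i)}(x,y_x^{\xi_i})]^{-1}\nabla_yf(x,y_x^{\xi_i};\xi_i)$, $h(x;\xi_i)=f(x,y_x^{\xi_i};\xi_i)$ and $h(x)=\frac1m\sum_{i=1}^mh(x;\xi_i)$ (to be minimized, with $\inf h>-\infty$). Then $\nabla h(x;\xi_i)=\nabla_xf(x,y_x^{\xi_i};\xi_i)-\nabla_{xy}g^{(\xi_i)}(x,y_x^{\xi_i})u_x^{\xi_i}$ and $\nabla h(x)=\frac1m\sum_i\nabla h(x;\xi_i)$. Here $\nabla_{xy}g\in\mathbb R^{p\times d}$. Also write $f(x,y)=\frac1m\sum_if(x,y;\xi_i)$. $\bar L$ denotes a smoothness constant (Lipschitz constant of the gradient) of the functions $h(\cdot;\xi_i)$ and $h$; such a constant exists under the assumptions below and is of order $\kappa^3$. **Assumptions.** (A1) Each $f(\cdot,\cdot;\xi)$ is (possibly non-convex) $L$-smooth in $(x,y)$, with gradient in $y$ bounded in norm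 by $C_f$. (A2) Each $g(\cdot,\cdot;\zeta)$ is $L$-smooth and $\mu$-strongly convex in $y$ for every $x$; $\nabla_{xy}g(\cdot,\cdot;\zeta)$ and $\nabla_{y^2}g(\cdot,\cdot;\zeta)$ are Lipschitz with constants $L_{xy}$ and $L_{y^2}$. (A3) $\|\nabla f(x,y;\xi_i)-\nabla f(x,y)\|\le A$ for all $i,x,y$. (A4) $\|\nabla g(x,y;\zeta_{\xi_i,j})-\nabla g^{(\xi_i)}(x,y)\|\le A$ and $\|\nabla^2g(x,y;\zeta_{\xi_i,j})-\nabla^2g^{(\xi_i)}(x,y)\|\le A$ for all $i,j,x,y$. (A5) $\|\nabla h(x;\xi_i)-\nabla h(x)\|\le A$ for all $i,x$. (A6) (with constants $\alpha,C$) For every interval length $k>0$: for every outer step $t$, $\big\|\frac1k\sum_{\tau=t}^{t+k-1}\nabla h(x_t;\xi_\tau)-\nabla h(x_t)\big\|^2\le k^{-\alpha}C^2$ and $\big\|\frac1k\sum_{\tau=t}^{t+k-1}\nabla f(x_t,y;\xi_\tau)-\nabla f(x_t,y)\big\|^2\le k^{-\alpha}C^2$ with $y$ the final inner iterate of outer step $t$; and for every outer step $t$ and inner step $l$, at the inner iterate $y_l$, $\big\|\frac1k\sum_{l'=l}^{l+k-1}\nabla g(x_t,y_l;\zeta_{l'})-\nabla g^{(\xi_t)}(x_t,y_l)\big\|^2\le k^{-\alpha}C^2$ and $\big\|\frac1k\sum_{l'=l}^{l+k-1}\nabla^2g(x_t,y_l;\zeta_{l'})-\nabla^2g^{(\xi_t)}(x_t,y_l)\big\|^2\le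 k^{-\alpha}C^2$, where $\xi_\tau$ and $\zeta_{l'}$ are the outer examples and (within outer step $t$) inner examples in the order used. **Algorithm WiOR-CBO.** Run $R$ epochs of $m$ outer steps ($T=Rm$). The outer example order gives $\xi_t\in\mathcal D_u$ for each outer step $t$ (by default a random permutation of $\mathcal D_u$ in each epoch). At outer step $t$, with $\xi_t=\xi_i$, start an inner loop from initial states $y^0,u^0$, consisting of $S$ inner epochs of $n_i$ steps, whose example order gives $\zeta_l\in\mathcal D_{l,\xi_i}$ for each inner step $l$ (by default a random permutation of $\mathcal D_{l,\xi_i}$ in each inner epoch). Each inner step performs $y_{l+1}=y_l-\gamma_l\nabla_yg(x_t,y_l;\zeta_l)$ and $u_{l+1}=u_l-\rho_l\big(\nabla_{y^2}g(x_t,y_l;\zeta_l)u_l-\nabla_yf(x_t,y_l;\xi_t)\big)$; at the start of each inner epoch after the first, $u$ is projected onto the centered ball of radius $\iota=C_f/\mu$. With $\hat y,\hat u$ the final inner iterates, set $x_{t+1}=x_t-\eta_t\big(\nabla_xf(x_t,\hat y;\xi_t)-\nabla_{xy}g^{(\xi_t)}(x_t,\hat y)\hat u\big)$.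
   Formalization: T_l = E_l·k is any number with T_l ≤ S·n_i for all i, not S·max n_i: for unequal n_i the claim fails, as small inner loops stop early. For α ≤ 2 the averaged bounds are needed only on intervals inside the run; for α > 2 on all intervals, with the example orders continued past the run. *)

theory Defs
  imports "HOL-Analysis.Analysis"
begin

section \<open>Euclidean spaces of variable dimension\<close>

text \<open>
  The constants of the theorem must not depend on the dimensions, so the dimensions have to be
  quantified inside a formula. All spaces \<open>\<real>\<^sup>n\<close> are therefore taken inside one type,
  the finitely supported real sequences with their Euclidean inner product.
\<close>

typedef rvec = "{v :: nat \<Rightarrow> real. finite {i. v i \<noteq> 0}}"
  morphisms coord Abs_rvec
  by (rule exI[of _ "\<lambda>_. 0"]) simp

setup_lifting type_definition_rvec

lemma rvec_eqI: "(\<And>i. coord v i = coord w i) \<Longrightarrow> v = w"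
  by (simp add: coord_inject[symmetric] fun_eq_iff)

lemma finite_coord: "finite {i. coord v i \<noteq> 0}"
  using coord[of v] by simp

instantiation rvec :: real_inner
begin

lift_definition zero_rvec :: rvec is "\<lambda>_. 0" by simp

lift_definition plus_rvec :: "rvec \<Rightarrow> rvec \<Rightarrow> rvec" is "\<lambda>v w i. v i + w i"
  by (erule (1) finite_subset[OF _ finite_UnI, rotated]) auto

lift_definition minus_rvec :: "rvec \<Rightarrow> rvec \<Rightarrow> rvec" is "\<lambda>v w i. v i - w i"
  by (erule (1) finite_subset[OF _ finite_UnI, rotated]) auto

lift_definition uminus_rvec :: "rvec \<Rightarrow> rvec" is "\<lambda>v i. - v i" by simp

lift_definition scaleR_rvec :: "real \<Rightarrow> rvec \<Rightarrow> rvec" is "\<lambda>c v i. c * v i"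
  by (erule finite_subset[rotated]) auto

definition inner_rvec :: "rvec \<Rightarrow> rvec \<Rightarrow> real"
  where "inner_rvec v w = (\<Sum>i | coord v i \<noteq> 0. coord v i * coord w i)"

definition norm_rvec :: "rvec \<Rightarrow> real"
  where "norm_rvec v = sqrt (inner v v)"

definition dist_rvec :: "rvec \<Rightarrow> rvec \<Rightarrow> real"
  where "dist_rvec v w = norm (v - w)"

definition sgn_rvec :: "rvec \<Rightarrow> rvec"
  where "sgn_rvec v = scaleR (inverse (norm v)) v"

definition uniformity_rvec :: "(rvec \<times> rvec) filter"
  where "uniformity_rvec = (INF e\<in>{0<..}. principal {(v, w). dist v w < e})"

definition open_rvec :: "rvec set \<Rightarrow> bool"
  where "open_rvec U \<longleftrightarrow> (\<forall>v\<in>U. \<forall>\<^sub>F (v', w) in uniformity. v' = v \<longrightarrow> w \<in> U)"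

lemma inner_rvec_superset:
  assumes "finite I" "{i. coord v i \<noteq> 0} \<subseteq> I"
  shows "inner v w = (\<Sum>i\<in>I. coord v i * coord w i)"
  unfolding inner_rvec_def by (rule sum.mono_neutral_left) (use assms in auto)

instance
proof
  fix a b c :: rvec and r s :: real
  show "a + b + c = a + (b + c)" "a + b = b + a" "0 + a = a" "- a + a = 0" "a - b = a + - b"
    by (rule rvec_eqI; transfer; simp)+
  show "r *\<^sub>R (a + b) = r *\<^sub>R a + r *\<^sub>R b" "(r + s) *\<^sub>R a = r *\<^sub>R a + s *\<^sub>R a"
    "r *\<^sub>R s *\<^sub>R a = (r * s) *\<^sub>R a" "1 *\<^sub>R a = a"
    by (rule rvec_eqI; transfer; simp add: algebra_simps)+
  let ?I = "{i. coord a i \<noteq> 0} \<union> {i. coord b i \<noteq> 0}"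
  have I: "finite ?I" using finite_coord by simp
  have sup: "{i. coord a i \<noteq> 0} \<subseteq> ?I" "{i. coord b i \<noteq> 0} \<subseteq> ?I"
      "{i. coord (a + b) i \<noteq> 0} \<subseteq> ?I" "{i. coord (r *\<^sub>R a) i \<noteq> 0} \<subseteq> ?I"
    by (auto simp: plus_rvec.rep_eq scaleR_rvec.rep_eq)
  note inn = inner_rvec_superset[OF I sup(1)] inner_rvec_superset[OF I sup(2)]
      inner_rvec_superset[OF I sup(3)] inner_rvec_superset[OF I sup(4)]
  show "inner a b = inner b a"
    by (simp add: inn mult.commute)
  show "inner (a + b) c = inner a c + inner b c"
    by (simp add: inn plus_rvec.rep_eq algebra_simps sum.distrib)
  show "inner (r *\<^sub>R a) b = r * inner a b"
    by (simp add: inn scaleR_rvec.rep_eq algebra_simps sum_distrib_left)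
  show "0 \<le> inner a a"
    by (simp add: inner_rvec_def sum_nonneg)
  have "inner a a = 0 \<longleftrightarrow> (\<forall>i\<in>{i. coord a i \<noteq> 0}. coord a i * coord a i = 0)"
    unfolding inner_rvec_def by (rule sum_nonneg_eq_0_iff) (auto simp: finite_coord)
  also have "\<dots> \<longleftrightarrow> (\<forall>i. coord a i = 0)" by auto
  also have "\<dots> \<longleftrightarrow> a = 0"
    by (auto intro!: rvec_eqI simp: zero_rvec.rep_eq)
  finally show "inner a a = 0 \<longleftrightarrow> a = 0" .
qed (simp_all add: norm_rvec_def dist_rvec_def sgn_rvec_def uniformity_rvec_def open_rvec_def)

end

definition Rn :: "nat \<Rightarrow> rvec set"
  where "Rn n = {v. \<forall>i\<ge>n. coord v i = 0}"


section \<open>Calculus relative to a subspace\<close>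

text \<open>
  A function on a subspace \<open>S\<close> is a function on the ambient type of which only the values on
  \<open>S\<close> matter. Gradients lie in \<open>S\<close>, which makes them unique. The derivative of the gradient
  is determined only on \<open>S\<close>, so the Hessian is only ever applied to vectors of \<open>S\<close>.
\<close>

definition has_gradient_on :: "'a::real_inner set \<Rightarrow> ('a \<Rightarrow> real) \<Rightarrow> 'a \<Rightarrow> 'a \<Rightarrow> bool"
  where "has_gradient_on S F x D \<longleftrightarrow> D \<in> S \<and> (F has_derivative (\<lambda>h. inner h D)) (at x within S)"

definition grad_on :: "'a::real_inner set \<Rightarrow> ('a \<Rightarrow> real) \<Rightarrow> 'a \<Rightarrow> 'a"
  where "grad_on S F x = (THE D. has_gradient_on S F x D)"

definition hess_on :: "'a::real_inner set \<Rightarrow> ('a \<Rightarrow> real) \<Rightarrow> 'a \<Rightarrow> 'a \<Rightarrow> 'a"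
  where "hess_on S F x = frechet_derivative (grad_on S F) (at x within S)"

definition twice_differentiable_on :: "'a::real_inner set \<Rightarrow> ('a \<Rightarrow> real) \<Rightarrow> bool"
  where "twice_differentiable_on S F \<longleftrightarrow>
    (\<forall>x\<in>S. (\<exists>D. has_gradient_on S F x D) \<and> grad_on S F differentiable (at x within S))"

definition smooth_on :: "'a::real_inner set \<Rightarrow> real \<Rightarrow> ('a \<Rightarrow> real) \<Rightarrow> bool"
  where "smooth_on S L F \<longleftrightarrow>
    (\<forall>x\<in>S. \<exists>D. has_gradient_on S F x D) \<and> L-lipschitz_on S (grad_on S F)"

definition strongly_convex_on :: "'a::real_inner set \<Rightarrow> real \<Rightarrow> ('a \<Rightarrow> real) \<Rightarrow> bool"
  where "strongly_convex_on S mu F \<longleftrightarrow>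
    (\<forall>x\<in>S. \<forall>y\<in>S. \<forall>t\<in>{0..1}.
      F ((1 - t) *\<^sub>R x + t *\<^sub>R y) \<le>
        (1 - t) * F x + t * F y - mu / 2 * t * (1 - t) * (norm (x - y))\<^sup>2)"

text \<open>The operator norm on \<open>S\<close>; it agrees with \<^const>\<open>onorm\<close> if \<open>S = UNIV\<close>.\<close>

definition onorm_on :: "'a::real_normed_vector set \<Rightarrow> ('a \<Rightarrow> 'b::real_normed_vector) \<Rightarrow> real"
  where "onorm_on S A = (SUP v\<in>S. norm (A v) / norm v)"


section \<open>Conditional bilevel problems\<close>

text \<open>
  The example \<open>\<xi>\<^sub>i\<close> is represented by its index \<open>i < num_outer P\<close>, and
  \<open>\<zeta>\<close> number \<open>j\<close> of its inner dataset by the pair of \<open>i\<close> and \<open>j < num_inner P i\<close>.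
  Thus \<open>f(x,y;\<xi>\<^sub>i)\<close> is \<open>outer_fun P i (x, y)\<close>, and \<open>g\<close> at the \<open>j\<close>-th inner example
  of \<open>\<xi>\<^sub>i\<close> is \<open>inner_fun P i j (x, y)\<close>.
\<close>

record cbo =
  dim_x :: nat
  dim_y :: nat
  num_outer :: nat
  num_inner :: "nat \<Rightarrow> nat"
  outer_fun :: "nat \<Rightarrow> rvec \<times> rvec \<Rightarrow> real"
  inner_fun :: "nat \<Rightarrow> nat \<Rightarrow> rvec \<times> rvec \<Rightarrow> real"

definition X_space :: "cbo \<Rightarrow> rvec set"
  where "X_space P = Rn (dim_x P)"

definition Y_space :: "cbo \<Rightarrow> rvec set"
  where "Y_space P = Rn (dim_y P)"

definition Z_space :: "cbo \<Rightarrow> (rvec \<times> rvec) set"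
  where "Z_space P = X_space P \<times> Y_space P"

definition grad_xy :: "cbo \<Rightarrow> (rvec \<times> rvec \<Rightarrow> real) \<Rightarrow> rvec \<times> rvec \<Rightarrow> rvec \<times> rvec"
  where "grad_xy P F = grad_on (Z_space P) F"

definition grad_x :: "cbo \<Rightarrow> (rvec \<times> rvec \<Rightarrow> real) \<Rightarrow> rvec \<times> rvec \<Rightarrow> rvec"
  where "grad_x P F z = fst (grad_xy P F z)"

definition grad_y :: "cbo \<Rightarrow> (rvec \<times> rvec \<Rightarrow> real) \<Rightarrow> rvec \<times> rvec \<Rightarrow> rvec"
  where "grad_y P F z = snd (grad_xy P F z)"

definition hess :: "cbo \<Rightarrow> (rvec \<times> rvec \<Rightarrow> real) \<Rightarrow> rvec \<times> rvec \<Rightarrow> rvec \<times> rvec \<Rightarrow> rvec \<times> rvec"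
  where "hess P F = hess_on (Z_space P) F"

text \<open>The blocks of the Hessian: \<open>\<nabla>\<^sub>x\<^sub>y F\<close> maps \<open>Y_space P\<close> to \<open>X_space P\<close>.\<close>

definition hess_xy :: "cbo \<Rightarrow> (rvec \<times> rvec \<Rightarrow> real) \<Rightarrow> rvec \<times> rvec \<Rightarrow> rvec \<Rightarrow> rvec"
  where "hess_xy P F z v = fst (hess P F z (0, v))"

definition hess_yy :: "cbo \<Rightarrow> (rvec \<times> rvec \<Rightarrow> real) \<Rightarrow> rvec \<times> rvec \<Rightarrow> rvec \<Rightarrow> rvec"
  where "hess_yy P F z v = snd (hess P F z (0, v))"

definition outer_mean :: "cbo \<Rightarrow> rvec \<times> rvec \<Rightarrow> real"
  where "outer_mean P z = (\<Sum>i<num_outer P. outer_fun P i z) / real (num_outer P)"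

definition inner_obj :: "cbo \<Rightarrow> nat \<Rightarrow> rvec \<times> rvec \<Rightarrow> real"
  where "inner_obj P i z = (\<Sum>j<num_inner P i. inner_fun P i j z) / real (num_inner P i)"

definition y_star :: "cbo \<Rightarrow> nat \<Rightarrow> rvec \<Rightarrow> rvec"
  where "y_star P i x = arg_min_on (\<lambda>y. inner_obj P i (x, y)) (Y_space P)"

definition u_star :: "cbo \<Rightarrow> nat \<Rightarrow> rvec \<Rightarrow> rvec"
  where "u_star P i x =
    inv_into (Y_space P) (hess_yy P (inner_obj P i) (x, y_star P i x))
      (grad_y P (outer_fun P i) (x, y_star P i x))"

definition h_ex :: "cbo \<Rightarrow> nat \<Rightarrow> rvec \<Rightarrow> real"
  where "h_ex P i x = outer_fun P i (x, y_star P i x)"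

definition h_obj :: "cbo \<Rightarrow> rvec \<Rightarrow> real"
  where "h_obj P x = (\<Sum>i<num_outer P. h_ex P i x) / real (num_outer P)"

definition grad_h_ex :: "cbo \<Rightarrow> nat \<Rightarrow> rvec \<Rightarrow> rvec"
  where "grad_h_ex P i = grad_on (X_space P) (h_ex P i)"

definition grad_h :: "cbo \<Rightarrow> rvec \<Rightarrow> rvec"
  where "grad_h P = grad_on (X_space P) (h_obj P)"

definition cbo_problem :: "cbo \<Rightarrow> bool"
  where "cbo_problem P \<longleftrightarrow>
    0 < dim_x P \<and> 0 < dim_y P \<and> 0 < num_outer P \<and> (\<forall>i<num_outer P. 0 < num_inner P i) \<and>
    bdd_below (h_obj P ` X_space P)"


subsection \<open>Assumptions\<close>

definition outer_regular :: "cbo \<Rightarrow> real \<Rightarrow> real \<Rightarrow> bool"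
  where "outer_regular P L Cf \<longleftrightarrow>
    (\<forall>i<num_outer P.
      smooth_on (Z_space P) L (outer_fun P i) \<and>
      (\<forall>z\<in>Z_space P. norm (grad_y P (outer_fun P i) z) \<le> Cf))"

definition inner_regular :: "cbo \<Rightarrow> real \<Rightarrow> real \<Rightarrow> real \<Rightarrow> real \<Rightarrow> bool"
  where "inner_regular P L mu Lxy Lyy \<longleftrightarrow>
    (\<forall>i<num_outer P. \<forall>j<num_inner P i. let G = inner_fun P i j in
      smooth_on (Z_space P) L G \<and>
      twice_differentiable_on (Z_space P) G \<and>
      (\<forall>x\<in>X_space P. strongly_convex_on (Y_space P) mu (\<lambda>y. G (x, y))) \<and>
      (\<forall>z\<in>Z_space P. \<forall>w\<in>Z_space P.
        onorm_on (Y_space P) (\<lambda>v. hess_xy P G z v - hess_xy P G w v) \<le> Lxy * norm (z - w) \<and>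
        onorm_on (Y_space P) (\<lambda>v. hess_yy P G z v - hess_yy P G w v) \<le> Lyy * norm (z - w)))"

definition bounded_deviation :: "cbo \<Rightarrow> real \<Rightarrow> bool"
  where "bounded_deviation P A \<longleftrightarrow>
    (\<forall>i<num_outer P.
      (\<forall>z\<in>Z_space P. norm (grad_xy P (outer_fun P i) z - grad_xy P (outer_mean P) z) \<le> A) \<and>
      (\<forall>j<num_inner P i. \<forall>z\<in>Z_space P.
        norm (grad_xy P (inner_fun P i j) z - grad_xy P (inner_obj P i) z) \<le> A \<and>
        onorm_on (Z_space P) (\<lambda>v. hess P (inner_fun P i j) z v - hess P (inner_obj P i) z v) \<le> A) \<and>
      (\<forall>x\<in>X_space P. norm (grad_h_ex P i x - grad_h P x) \<le> A))"

definition h_smoothness_constant :: "cbo \<Rightarrow> real \<Rightarrow> bool"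
  where "h_smoothness_constant P Lbar \<longleftrightarrow>
    0 < Lbar \<and> smooth_on (X_space P) Lbar (h_obj P) \<and>
    (\<forall>i<num_outer P. smooth_on (X_space P) Lbar (h_ex P i))"



section \<open>The algorithm WiOR-CBO\<close>

definition proj_ball :: "real \<Rightarrow> rvec \<Rightarrow> rvec"
  where "proj_ball r u = arg_min_on (dist u) (cball 0 r)"

text \<open>
  The pair \<open>(y\<^sub>l, u\<^sub>l)\<close> in the inner loop for the outer example \<open>i\<close> at \<open>x\<close>. Step \<open>l\<close> uses
  the inner example \<open>ze l\<close>. Since an inner epoch has \<open>num_inner P i\<close> steps, step \<open>l > 0\<close>
  starts an inner epoch after the first iff \<open>num_inner P i\<close> divides \<open>l\<close>.
\<close>

primrec inner_iter ::
  "cbo \<Rightarrow> real \<Rightarrow> (nat \<Rightarrow> real) \<Rightarrow> (nat \<Rightarrow> real) \<Rightarrow> rvec \<Rightarrow> rvec \<Rightarrow>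
   nat \<Rightarrow> (nat \<Rightarrow> nat) \<Rightarrow> rvec \<Rightarrow> nat \<Rightarrow> rvec \<times> rvec"
  where
    "inner_iter P r gam rho y0 u0 i ze x 0 = (y0, u0)"
  | "inner_iter P r gam rho y0 u0 i ze x (Suc l) =
      (let (y, u) = inner_iter P r gam rho y0 u0 i ze x l;
           u' = (if 0 < l \<and> num_inner P i dvd l then proj_ball r u else u);
           G = inner_fun P i (ze l)
       in (y - gam l *\<^sub>R grad_y P G (x, y),
           u' - rho l *\<^sub>R (hess_yy P G (x, y) u' - grad_y P (outer_fun P i) (x, y))))"

text \<open>
  An example order consists of \<open>xi\<close>, where \<open>xi t\<close> is the outer example of step \<open>t\<close>, and \<open>ze\<close>,
  where \<open>ze t l\<close> is the inner example of the inner step \<open>l\<close> of the outer step \<open>t\<close>. A run uses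
  the initial parts \<open>t < T\<close> and \<open>l < S * num_inner P (xi t)\<close> of these sequences.
\<close>

definition example_order :: "cbo \<Rightarrow> (nat \<Rightarrow> nat) \<Rightarrow> (nat \<Rightarrow> nat \<Rightarrow> nat) \<Rightarrow> bool"
  where "example_order P xi ze \<longleftrightarrow>
    (\<forall>t. xi t < num_outer P \<and> (\<forall>l. ze t l < num_inner P (xi t)))"

primrec outer_iter ::
  "cbo \<Rightarrow> real \<Rightarrow> nat \<Rightarrow> (nat \<Rightarrow> real) \<Rightarrow> (nat \<Rightarrow> real) \<Rightarrow> (nat \<Rightarrow> real) \<Rightarrow> rvec \<Rightarrow> rvec \<Rightarrow>
   (nat \<Rightarrow> nat) \<Rightarrow> (nat \<Rightarrow> nat \<Rightarrow> nat) \<Rightarrow> rvec \<Rightarrow> nat \<Rightarrow> rvec"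
  where
    "outer_iter P r S eta gam rho y0 u0 xi ze x0 0 = x0"
  | "outer_iter P r S eta gam rho y0 u0 xi ze x0 (Suc t) =
      (let x = outer_iter P r S eta gam rho y0 u0 xi ze x0 t;
           i = xi t;
           (y, u) = inner_iter P r gam rho y0 u0 i (ze t) x (S * num_inner P i)
       in x - eta t *\<^sub>R (grad_x P (outer_fun P i) (x, y) - hess_xy P (inner_obj P i) (x, y) u))"

text \<open>
  The intervals \<open>{a..<a + s}\<close> over which averages are bounded, for a sequence of examples whose first
  \<open>N\<close> members are used. If \<open>al \<le> 2\<close>, these are the intervals of used examples. If \<open>al > 2\<close>,
  every interval counts, including those that leave the used part: without them the
  bounds do not control sums over \<open>s < k\<close> examples by \<open>C * k powr (1 - al / 2)\<close>, and the
  theorem would fail for large \<open>al\<close>.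
\<close>

definition averaging_interval :: "real \<Rightarrow> nat \<Rightarrow> nat \<Rightarrow> nat \<Rightarrow> bool"
  where "averaging_interval al N a s \<longleftrightarrow> 0 < s \<and> (a + s \<le> N \<or> 2 < al)"

text \<open>
  The averaged-gradient bounds along the first \<open>T\<close> outer steps of a run, where \<open>x t\<close> is the outer
  iterate, \<open>y t l\<close> the inner iterate of the inner step \<open>l\<close> of the outer step \<open>t\<close>, and \<open>N t\<close> the
  number of inner steps of the outer step \<open>t\<close>.
\<close>

definition averaged_bounds ::
  "cbo \<Rightarrow> real \<Rightarrow> real \<Rightarrow> (nat \<Rightarrow> nat) \<Rightarrow> (nat \<Rightarrow> nat \<Rightarrow> nat) \<Rightarrow>
   (nat \<Rightarrow> rvec) \<Rightarrow> (nat \<Rightarrow> nat \<Rightarrow> rvec) \<Rightarrow> nat \<Rightarrow> (nat \<Rightarrow> nat) \<Rightarrow> bool"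
  where "averaged_bounds P al C xi ze x y T N \<longleftrightarrow>
    (\<forall>t<T.
      (\<forall>s. averaging_interval al T t s \<longrightarrow>
        (norm ((\<Sum>\<tau>=t..<t+s. grad_h_ex P (xi \<tau>) (x t)) /\<^sub>R real s - grad_h P (x t)))\<^sup>2
          \<le> real s powr (-al) * C\<^sup>2 \<and>
        (let z = (x t, y t (N t)) in
          (norm ((\<Sum>\<tau>=t..<t+s. grad_xy P (outer_fun P (xi \<tau>)) z) /\<^sub>R real s
                 - grad_xy P (outer_mean P) z))\<^sup>2
            \<le> real s powr (-al) * C\<^sup>2)) \<and>
      (\<forall>l<N t. \<forall>s. averaging_interval al (N t) l s \<longrightarrow>
        (let z = (x t, y t l); G = inner_fun P (xi t); Gm = inner_obj P (xi t) in
          (norm ((\<Sum>l'=l..<l+s. grad_xy P (G (ze t l')) z) /\<^sub>R real s - grad_xy P Gm z))\<^sup>2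
            \<le> real s powr (-al) * C\<^sup>2 \<and>
          (onorm_on (Z_space P)
              (\<lambda>v. (\<Sum>l'=l..<l+s. hess P (G (ze t l')) z v) /\<^sub>R real s - hess P Gm z v))\<^sup>2
            \<le> real s powr (-al) * C\<^sup>2)))"

text \<open>
  \<open>Tl\<close> inner steps are performed in every outer step. If the inner datasets have equal
  sizes, \<open>Tl = S * (MAX i\<in>{..<num_outer P}. num_inner P i)\<close> is allowed. For unequal sizes this
  maximum would be wrong: the inner loops of the smaller datasets stop earlier, and their error
  is not contracted as often as the exponent in the theorem says.
\<close>

definition common_inner_steps :: "cbo \<Rightarrow> nat \<Rightarrow> nat \<Rightarrow> bool"
  where "common_inner_steps P S Tl \<longleftrightarrow> (\<forall>i<num_outer P. Tl \<le> S * num_inner P i)"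

end

theory Submission
  imports Defs
begin

text \<open>
  Both loops are SGD with a step of order \<open>1 / k\<close>. Over a block of \<open>k\<close> steps they are compared with one
  gradient step at the start of the block: the drift within the block is a fraction of the
  gradient, and the sums of example gradients over the block differ from their means by
  \<open>N = \<bar>C\<bar> k\<^bsup>-al/2\<^esup>\<close> per step.

  In the inner loop the error of \<open>y\<close> contracts blockwise because the averaged objective is strongly convex,
  and the noise in the linear system for \<open>u\<close> acts only on the fixed vector \<open>u\<^sup>*\<close>, so it is removed by
  summation by parts. The projection has an effect at most once, since the ball of radius \<open>Cf / mu\<close> is
  invariant under the steps for \<open>u\<close>. A weighted sum of both errors then contracts up to \<open>O(N)\<close>, which
  bounds the bias of the hypergradient estimates. The descent inequality for \<open>h\<close>, summed over the outer
  blocks, gives the theorem.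
\<close>

section \<open>Calculus on a subspace\<close>

text \<open>The averaging bounds control whole sums at the iterate where an interval starts, but the
  drift inside a block involves every partial sum of its examples. Each partial sum is therefore
  charged with twice the noise of a full block plus a multiple of the drift itself, and the steps
  are short enough to absorb this multiple. The two inner variables need different treatment. For
  \<open>y\<close> only the mean over a block is compared with the exact gradient step; the choice
  \<open>sg * L * L = mu / 512\<close> makes all second-order terms small multiples of the
  contraction \<open>sg * mu\<close>. For \<open>u\<close> every single step already contracts,
  because each example Hessian is symmetric with quadratic form between \<open>mu\<close> and
  \<open>L\<close>, and only the inhomogeneity is noisy. Inner errors are kept as norms and squared
  at the very end, so that noise adds up linearly. The number of inner steps need not be a multiple
  of \<open>k\<close>: the incomplete block is placed at the beginning, where it costs a constant
  factor only.\<close>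

text \<open>Because the line stays in \<open>S\<close>, differentiability within \<open>S\<close>
  becomes ordinary differentiability in \<open>t\<close>. In this way uniqueness and the mean value
  theorem in one variable reach functions on a subspace.\<close>

lemma has_vector_derivative_along_line:
  fixes f :: "'a::real_normed_vector \<Rightarrow> 'b::real_normed_vector"
  assumes "subspace S" "x \<in> S" "v \<in> S"
    and "(f has_derivative A) (at (x + t *\<^sub>R v) within S)"
  shows "((\<lambda>t. f (x + t *\<^sub>R v)) has_vector_derivative A v) (at t)"
proof -
  interpret A: bounded_linear A using assms(4) by (rule has_derivative_bounded_linear)
  have d: "((\<lambda>t. x + t *\<^sub>R v) has_derivative (\<lambda>h. h *\<^sub>R v)) (at t)"
    by (auto intro!: derivative_eq_intros)
  have sub: "range (\<lambda>t. x + t *\<^sub>R v) \<subseteq> S"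
    using assms(1-3) by (auto intro!: subspace_add subspace_scale)
  have "((\<lambda>t. f (x + t *\<^sub>R v)) has_derivative (\<lambda>h. A (h *\<^sub>R v))) (at t)"
    by (rule has_derivative_in_compose[OF d has_derivative_subset[OF assms(4) sub]])
  then show ?thesis
    by (simp add: has_vector_derivative_def A.scaleR)
qed

lemma has_derivative_unique_on_subspace:
  fixes f :: "'a::real_normed_vector \<Rightarrow> 'b::real_normed_vector"
  assumes "subspace S" "x \<in> S" "v \<in> S"
    and "(f has_derivative A) (at x within S)" "(f has_derivative B) (at x within S)"
  shows "A v = B v"
proof -
  have "((\<lambda>t. f (x + t *\<^sub>R v)) has_vector_derivative A v) (at 0)"
    "((\<lambda>t. f (x + t *\<^sub>R v)) has_vector_derivative B v) (at 0)"
    by (rule has_vector_derivative_along_line[OF assms(1-3)]; use assms in simp)+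
  then show ?thesis by (rule vector_derivative_unique_at)
qed

lemma has_gradient_on_unique:
  assumes "subspace S" "x \<in> S" "has_gradient_on S F x D" "has_gradient_on S F x D'"
  shows "D = D'"
proof -
  have D: "D \<in> S" "D' \<in> S" using assms by (auto simp: has_gradient_on_def)
  then have "D - D' \<in> S" using assms(1) by (simp add: subspace_diff)
  then have "inner (D - D') D = inner (D - D') D'"
    using has_derivative_unique_on_subspace[OF assms(1,2)] assms(3,4)
    unfolding has_gradient_on_def by metis
  then have "inner (D - D') (D - D') = 0" by (simp add: inner_diff_right)
  then show ?thesis by simp
qed

lemma grad_on_eqI:
  assumes "subspace S" "x \<in> S" "has_gradient_on S F x D"
  shows "grad_on S F x = D"
  unfolding grad_on_def using assms has_gradient_on_unique by blast

lemma has_gradient_grad_on: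
  assumes "subspace S" "x \<in> S" "\<exists>D. has_gradient_on S F x D"
  shows "has_gradient_on S F x (grad_on S F x)"
  using assms grad_on_eqI by metis

lemma grad_on_line_derivative:
  assumes "subspace S" "x \<in> S" "v \<in> S" "has_gradient_on S F (x + t *\<^sub>R v) D"
  shows "((\<lambda>t. F (x + t *\<^sub>R v)) has_field_derivative inner v D) (at t)"
  using has_vector_derivative_along_line[OF assms(1-3), of F "\<lambda>h. inner h D" t] assms(4)
  by (simp add: has_gradient_on_def has_real_derivative_iff_has_vector_derivative)

section \<open>Symmetry of the derivative of a gradient\<close>

text \<open>The mean value theorem along \<open>v\<close> turns the second difference into
  \<open>t\<close> times the \<open>v\<close>-component of a difference of two gradients, taken at
  distance O(t) from \<open>x\<close>. Both are then expanded at \<open>x\<close>, so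
  differentiability of the gradient at this one point suffices.\<close>

lemma second_difference_approx:
  fixes g :: "'a::real_inner \<Rightarrow> 'a"
  assumes S: "subspace S" "x \<in> S" "u \<in> S" "v \<in> S"
    and g: "\<And>z. z \<in> S \<Longrightarrow> has_gradient_on S F z (g z)"
    and A: "(g has_derivative A) (at x within S)"
    and "0 < e"
  shows "\<exists>d>0. \<forall>t. 0 < t \<and> t < d \<longrightarrow>
    \<bar>F (x + t *\<^sub>R u + t *\<^sub>R v) - F (x + t *\<^sub>R u) - F (x + t *\<^sub>R v) + F x - t\<^sup>2 * inner (A u) v\<bar>
      \<le> t\<^sup>2 * e"
proof -
  interpret A: bounded_linear A using A by (rule has_derivative_bounded_linear)
  define c where "c = norm u + norm v + 1"
  have c: "0 < c" by (simp add: c_def add_nonneg_pos)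
  \<comment> \<open>Two remainders of size at most \<open>e' * (t * c)\<close>, paired with
    \<open>v\<close> of norm at most \<open>c\<close> and multiplied by \<open>t\<close>, then add
    up to \<open>t\<^sup>2 * e\<close>.\<close>
  define e' where "e' = e / (2 * c * c)"
  have e': "0 < e'" using \<open>0 < e\<close> c by (simp add: e'_def)
  obtain d where d: "0 < d"
    "\<And>z. z \<in> S \<Longrightarrow> norm (z - x) < d \<Longrightarrow> norm (g z - g x - A (z - x)) \<le> e' * norm (z - x)"
    using A e' unfolding has_derivative_within_alt by meson
  show ?thesis
  proof (intro exI[of _ "d / c"] conjI allI impI)
    show "0 < d / c" using d c by simp
    fix t assume t: "0 < t \<and> t < d / c"
    have mem: "x + t *\<^sub>R u + s *\<^sub>R v \<in> S" "x + s *\<^sub>R v \<in> S" for s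
      using S by (auto intro!: subspace_add subspace_scale)
    have "\<exists>s. 0 < s \<and> s < t \<and>
      (F (x + t *\<^sub>R u + t *\<^sub>R v) - F (x + t *\<^sub>R v)) - (F (x + t *\<^sub>R u + 0 *\<^sub>R v) - F (x + 0 *\<^sub>R v))
        = (t - 0) * (inner v (g (x + t *\<^sub>R u + s *\<^sub>R v)) - inner v (g (x + s *\<^sub>R v)))"
      by (rule MVT2[where f = "\<lambda>s. F (x + t *\<^sub>R u + s *\<^sub>R v) - F (x + s *\<^sub>R v)"])
        (use t S mem g in \<open>auto intro!: DERIV_diff grad_on_line_derivative subspace_add subspace_scale\<close>)
    then obtain s where s: "0 < s" "s < t" and
      eq: "F (x + t *\<^sub>R u + t *\<^sub>R v) - F (x + t *\<^sub>R u) - F (x + t *\<^sub>R v) + F x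
        = t * inner v (g (x + t *\<^sub>R u + s *\<^sub>R v) - g (x + s *\<^sub>R v))"
      by (auto simp: inner_diff_right)
    define r where "r w = g (x + w) - g x - A w" for w
    have r: "norm (r w) \<le> e' * (t * c)" if "x + w \<in> S" "norm w \<le> t * c - t" for w
    proof -
      have tc: "t * c < d" using t c by (simp add: field_simps)
      then have "norm w < d" using that t by linarith
      then have "norm (r w) \<le> e' * norm w"
        using d(2)[of "x + w"] that by (simp add: r_def)
      also have "\<dots> \<le> e' * (t * c)" using e' that t by (intro mult_left_mono) auto
      finally show ?thesis .
    qed
    have nsv: "norm (s *\<^sub>R v) \<le> t * norm v" using s by (simp add: mult_right_mono)
    have "norm (t *\<^sub>R u + s *\<^sub>R v) \<le> t * norm u + t * norm v"
      using norm_triangle_ineq[of "t *\<^sub>R u" "s *\<^sub>R v"] nsv t by simp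
    then have r1: "norm (r (t *\<^sub>R u + s *\<^sub>R v)) \<le> e' * (t * c)"
      by (intro r) (use mem in \<open>auto simp: c_def algebra_simps\<close>)
    have "t * norm v \<le> t * norm u + t * norm v" using t by simp
    then have r2: "norm (r (s *\<^sub>R v)) \<le> e' * (t * c)"
      by (intro r) (use mem nsv in \<open>auto simp: c_def algebra_simps\<close>)
    have "g (x + t *\<^sub>R u + s *\<^sub>R v) - g (x + s *\<^sub>R v)
      = t *\<^sub>R A u + (r (t *\<^sub>R u + s *\<^sub>R v) - r (s *\<^sub>R v))"
      by (simp add: r_def A.add A.scaleR add.assoc)
    then have "F (x + t *\<^sub>R u + t *\<^sub>R v) - F (x + t *\<^sub>R u) - F (x + t *\<^sub>R v) + F x - t\<^sup>2 * inner (A u) v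
      = t * inner v (t *\<^sub>R A u + (r (t *\<^sub>R u + s *\<^sub>R v) - r (s *\<^sub>R v))) - t\<^sup>2 * inner (A u) v"
      unfolding eq by (simp only:)
    also have "\<dots> = t * inner v (r (t *\<^sub>R u + s *\<^sub>R v) - r (s *\<^sub>R v))"
      by (simp only: inner_add_right inner_scaleR_right power2_eq_square inner_commute[of v "A u"])
        (simp add: algebra_simps)
    also have "\<bar>\<dots>\<bar> \<le> t * (norm v * norm (r (t *\<^sub>R u + s *\<^sub>R v) - r (s *\<^sub>R v)))"
      using t Cauchy_Schwarz_ineq2 by (simp add: abs_mult)
    also have "\<dots> \<le> t * (c * (e' * (t * c) + e' * (t * c)))"
      using t r1 r2 norm_triangle_ineq4[of "r (t *\<^sub>R u + s *\<^sub>R v)" "r (s *\<^sub>R v)"] c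
      by (intro mult_left_mono mult_mono) (auto simp: c_def)
    also have "\<dots> = t\<^sup>2 * e" using c by (simp add: e'_def power2_eq_square field_simps)
    finally show "\<bar>F (x + t *\<^sub>R u + t *\<^sub>R v) - F (x + t *\<^sub>R u) - F (x + t *\<^sub>R v) + F x - t\<^sup>2 * inner (A u) v\<bar>
      \<le> t\<^sup>2 * e" .
  qed
qed

text \<open>The second difference is symmetric in \<open>u\<close> and \<open>v\<close>, and divided
  by \<open>t\<^sup>2\<close> it approximates both inner products.\<close>

lemma derivative_of_gradient_symmetric:
  fixes g :: "'a::real_inner \<Rightarrow> 'a"
  assumes S: "subspace S" "x \<in> S" "u \<in> S" "v \<in> S"
    and g: "\<And>z. z \<in> S \<Longrightarrow> has_gradient_on S F z (g z)"
    and A: "(g has_derivative A) (at x within S)"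
  shows "inner (A u) v = inner (A v) u"
proof -
  have "\<bar>inner (A u) v - inner (A v) u\<bar> \<le> 0 + e" if "0 < e" for e
  proof -
    have "0 < e / 2" using that by simp
    from second_difference_approx[OF S g A this] second_difference_approx[OF S(1,2,4,3) g A this]
    obtain d1 d2 where d: "0 < d1" "0 < d2"
      "\<And>t. 0 < t \<and> t < d1 \<Longrightarrow> \<bar>F (x + t *\<^sub>R u + t *\<^sub>R v) - F (x + t *\<^sub>R u) - F (x + t *\<^sub>R v) + F x
        - t\<^sup>2 * inner (A u) v\<bar> \<le> t\<^sup>2 * (e / 2)"
      "\<And>t. 0 < t \<and> t < d2 \<Longrightarrow> \<bar>F (x + t *\<^sub>R v + t *\<^sub>R u) - F (x + t *\<^sub>R v) - F (x + t *\<^sub>R u) + F x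
        - t\<^sup>2 * inner (A v) u\<bar> \<le> t\<^sup>2 * (e / 2)"
      by blast
    define t where "t = min d1 d2 / 2"
    have t: "0 < t" "t < d1" "t < d2" using d by (auto simp: t_def)
    have com: "x + t *\<^sub>R v + t *\<^sub>R u = x + t *\<^sub>R u + t *\<^sub>R v" by (simp add: algebra_simps)
    have "\<bar>t\<^sup>2 * inner (A u) v - t\<^sup>2 * inner (A v) u\<bar> \<le> t\<^sup>2 * (e / 2) + t\<^sup>2 * (e / 2)"
      using d(3)[of t] d(4)[of t] t unfolding com by linarith
    then have "t\<^sup>2 * \<bar>inner (A u) v - inner (A v) u\<bar> \<le> t\<^sup>2 * e"
      using t by (simp add: abs_mult flip: right_diff_distrib)
    then show ?thesis using t by simp
  qed
  then have "\<bar>inner (A u) v - inner (A v) u\<bar> \<le> 0" by (rule field_le_epsilon)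
  then show ?thesis by simp
qed

section \<open>Properties that pass from difference quotients to derivatives\<close>

text \<open>Closed conditions on the quotients survive this limit. It is used for values in a closed
  subspace, Lipschitz bounds, monotonicity and the gradient inequality of a strongly convex
  function.\<close>

lemma directional_derivative_limit:
  fixes g :: "'a::real_normed_vector \<Rightarrow> 'b::real_normed_vector"
  assumes S: "subspace S" "x \<in> S" "v \<in> S"
    and A: "(g has_derivative A) (at x within S)"
  shows "((\<lambda>t. (g (x + t *\<^sub>R v) - g x) /\<^sub>R t) \<longlongrightarrow> A v) (at_right 0)"
proof -
  have "((\<lambda>t. g (x + t *\<^sub>R v)) has_vector_derivative A v) (at 0)"
    by (rule has_vector_derivative_along_line[OF S]) (use A in simp)
  then have lim: "((\<lambda>h. norm (g (x + h *\<^sub>R v) - g x - h *\<^sub>R A v) / \<bar>h\<bar>) \<longlongrightarrow> 0) (at 0)"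
    by (simp add: has_vector_derivative_def has_derivative_at)
  have "((\<lambda>h. (g (x + h *\<^sub>R v) - g x) /\<^sub>R h - A v) \<longlongrightarrow> 0) (at_right 0)"
  proof (rule tendsto_norm_zero_cancel, rule Lim_transform_eventually)
    show "((\<lambda>h. norm (g (x + h *\<^sub>R v) - g x - h *\<^sub>R A v) / \<bar>h\<bar>) \<longlongrightarrow> 0) (at_right 0)"
      by (rule filterlim_mono[OF lim]) (auto simp: at_within_le_at)
    show "\<forall>\<^sub>F h in at_right 0. norm (g (x + h *\<^sub>R v) - g x - h *\<^sub>R A v) / \<bar>h\<bar>
      = norm ((g (x + h *\<^sub>R v) - g x) /\<^sub>R h - A v)"
    proof (rule eventually_at_rightI[of 0 1])
      fix h :: real assume h: "h \<in> {0<..<1}"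
      have "norm ((g (x + h *\<^sub>R v) - g x) /\<^sub>R h - A v)
        = norm ((g (x + h *\<^sub>R v) - g x - h *\<^sub>R A v) /\<^sub>R h)"
        using h by (simp add: scaleR_diff_right)
      then show "norm (g (x + h *\<^sub>R v) - g x - h *\<^sub>R A v) / \<bar>h\<bar>
        = norm ((g (x + h *\<^sub>R v) - g x) /\<^sub>R h - A v)"
        by (simp add: divide_inverse mult.commute)
    qed simp
  qed
  then show ?thesis using LIM_zero_iff by blast
qed

lemma derivative_in_closed_subspace:
  fixes g :: "'a::real_normed_vector \<Rightarrow> 'b::real_normed_vector"
  assumes S: "subspace S" "x \<in> S" "v \<in> S"
    and A: "(g has_derivative A) (at x within S)"
    and W: "subspace W" "closed W" "\<And>z. z \<in> S \<Longrightarrow> g z \<in> W"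
  shows "A v \<in> W"
proof (rule Lim_in_closed_set[OF W(2) _ _ directional_derivative_limit[OF S A]])
  show "\<forall>\<^sub>F t in at_right 0. (g (x + t *\<^sub>R v) - g x) /\<^sub>R t \<in> W"
    using S W by (intro always_eventually allI) (auto intro!: subspace_scale subspace_diff subspace_add)
qed simp

lemma derivative_bound_of_lipschitz_on:
  fixes g :: "'a::real_normed_vector \<Rightarrow> 'b::real_normed_vector"
  assumes S: "subspace S" "x \<in> S" "v \<in> S"
    and lip: "L-lipschitz_on S g"
    and A: "(g has_derivative A) (at x within S)"
  shows "norm (A v) \<le> L * norm v"
proof (rule tendsto_upperbound[OF tendsto_norm[OF directional_derivative_limit[OF S A]]])
  show "\<forall>\<^sub>F t in at_right 0. norm ((g (x + t *\<^sub>R v) - g x) /\<^sub>R t) \<le> L * norm v"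
  proof (rule eventually_at_rightI[of 0 1])
    fix t :: real assume t: "t \<in> {0<..<1}"
    have "norm (g (x + t *\<^sub>R v) - g x) \<le> L * norm (t *\<^sub>R v)"
      using lipschitz_onD[OF lip, of "x + t *\<^sub>R v" x] S
      by (simp add: dist_norm subspace_add subspace_scale)
    then have "inverse t * norm (g (x + t *\<^sub>R v) - g x) \<le> inverse t * (L * norm (t *\<^sub>R v))"
      using t by (intro mult_left_mono) auto
    also have "\<dots> = L * norm v" using t by simp
    finally show "norm ((g (x + t *\<^sub>R v) - g x) /\<^sub>R t) \<le> L * norm v"
      using t by simp
  qed simp
qed simp

lemma derivative_monotone_on:
  fixes g :: "'a::real_inner \<Rightarrow> 'a"
  assumes S: "subspace S" "x \<in> S" "v \<in> S"
    and mono: "\<And>t. 0 < t \<Longrightarrow> mu * (norm (t *\<^sub>R v))\<^sup>2 \<le> inner (g (x + t *\<^sub>R v) - g x) (t *\<^sub>R v)"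
    and A: "(g has_derivative A) (at x within S)"
  shows "mu * (norm v)\<^sup>2 \<le> inner (A v) v"
proof (rule tendsto_lowerbound[OF tendsto_inner[OF directional_derivative_limit[OF S A] tendsto_const]])
  show "\<forall>\<^sub>F t in at_right 0. mu * (norm v)\<^sup>2 \<le> inner ((g (x + t *\<^sub>R v) - g x) /\<^sub>R t) v"
  proof (rule eventually_at_rightI[of 0 1])
    fix t :: real assume t: "t \<in> {0<..<1}"
    have "t * (t * (mu * (norm v)\<^sup>2)) \<le> t * inner (g (x + t *\<^sub>R v) - g x) v"
      using mono[of t] t by (simp add: power2_eq_square algebra_simps)
    then have "t * (mu * (norm v)\<^sup>2) \<le> inner (g (x + t *\<^sub>R v) - g x) v"
      using t by simp
    then have "inverse t * (t * (mu * (norm v)\<^sup>2)) \<le> inverse t * inner (g (x + t *\<^sub>R v) - g x) v"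
      using t by (intro mult_left_mono) auto
    then show "mu * (norm v)\<^sup>2 \<le> inner ((g (x + t *\<^sub>R v) - g x) /\<^sub>R t) v"
      using t by (simp add: mult.assoc[symmetric])
  qed simp
qed simp

section \<open>Strong convexity and smoothness on a subspace\<close>

text \<open>Convexity between \<open>x\<close> and \<open>y\<close>, divided by \<open>t\<close>, in
  the limit \<open>t\<close> to \<open>0\<close> from the right.\<close>

lemma strongly_convex_on_gradient_ineq:
  assumes S: "subspace S" "x \<in> S" "y \<in> S"
    and sc: "strongly_convex_on S mu F"
    and D: "has_gradient_on S F x D"
  shows "F x + inner (y - x) D + mu / 2 * (norm (y - x))\<^sup>2 \<le> F y"
proof -
  have yx: "y - x \<in> S" using S by (simp add: subspace_diff)
  have "(F has_derivative (\<lambda>h. inner h D)) (at x within S)" using D by (simp add: has_gradient_on_def)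
  from directional_derivative_limit[OF S(1,2) yx this]
  have lim: "((\<lambda>t. (F (x + t *\<^sub>R (y - x)) - F x) /\<^sub>R t) \<longlongrightarrow> inner (y - x) D) (at_right 0)" .
  have lim2: "((\<lambda>t. F y - F x - mu / 2 * (1 - t) * (norm (y - x))\<^sup>2) \<longlongrightarrow>
    F y - F x - mu / 2 * (1 - 0) * (norm (y - x))\<^sup>2) (at_right 0)"
    by (intro tendsto_intros)
  have "inner (y - x) D \<le> F y - F x - mu / 2 * (1 - 0) * (norm (y - x))\<^sup>2"
  proof (rule tendsto_le[OF _ lim2 lim])
    show "\<forall>\<^sub>F t in at_right 0. (F (x + t *\<^sub>R (y - x)) - F x) /\<^sub>R t
      \<le> F y - F x - mu / 2 * (1 - t) * (norm (y - x))\<^sup>2"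
    proof (rule eventually_at_rightI[of 0 1])
      fix t :: real assume t: "t \<in> {0<..<1}"
      have "x + t *\<^sub>R (y - x) = (1 - t) *\<^sub>R x + t *\<^sub>R y" by (simp add: algebra_simps)
      then have "F (x + t *\<^sub>R (y - x)) \<le>
        (1 - t) * F x + t * F y - mu / 2 * t * (1 - t) * (norm (y - x))\<^sup>2"
        using sc S t unfolding strongly_convex_on_def
        by (auto simp: norm_minus_commute[of y x])
      then have "F (x + t *\<^sub>R (y - x)) - F x
        \<le> t * (F y - F x - mu / 2 * (1 - t) * (norm (y - x))\<^sup>2)"
        by (simp add: algebra_simps)
      then show "(F (x + t *\<^sub>R (y - x)) - F x) /\<^sub>R t
        \<le> F y - F x - mu / 2 * (1 - t) * (norm (y - x))\<^sup>2"
        using t by (simp add: divide_inverse[symmetric] field_simps)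
    qed simp
  qed simp
  then show ?thesis by simp
qed

lemma strongly_convex_on_gradient_monotone:
  assumes S: "subspace S" "x \<in> S" "y \<in> S"
    and sc: "strongly_convex_on S mu F"
    and D: "has_gradient_on S F x D" "has_gradient_on S F y E"
  shows "mu * (norm (y - x))\<^sup>2 \<le> inner (E - D) (y - x)"
  using strongly_convex_on_gradient_ineq[OF S sc D(1)]
    strongly_convex_on_gradient_ineq[OF S(1,3,2) sc D(2)]
  by (simp add: inner_diff_left inner_diff_right inner_commute norm_minus_commute)

text \<open>The mean value theorem replaces integration along the segment, so the constant is
  \<open>L\<close> instead of \<open>L / 2\<close>. The loss is harmless: the block steps in the
  descent have length \<open>1 / (8 * L)\<close>.\<close>

lemma smooth_on_upper_bound:
  assumes S: "subspace S" "x \<in> S" "y \<in> S"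
    and sm: "smooth_on S L F"
  shows "F y \<le> F x + inner (y - x) (grad_on S F x) + L * (norm (y - x))\<^sup>2"
proof -
  have yx: "y - x \<in> S" using S by (simp add: subspace_diff)
  have mem: "x + t *\<^sub>R (y - x) \<in> S" for t using S yx by (simp add: subspace_add subspace_scale)
  have "\<exists>t::real. 0 < t \<and> t < 1 \<and> F (x + 1 *\<^sub>R (y - x)) - F (x + 0 *\<^sub>R (y - x))
    = (1 - 0) * inner (y - x) (grad_on S F (x + t *\<^sub>R (y - x)))"
    by (rule MVT2[where f = "\<lambda>t. F (x + t *\<^sub>R (y - x))"])
      (use S mem yx sm in \<open>auto intro!: grad_on_line_derivative has_gradient_grad_on simp: smooth_on_def\<close>)
  then obtain t :: real where t: "0 < t" "t < 1"
    and eq: "F y = F x + inner (y - x) (grad_on S F (x + t *\<^sub>R (y - x)))"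
    by auto
  have "L-lipschitz_on S (grad_on S F)" using sm by (simp add: smooth_on_def)
  from lipschitz_onD[OF this mem S(2), of t] lipschitz_on_nonneg[OF this]
  have "norm (grad_on S F (x + t *\<^sub>R (y - x)) - grad_on S F x) \<le> L * norm (y - x)"
    using t mult_right_mono[of t 1 "L * norm (y - x)"]
    by (auto simp: dist_norm mult.left_commute)
  then have "inner (y - x) (grad_on S F (x + t *\<^sub>R (y - x)) - grad_on S F x)
    \<le> norm (y - x) * (L * norm (y - x))"
    by (intro order.trans[OF norm_cauchy_schwarz] mult_left_mono) auto
  then show ?thesis by (simp add: eq inner_diff_right power2_eq_square mult.left_commute)
qed

section \<open>Operator bounds, means and zeros of strongly monotone maps\<close>

text \<open>The quadratic form of a symmetric operator governs its norm. Polarization at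
  \<open>v\<close> and a multiple of \<open>B v\<close> shows this without a spectral
  decomposition.\<close>

lemma norm_symmetric_psd_le:
  fixes B :: "'a::real_inner \<Rightarrow> 'a"
  assumes S: "subspace S" and BS: "\<And>v. v \<in> S \<Longrightarrow> B v \<in> S"
    and lin: "\<And>v w c. v \<in> S \<Longrightarrow> w \<in> S \<Longrightarrow> B (v + c *\<^sub>R w) = B v + c *\<^sub>R B w"
    and sym: "\<And>v w. v \<in> S \<Longrightarrow> w \<in> S \<Longrightarrow> inner (B v) w = inner (B w) v"
    and nonneg: "\<And>v. v \<in> S \<Longrightarrow> 0 \<le> inner (B v) v"
    and upper: "\<And>v. v \<in> S \<Longrightarrow> inner (B v) v \<le> b * (norm v)\<^sup>2"
    and v: "v \<in> S"
  shows "norm (B v) \<le> b * norm v"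
proof (cases "B v = 0 \<or> v = 0")
  case True
  have "0 \<le> b" if "v \<noteq> 0"
  proof -
    have "0 \<le> b * (norm v)\<^sup>2" using nonneg upper v order.trans by blast
    then show ?thesis using that by (simp add: zero_le_mult_iff)
  qed
  moreover have "B 0 = 0" using lin[of 0 0 "-1"] S by (simp add: subspace_0)
  ultimately show ?thesis using True by (cases "v = 0") auto
next
  case False
  \<comment> \<open>This scaling gives \<open>t *\<^sub>R B v\<close> the length of
    \<open>v\<close>, for which the polarization bound is sharp.\<close>
  define t where "t = norm v / norm (B v)"
  have t: "0 < t" using False by (simp add: t_def)
  have nt: "t * norm (B v) = norm v" using False by (simp add: t_def)
  let ?w = "B v"
  have w: "?w \<in> S" using BS v .
  have m: "v - t *\<^sub>R ?w \<in> S" "v + t *\<^sub>R ?w \<in> S"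
    using S v w by (auto intro!: subspace_add subspace_diff subspace_scale)
  have l1: "B (v + t *\<^sub>R ?w) = B v + t *\<^sub>R B ?w" and l2: "B (v - t *\<^sub>R ?w) = B v - t *\<^sub>R B ?w"
    using lin[OF v w, of t] lin[OF v w, of "-t"] by auto
  have "4 * t * (norm ?w)\<^sup>2 = inner (B (v + t *\<^sub>R ?w)) (v + t *\<^sub>R ?w) - inner (B (v - t *\<^sub>R ?w)) (v - t *\<^sub>R ?w)"
    using sym[OF v w]
    by (simp add: l1 l2 inner_add_left inner_add_right inner_diff_left inner_diff_right power2_norm_eq_inner algebra_simps)
  also have "\<dots> \<le> b * (norm (v + t *\<^sub>R ?w))\<^sup>2"
    using nonneg[OF m(1)] upper[OF m(2)] by linarith
  also have "\<dots> \<le> b * (2 * norm v)\<^sup>2"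
  proof (rule mult_left_mono)
    have "norm (v + t *\<^sub>R ?w) \<le> 2 * norm v" using norm_triangle_ineq[of v "t *\<^sub>R ?w"] nt t by simp
    then show "(norm (v + t *\<^sub>R ?w))\<^sup>2 \<le> (2 * norm v)\<^sup>2" by (rule power_mono) simp
    have "0 \<le> b * (norm v)\<^sup>2" using nonneg upper v order.trans by blast
    then show "0 \<le> b" using False by (simp add: zero_le_mult_iff)
  qed
  finally have "norm v * norm ?w \<le> b * (norm v * norm v)"
    using nt by (simp add: power2_eq_square mult.assoc[symmetric])
  then have "norm v * norm ?w \<le> norm v * (b * norm v)" by (simp add: mult.left_commute)
  then show ?thesis using False by simp
qed

text \<open>A real supremum dominates its members only if they are bounded above, which is where
  boundedness of \<open>A\<close> enters. At \<open>v = 0\<close> the quotient is \<open>0\<close>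
  by the convention for division.\<close>

lemma norm_le_onorm_on:
  assumes A: "bounded_linear A" and v: "v \<in> S"
  shows "norm (A v) \<le> onorm_on S A * norm v"
proof -
  obtain K where K: "norm (A w) \<le> norm w * K" for w
    using bounded_linear.nonneg_bounded[OF A] by blast
  have "norm (A w) / norm w \<le> max K 0" for w
  proof -
    have "norm (A w) \<le> norm w * max K 0" by (rule order.trans[OF K mult_left_mono]) auto
    then show ?thesis by (cases "w = 0") (simp_all add: pos_divide_le_eq mult.commute)
  qed
  then have "norm (A v) / norm v \<le> onorm_on S A"
    unfolding onorm_on_def using v by (intro cSUP_upper) (auto intro!: bdd_aboveI2)
  moreover have "A 0 = 0" by (rule linear_0[OF bounded_linear.linear[OF A]])
  ultimately show ?thesis by (cases "v = 0") (auto simp: divide_le_eq)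
qed

lemma has_gradient_on_mean:
  assumes S: "subspace S" and F: "\<And>j. j < n \<Longrightarrow> has_gradient_on S (F j) x (g j)"
  shows "has_gradient_on S (\<lambda>z. (\<Sum>j<n. F j z) / real n) x ((\<Sum>j<n. g j) /\<^sub>R real n)"
  unfolding has_gradient_on_def
proof
  show "(\<Sum>j<n. g j) /\<^sub>R real n \<in> S"
    using S F by (auto simp: has_gradient_on_def intro!: subspace_scale subspace_sum)
  have "((\<lambda>z. (\<Sum>j<n. F j z) /\<^sub>R real n) has_derivative
      (\<lambda>h. (\<Sum>j<n. inner h (g j)) /\<^sub>R real n)) (at x within S)"
    using F by (intro has_derivative_scaleR_right has_derivative_sum) (auto simp: has_gradient_on_def)
  then show "((\<lambda>z. (\<Sum>j<n. F j z) / real n) has_derivative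
      (\<lambda>h. inner h ((\<Sum>j<n. g j) /\<^sub>R real n))) (at x within S)"
    by (simp add: inner_sum_right divide_inverse mult.commute)
qed

lemma norm_mean_le:
  fixes a :: "nat \<Rightarrow> 'a::real_normed_vector"
  assumes "0 < n" "\<And>j. j < n \<Longrightarrow> norm (a j) \<le> b"
  shows "norm ((\<Sum>j<n. a j) /\<^sub>R real n) \<le> b"
proof -
  have "norm (\<Sum>j<n. a j) \<le> real n * b"
    using sum_norm_bound[of "{..<n}" a b] assms(2) by simp
  then show ?thesis using assms(1) by (simp add: field_simps)
qed

lemma forward_step_norm:
  fixes a b :: "'a::real_inner"
  assumes "0 \<le> s" "mu * (norm a)\<^sup>2 \<le> inner b a" "norm b \<le> L * norm a"
  shows "(norm (a - s *\<^sub>R b))\<^sup>2 \<le> (1 - 2 * s * mu + s\<^sup>2 * L\<^sup>2) * (norm a)\<^sup>2"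
proof -
  have "(norm (a - s *\<^sub>R b))\<^sup>2 = (norm a)\<^sup>2 - 2 * s * inner b a + s\<^sup>2 * (norm b)\<^sup>2"
    unfolding power2_norm_eq_inner
    by (simp add: inner_diff_left inner_diff_right inner_commute power2_eq_square algebra_simps)
  also have "\<dots> \<le> (norm a)\<^sup>2 - 2 * s * (mu * (norm a)\<^sup>2) + s\<^sup>2 * (L * norm a)\<^sup>2"
    using assms by (intro add_mono diff_left_mono mult_left_mono power_mono) auto
  finally show ?thesis by (simp add: algebra_simps power_mult_distrib)
qed

text \<open>A short forward step \<open>y - s *\<^sub>R T y\<close> is a contraction of the complete
  set \<open>S\<close>. Both the minimizer \<open>y_star\<close> and the solution
  \<open>u_star\<close> of the linear system are obtained from this.\<close>

lemma strongly_monotone_zero_ex: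
  fixes T :: "'a::real_inner \<Rightarrow> 'a"
  assumes S: "subspace S" "complete S" and TS: "\<And>y. y \<in> S \<Longrightarrow> T y \<in> S"
    and mono: "\<And>y z. y \<in> S \<Longrightarrow> z \<in> S \<Longrightarrow> mu * (norm (y - z))\<^sup>2 \<le> inner (T y - T z) (y - z)"
    and lip: "\<And>y z. y \<in> S \<Longrightarrow> z \<in> S \<Longrightarrow> norm (T y - T z) \<le> L * norm (y - z)"
    and mu: "0 < mu" "mu \<le> L"
  shows "\<exists>y\<in>S. T y = 0"
proof -
  \<comment> \<open>This step minimizes the factor
    \<open>1 - 2 * s * mu + s\<^sup>2 * L\<^sup>2\<close> of
    \<open>forward_step_norm\<close>.\<close>
  define s where "s = mu / L\<^sup>2"
  have s: "0 < s" using mu by (simp add: s_def)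
  define c where "c = sqrt (1 - mu\<^sup>2 / L\<^sup>2)"
  have r: "0 < mu\<^sup>2 / L\<^sup>2" "mu\<^sup>2 / L\<^sup>2 \<le> 1" using mu by (auto simp: divide_le_eq_1 power_mono)
  have c: "0 \<le> c" "c < 1" "c\<^sup>2 = 1 - mu\<^sup>2 / L\<^sup>2" using r by (auto simp: c_def)
  have c': "1 - 2 * s * mu + s\<^sup>2 * L\<^sup>2 = c\<^sup>2"
    using mu unfolding c(3) s_def by (simp add: field_simps power2_eq_square)
  have "\<exists>!y\<in>S. y - s *\<^sub>R T y = y"
  proof (rule Banach_fix[OF S(2) _ c(1,2)])
    show "S \<noteq> {}" using S(1) subspace_0 by blast
    show "(\<lambda>y. y - s *\<^sub>R T y) ` S \<subseteq> S" using S TS by (auto intro!: subspace_diff subspace_scale)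
    show "dist (y - s *\<^sub>R T y) (z - s *\<^sub>R T z) \<le> c * dist y z" if "y \<in> S" "z \<in> S" for y z
    proof (rule power2_le_imp_le)
      have "y - s *\<^sub>R T y - (z - s *\<^sub>R T z) = (y - z) - s *\<^sub>R (T y - T z)"
        by (simp add: algebra_simps)
      moreover have "(norm ((y - z) - s *\<^sub>R (T y - T z)))\<^sup>2 \<le> c\<^sup>2 * (norm (y - z))\<^sup>2"
        using forward_step_norm[of s mu "y - z" "T y - T z" L] s mono lip that unfolding c' by simp
      ultimately show "(dist (y - s *\<^sub>R T y) (z - s *\<^sub>R T z))\<^sup>2 \<le> (c * dist y z)\<^sup>2"
        by (simp only: dist_norm power_mult_distrib)
    qed (use c in simp)
  qed
  then show ?thesis using s by auto
qed

section \<open>The spaces \<open>\<real>\<^sup>n\<close>\<close>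

lemma subspace_Rn: "subspace (Rn n)"
  by (simp add: Rn_def subspace_def zero_rvec.rep_eq plus_rvec.rep_eq scaleR_rvec.rep_eq)

lemma inner_Rn: "v \<in> Rn n \<Longrightarrow> inner v w = (\<Sum>i<n. coord v i * coord w i)"
  by (rule inner_rvec_superset) (auto simp: Rn_def not_less[symmetric])

lemma norm_le_sum_coord:
  assumes "v \<in> Rn n"
  shows "norm v \<le> (\<Sum>i<n. \<bar>coord v i\<bar>)"
proof -
  have "norm v = L2_set (coord v) {..<n}"
    using inner_Rn[OF assms, of v] by (simp add: norm_eq_sqrt_inner L2_set_def power2_eq_square)
  also have "\<dots> \<le> (\<Sum>i<n. \<bar>coord v i\<bar>)" by (rule L2_set_le_sum_abs)
  finally show ?thesis .
qed

lemma abs_coord_le_norm: "\<bar>coord v i\<bar> \<le> norm v"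
proof -
  define I where "I = insert i {i. coord v i \<noteq> 0}"
  have "finite I" "{i. coord v i \<noteq> 0} \<subseteq> I" using finite_coord by (auto simp: I_def)
  then have "norm v = L2_set (coord v) I"
    by (simp add: norm_eq_sqrt_inner L2_set_def inner_rvec_superset power2_eq_square)
  moreover have "norm (coord v i) \<le> L2_set (coord v) I"
    using member_le_L2_set[of I i "\<lambda>i. \<bar>coord v i\<bar>"] \<open>finite I\<close>
    by (auto simp: L2_set_def I_def)
  ultimately show ?thesis by simp
qed

lemma coord_diff: "coord (v - w) i = coord v i - coord w i"
  by (simp add: minus_rvec.rep_eq)

text \<open>The ambient type is not complete, so fixed points and closedness have to come from
  \<open>Rn n\<close>. There a Cauchy sequence has only \<open>n\<close> coordinates to converge
  in.\<close>

lemma complete_Rn: "complete (Rn n)"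
proof (rule completeI)
  fix f assume f: "\<forall>k. f k \<in> Rn n" and C: "Cauchy f"
  have "convergent (\<lambda>k. coord (f k) i)" for i
  proof (rule real_Cauchy_convergent, rule metric_CauchyI)
    fix e :: real assume "0 < e"
    then obtain M where M: "\<And>k l. M \<le> k \<Longrightarrow> M \<le> l \<Longrightarrow> dist (f k) (f l) < e"
      using metric_CauchyD[OF C] by blast
    have "dist (coord (f k) i) (coord (f l) i) \<le> dist (f k) (f l)" for k l
      using abs_coord_le_norm[of "f k - f l" i] by (simp add: dist_norm coord_diff)
    then show "\<exists>M. \<forall>k\<ge>M. \<forall>l\<ge>M. dist (coord (f k) i) (coord (f l) i) < e"
      using M by (meson le_less_trans)
  qed
  then obtain c where c: "\<And>i. (\<lambda>k. coord (f k) i) \<longlonglongrightarrow> c i" unfolding convergent_def by metis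
  have c0: "c i = 0" if "n \<le> i" for i
    using c[of i] f that by (simp add: Rn_def LIMSEQ_const_iff)
  have "finite {i. c i \<noteq> 0}"
    by (rule finite_subset[of _ "{..<n}"]) (use c0 in \<open>auto simp: not_less[symmetric]\<close>)
  then have coord_c: "coord (Abs_rvec c) = c" by (intro Abs_rvec_inverse) simp
  have mem: "Abs_rvec c \<in> Rn n" using c0 by (simp add: Rn_def coord_c)
  have "(\<lambda>k. norm (f k - Abs_rvec c)) \<longlonglongrightarrow> 0"
  proof (rule tendsto_sandwich[OF _ _ tendsto_const])
    show "(\<lambda>k. \<Sum>i<n. \<bar>coord (f k) i - c i\<bar>) \<longlonglongrightarrow> 0"
      using c by (intro tendsto_null_sum tendsto_rabs_zero) (simp add: LIM_zero)
    show "\<forall>\<^sub>F k in sequentially. norm (f k - Abs_rvec c) \<le> (\<Sum>i<n. \<bar>coord (f k) i - c i\<bar>)"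
    proof (intro always_eventually allI)
      fix k
      have "f k - Abs_rvec c \<in> Rn n" using f mem by (simp add: subspace_diff[OF subspace_Rn])
      from norm_le_sum_coord[OF this]
      show "norm (f k - Abs_rvec c) \<le> (\<Sum>i<n. \<bar>coord (f k) i - c i\<bar>)"
        by (simp only: coord_diff coord_c)
    qed
  qed simp
  then have "f \<longlonglongrightarrow> Abs_rvec c" by (rule LIM_zero_cancel[OF tendsto_norm_zero_cancel])
  then show "\<exists>l\<in>Rn n. f \<longlonglongrightarrow> l" using mem by blast
qed

lemma Rn_nontrivial: "0 < n \<Longrightarrow> \<exists>v\<in>Rn n. v \<noteq> 0"
proof -
  assume n: "0 < n"
  let ?c = "\<lambda>i::nat. if i = 0 then 1 else 0 :: real"
  have c: "coord (Abs_rvec ?c) = ?c" by (intro Abs_rvec_inverse) simp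
  then have "Abs_rvec ?c \<noteq> 0" by (metis zero_rvec.rep_eq zero_neq_one)
  then show ?thesis using c n by (intro bexI[of _ "Abs_rvec ?c"]) (auto simp: Rn_def)
qed

lemma subspace_spaces [simp]:
  "subspace (X_space P)" "subspace (Y_space P)" "subspace (Z_space P)"
  by (simp_all add: X_space_def Y_space_def Z_space_def subspace_Rn subspace_Times)

lemma complete_Y_space: "complete (Y_space P)"
  by (simp add: Y_space_def complete_Rn)

lemma closed_spaces: "closed (X_space P)" "closed (Y_space P)" "closed (Z_space P)"
  by (simp_all add: X_space_def Y_space_def Z_space_def complete_Rn complete_imp_closed closed_Times)

lemma mem_Z_space [simp]: "(x, y) \<in> Z_space P \<longleftrightarrow> x \<in> X_space P \<and> y \<in> Y_space P"
  by (simp add: Z_space_def)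

section \<open>Projection onto a ball\<close>

text \<open>\<open>arg_min_on\<close> selects some minimizer, so uniqueness is needed to identify
  it. For \<open>u\<close> outside the ball, a nearest point \<open>w\<close> has norm
  \<open>r\<close> and inner product at least \<open>norm u * r\<close> with \<open>u\<close>, the
  equality case of Cauchy-Schwarz.\<close>

lemma proj_ball_eq:
  assumes "0 \<le> r"
  shows "proj_ball r u = (if norm u \<le> r then u else (r / norm u) *\<^sub>R u)"
proof -
  define p where "p = (if norm u \<le> r then u else (r / norm u) *\<^sub>R u)"
  have p: "norm p \<le> r" using assms by (auto simp: p_def)
  have dp: "dist u p = max 0 (norm u - r)"
  proof (cases "norm u \<le> r")
    case False
    then have u: "0 < norm u" "u \<noteq> 0" using assms by auto
    have "u - p = (1 - r / norm u) *\<^sub>R u" using False by (simp add: p_def algebra_simps)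
    then have "norm (u - p) = \<bar>1 - r / norm u\<bar> * norm u" by simp
    also have "\<dots> = norm u - r" using False u assms by (simp add: abs_if field_simps)
    finally show ?thesis using False by (simp add: dist_norm)
  qed (simp add: p_def)
  have min: "dist u p \<le> dist u w" if "norm w \<le> r" for w
    using dp norm_triangle_ineq2[of u w] that by (simp add: dist_norm)
  have uniq: "w = p" if "norm w \<le> r" "dist u w \<le> dist u p" for w
  proof (cases "norm u \<le> r")
    case True
    then show ?thesis using that dp by (simp add: p_def)
  next
    case False
    then have u: "0 < norm u" using assms by linarith
    have d: "norm (u - w) \<le> norm u - r" using that dp False by (simp add: dist_norm)
    then have nw: "norm w = r" using that norm_triangle_ineq2[of u w] by linarith
    have "(norm (u - w))\<^sup>2 \<le> (norm u - r)\<^sup>2" using d by (rule power_mono) simp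
    then have i: "norm u * r \<le> inner u w"
      using nw dot_norm_neg[of u w] by (simp add: power2_eq_square algebra_simps)
    have np: "norm p = r" using False u assms by (simp add: p_def)
    have "inner p w = (r / norm u) * inner u w" using False by (simp add: p_def)
    then have "(r / norm u) * (norm u * r) \<le> inner p w" using i assms u
      by (metis divide_nonneg_pos mult_left_mono)
    then have "r * r \<le> inner p w" using u by simp
    then have "(norm (p - w))\<^sup>2 \<le> 0"
      using nw np dot_norm_neg[of p w] by (simp add: power2_eq_square)
    then show ?thesis by simp
  qed
  have "is_arg_min (dist u) (\<lambda>w. w \<in> cball 0 r) p"
    using p min by (force simp: is_arg_min_def)
  moreover have "w = p" if "is_arg_min (dist u) (\<lambda>w. w \<in> cball 0 r) w" for w
    using that p by (intro uniq) (auto simp: is_arg_min_def not_less)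
  ultimately have "arg_min_on (dist u) (cball 0 r) = p"
    unfolding arg_min_on_def arg_min_def by (rule some_equality)
  then show ?thesis by (simp add: proj_ball_def p_def)
qed

lemma norm_proj_ball_le: "0 \<le> r \<Longrightarrow> norm (proj_ball r u) \<le> r"
  by (auto simp: proj_ball_eq)

text \<open>Only the distance to a fixed point of the ball matters, later \<open>u_star\<close>.
  With \<open>k = r / norm u\<close>, Cauchy-Schwarz gives
  \<open>2 * inner u c \<le> (1 + k) * (norm u)\<^sup>2\<close>, and multiplying by
  \<open>1 - k\<close> yields the difference of the two squared distances.\<close>

lemma proj_ball_nonexpansive_to:
  assumes "norm c \<le> r"
  shows "norm (proj_ball r u - c) \<le> norm (u - c)"
proof (cases "norm u \<le> r")
  case False
  have r: "0 \<le> r" using assms norm_ge_zero order.trans by blast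
  then have u: "0 < norm u" using False by linarith
  define k where "k = r / norm u"
  have k: "0 \<le> k" "k \<le> 1" "k * norm u = r" using r u False by (auto simp: k_def)
  have "inner u c \<le> norm u * r"
    using norm_cauchy_schwarz[of u c] mult_left_mono[OF assms norm_ge_zero[of u]] by linarith
  moreover have "norm u * r = k * (norm u)\<^sup>2" using k by (simp add: power2_eq_square)
  moreover have "k * (norm u)\<^sup>2 \<le> (norm u)\<^sup>2" using k by (simp add: mult_left_le_one_le)
  ultimately have "2 * inner u c \<le> (1 + k) * (norm u)\<^sup>2" by (simp add: distrib_right)
  then have "(1 - k) * (2 * inner u c) \<le> (1 - k) * ((1 + k) * (norm u)\<^sup>2)"
    using k by (intro mult_left_mono) auto
  then have "(norm (k *\<^sub>R u - c))\<^sup>2 \<le> (norm (u - c))\<^sup>2"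
    unfolding power2_norm_eq_inner
    by (simp add: inner_diff_left inner_diff_right inner_commute algebra_simps)
  then have "norm (k *\<^sub>R u - c) \<le> norm (u - c)" by (rule power2_le_imp_le) simp
  then show ?thesis using False r by (simp add: proj_ball_eq k_def)
next
  case True
  then have "0 \<le> r" using norm_ge_zero order.trans by blast
  then show ?thesis using True by (simp add: proj_ball_eq)
qed

lemma proj_ball_mem: "subspace S \<Longrightarrow> 0 \<le> r \<Longrightarrow> u \<in> S \<Longrightarrow> proj_ball r u \<in> S"
  by (simp add: proj_ball_eq subspace_scale)

section \<open>The regular inner problem\<close>

lemma fst_snd_mem_Z_space: "z \<in> Z_space P \<Longrightarrow> fst z \<in> X_space P \<and> snd z \<in> Y_space P"
  by (cases z) simp

lemma zero_mem_spaces [simp]: "0 \<in> X_space P" "0 \<in> Y_space P"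
  by (simp_all add: subspace_0)

lemma norm_fst_le: "norm (fst z) \<le> norm z"
  by (cases z) (simp add: norm_Pair)

lemma norm_snd_le: "norm (snd z) \<le> norm z"
  by (cases z) (simp add: norm_Pair)

lemma norm_Pair_zero [simp]: "norm (0, v) = norm v" "norm (v, 0) = norm v"
  by (simp_all add: norm_Pair)

section \<open>Gradients and Hessian blocks in \<open>x\<close> and \<open>y\<close>\<close>

lemma smooth_on_gradient:
  assumes "smooth_on (Z_space P) L F" "z \<in> Z_space P"
  shows "has_gradient_on (Z_space P) F z (grad_xy P F z)"
  using assms unfolding smooth_on_def grad_xy_def by (auto intro: has_gradient_grad_on)

lemma grad_xy_mem: "smooth_on (Z_space P) L F \<Longrightarrow> z \<in> Z_space P \<Longrightarrow> grad_xy P F z \<in> Z_space P"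
  using smooth_on_gradient has_gradient_on_def by blast

lemma grad_x_mem: "smooth_on (Z_space P) L F \<Longrightarrow> z \<in> Z_space P \<Longrightarrow> grad_x P F z \<in> X_space P"
  using grad_xy_mem fst_snd_mem_Z_space by (simp add: grad_x_def)

lemma grad_y_mem: "smooth_on (Z_space P) L F \<Longrightarrow> z \<in> Z_space P \<Longrightarrow> grad_y P F z \<in> Y_space P"
  using grad_xy_mem fst_snd_mem_Z_space by (simp add: grad_y_def)

lemma grad_xy_lipschitz:
  assumes "smooth_on (Z_space P) L F" "z \<in> Z_space P" "w \<in> Z_space P"
  shows "norm (grad_xy P F z - grad_xy P F w) \<le> L * norm (z - w)"
  using assms lipschitz_onD[of L "Z_space P" "grad_xy P F" z w]
  by (simp add: smooth_on_def grad_xy_def dist_norm)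

lemma grad_x_lipschitz:
  assumes "smooth_on (Z_space P) L F" "z \<in> Z_space P" "w \<in> Z_space P"
  shows "norm (grad_x P F z - grad_x P F w) \<le> L * norm (z - w)"
  using grad_xy_lipschitz[OF assms] norm_fst_le[of "grad_xy P F z - grad_xy P F w"]
  by (simp add: grad_x_def)

lemma grad_y_lipschitz:
  assumes "smooth_on (Z_space P) L F" "z \<in> Z_space P" "w \<in> Z_space P"
  shows "norm (grad_y P F z - grad_y P F w) \<le> L * norm (z - w)"
  using grad_xy_lipschitz[OF assms] norm_snd_le[of "grad_xy P F z - grad_xy P F w"]
  by (simp add: grad_y_def)

lemma hess_has_derivative:
  assumes "twice_differentiable_on (Z_space P) G" "z \<in> Z_space P"
  shows "(grad_xy P G has_derivative hess P G z) (at z within Z_space P)"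
  using assms frechet_derivative_works
  by (auto simp: twice_differentiable_on_def hess_def hess_on_def grad_xy_def)

lemma bounded_linear_hess:
  "twice_differentiable_on (Z_space P) G \<Longrightarrow> z \<in> Z_space P \<Longrightarrow> bounded_linear (hess P G z)"
  using hess_has_derivative has_derivative_bounded_linear by blast

lemma bounded_linear_hess_blocks:
  assumes "twice_differentiable_on (Z_space P) G" "z \<in> Z_space P"
  shows "bounded_linear (hess_xy P G z)" "bounded_linear (hess_yy P G z)"
proof -
  have *: "bounded_linear (\<lambda>v. hess P G z (0, v))"
    by (rule bounded_linear_compose[OF bounded_linear_hess[OF assms]])
      (intro bounded_linear_Pair bounded_linear_zero bounded_linear_ident)
  show "bounded_linear (hess_xy P G z)" "bounded_linear (hess_yy P G z)"
    unfolding hess_xy_def hess_yy_def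
    by (rule bounded_linear_compose[OF bounded_linear_fst *]
        bounded_linear_compose[OF bounded_linear_snd *])+
qed

text \<open>Satisfied by the single inner examples and, by
  \<open>strongly_convex_inner_mean\<close>, by their averages, so each fact below serves both. The
  Hessian bounds are pointwise in \<open>v\<close> because in this form they pass to means
  directly.\<close>

locale strongly_convex_inner =
  fixes P :: cbo and G :: "rvec \<times> rvec \<Rightarrow> real" and L mu Lxy Lyy :: real
  assumes smooth: "smooth_on (Z_space P) L G"
    and twice: "twice_differentiable_on (Z_space P) G"
    and convex: "x \<in> X_space P \<Longrightarrow> strongly_convex_on (Y_space P) mu (\<lambda>y. G (x, y))"
    and hess_xy_lipschitz: "z \<in> Z_space P \<Longrightarrow> w \<in> Z_space P \<Longrightarrow> v \<in> Y_space P \<Longrightarrow>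
      norm (hess_xy P G z v - hess_xy P G w v) \<le> Lxy * norm (z - w) * norm v"
    and hess_yy_lipschitz: "z \<in> Z_space P \<Longrightarrow> w \<in> Z_space P \<Longrightarrow> v \<in> Y_space P \<Longrightarrow>
      norm (hess_yy P G z v - hess_yy P G w v) \<le> Lyy * norm (z - w) * norm v"
    and mu_pos: "0 < mu" and dim_y_pos: "0 < dim_y P"
begin

lemma hess_mem: "z \<in> Z_space P \<Longrightarrow> v \<in> Z_space P \<Longrightarrow> hess P G z v \<in> Z_space P"
  using derivative_in_closed_subspace[OF subspace_spaces(3) _ _ hess_has_derivative[OF twice]
      subspace_spaces(3) closed_spaces(3)] grad_xy_mem[OF smooth] by blast

lemma hess_yy_mem: "z \<in> Z_space P \<Longrightarrow> v \<in> Y_space P \<Longrightarrow> hess_yy P G z v \<in> Y_space P"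
  using hess_mem[of z "(0, v)"] fst_snd_mem_Z_space by (simp add: hess_yy_def)

lemma hess_xy_mem: "z \<in> Z_space P \<Longrightarrow> v \<in> Y_space P \<Longrightarrow> hess_xy P G z v \<in> X_space P"
  using hess_mem[of z "(0, v)"] fst_snd_mem_Z_space by (simp add: hess_xy_def)

lemma hess_symmetric:
  assumes "z \<in> Z_space P" "v \<in> Z_space P" "w \<in> Z_space P"
  shows "inner (hess P G z v) w = inner (hess P G z w) v"
  using derivative_of_gradient_symmetric[OF subspace_spaces(3) assms smooth_on_gradient[OF smooth]
      hess_has_derivative[OF twice assms(1)]] .

lemma hess_bound: "z \<in> Z_space P \<Longrightarrow> v \<in> Z_space P \<Longrightarrow> norm (hess P G z v) \<le> L * norm v"
  using derivative_bound_of_lipschitz_on[OF subspace_spaces(3) _ _ _ hess_has_derivative[OF twice]]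
    smooth by (simp add: smooth_on_def grad_xy_def)

lemma hess_yy_bound: "z \<in> Z_space P \<Longrightarrow> v \<in> Y_space P \<Longrightarrow> norm (hess_yy P G z v) \<le> L * norm v"
  using hess_bound[of z "(0, v)"] norm_snd_le[of "hess P G z (0, v)"] by (simp add: hess_yy_def)

lemma hess_xy_bound: "z \<in> Z_space P \<Longrightarrow> v \<in> Y_space P \<Longrightarrow> norm (hess_xy P G z v) \<le> L * norm v"
  using hess_bound[of z "(0, v)"] norm_fst_le[of "hess P G z (0, v)"] by (simp add: hess_xy_def)

lemma gradient_in_y:
  assumes "x \<in> X_space P" "y \<in> Y_space P"
  shows "has_gradient_on (Y_space P) (\<lambda>y. G (x, y)) y (grad_y P G (x, y))"
proof -
  have z: "(x, y) \<in> Z_space P" using assms by simp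
  have d: "((\<lambda>y. (x, y)) has_derivative (\<lambda>h. (0, h))) (at y within Y_space P)"
    by (intro has_derivative_Pair has_derivative_const has_derivative_ident)
  have sub: "(\<lambda>y. (x, y)) ` Y_space P \<subseteq> Z_space P" using assms by auto
  have "(G has_derivative (\<lambda>h. inner h (grad_xy P G (x, y)))) (at (x, y) within Z_space P)"
    using smooth_on_gradient[OF smooth z] by (simp add: has_gradient_on_def)
  from has_derivative_in_compose[OF d has_derivative_subset[OF this sub]]
  show ?thesis
    using grad_y_mem[OF smooth z] by (simp add: has_gradient_on_def inner_prod_def grad_y_def)
qed

lemma grad_y_monotone:
  assumes "x \<in> X_space P" "y \<in> Y_space P" "y' \<in> Y_space P"
  shows "mu * (norm (y' - y))\<^sup>2 \<le> inner (grad_y P G (x, y') - grad_y P G (x, y)) (y' - y)"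
  using strongly_convex_on_gradient_monotone[OF subspace_spaces(2) assms(2,3) convex[OF assms(1)]
      gradient_in_y[OF assms(1,2)] gradient_in_y[OF assms(1,3)]] .

lemma grad_y_lipschitz_y:
  assumes "x \<in> X_space P" "y \<in> Y_space P" "y' \<in> Y_space P"
  shows "norm (grad_y P G (x, y') - grad_y P G (x, y)) \<le> L * norm (y' - y)"
  using grad_y_lipschitz[OF smooth, of "(x, y')" "(x, y)"] assms by simp

lemma mu_le_L: "mu \<le> L"
proof -
  obtain v where v: "v \<in> Y_space P" "v \<noteq> 0"
    using Rn_nontrivial[OF dim_y_pos] by (auto simp: Y_space_def)
  have "mu * (norm v)\<^sup>2 \<le> norm (grad_y P G (0, v) - grad_y P G (0, 0)) * norm v"
    using grad_y_monotone[of 0 0 v] norm_cauchy_schwarz v order.trans by fastforce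
  also have "\<dots> \<le> (L * norm v) * norm v"
    using grad_y_lipschitz_y[of 0 0 v] v by (intro mult_right_mono) auto
  finally show ?thesis using v by (simp add: power2_eq_square)
qed

text \<open>In a direction \<open>(0, v)\<close> the difference quotients compare points with equal
  \<open>x\<close>, where strong convexity in \<open>y\<close> applies.\<close>

lemma hess_yy_monotone:
  assumes "z \<in> Z_space P" "v \<in> Y_space P"
  shows "mu * (norm v)\<^sup>2 \<le> inner (hess_yy P G z v) v"
proof -
  obtain x y where z: "z = (x, y)" "x \<in> X_space P" "y \<in> Y_space P" using assms by (cases z) auto
  have "mu * (norm (0::rvec, v))\<^sup>2 \<le> inner (hess P G z (0, v)) (0, v)"
  proof (rule derivative_monotone_on[OF subspace_spaces(3) assms(1) _ _ hess_has_derivative[OF twice assms(1)]])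
    show "mu * (norm (t *\<^sub>R (0::rvec, v)))\<^sup>2 \<le>
      inner (grad_xy P G (z + t *\<^sub>R (0, v)) - grad_xy P G z) (t *\<^sub>R (0, v))" for t
      using grad_y_monotone[OF z(2,3), of "y + t *\<^sub>R v"] assms z
      by (simp add: subspace_add subspace_scale inner_Pair_0 grad_y_def)
  qed (use assms in simp)
  then show ?thesis by (simp add: hess_yy_def inner_Pair_0)
qed

lemma hess_yy_linear:
  assumes "z \<in> Z_space P"
  shows "hess_yy P G z (v + w) = hess_yy P G z v + hess_yy P G z w"
    "hess_yy P G z (v - w) = hess_yy P G z v - hess_yy P G z w"
    "hess_yy P G z (c *\<^sub>R v) = c *\<^sub>R hess_yy P G z v"
proof -
  interpret bounded_linear "hess_yy P G z" using bounded_linear_hess_blocks(2)[OF twice assms] .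
  show "hess_yy P G z (v + w) = hess_yy P G z v + hess_yy P G z w"
    "hess_yy P G z (v - w) = hess_yy P G z v - hess_yy P G z w"
    "hess_yy P G z (c *\<^sub>R v) = c *\<^sub>R hess_yy P G z v"
    by (rule add diff scaleR)+
qed

lemma hess_xy_diff:
  "z \<in> Z_space P \<Longrightarrow> hess_xy P G z (v - w) = hess_xy P G z v - hess_xy P G z w"
  using linear_diff[OF bounded_linear.linear[OF bounded_linear_hess_blocks(1)[OF twice]]] .

lemma hess_yy_symmetric:
  assumes "z \<in> Z_space P" "v \<in> Y_space P" "w \<in> Y_space P"
  shows "inner (hess_yy P G z v) w = inner (hess_yy P G z w) v"
  using hess_symmetric[of z "(0, v)" "(0, w)"] assms by (simp add: hess_yy_def inner_Pair_0)

text \<open>Symmetry of the Hessian gives the sharp factor \<open>1 - rho * mu\<close>, for which the ball of radius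
  \<open>Cf / mu\<close> is invariant under the steps for \<open>u\<close>.\<close>

lemma hess_yy_step:
  assumes z: "z \<in> Z_space P" and v: "v \<in> Y_space P" and rho: "0 \<le> rho" "rho * L \<le> 1"
  shows "norm (v - rho *\<^sub>R hess_yy P G z v) \<le> (1 - rho * mu) * norm v"
proof (rule norm_symmetric_psd_le[OF subspace_spaces(2)[of P], of "\<lambda>v. v - rho *\<^sub>R hess_yy P G z v"])
  fix v assume v: "v \<in> Y_space P"
  have "inner (hess_yy P G z v) v \<le> L * norm v * norm v"
    using order.trans[OF norm_cauchy_schwarz mult_right_mono[OF hess_yy_bound[OF z v]]] by simp
  then have "rho * inner (hess_yy P G z v) v \<le> rho * L * (norm v)\<^sup>2"
    using mult_left_mono[OF _ rho(1)] by (simp add: power2_eq_square mult.assoc)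
  also have "\<dots> \<le> 1 * (norm v)\<^sup>2" using rho by (intro mult_right_mono) auto
  finally show "0 \<le> inner (v - rho *\<^sub>R hess_yy P G z v) v"
    by (simp add: inner_diff_left dot_square_norm)
  show "inner (v - rho *\<^sub>R hess_yy P G z v) v \<le> (1 - rho * mu) * (norm v)\<^sup>2"
    using mult_left_mono[OF hess_yy_monotone[OF z v] rho(1)]
    by (simp add: inner_diff_left dot_square_norm algebra_simps)
next
  fix v w c
  show "v + c *\<^sub>R w - rho *\<^sub>R hess_yy P G z (v + c *\<^sub>R w)
      = v - rho *\<^sub>R hess_yy P G z v + c *\<^sub>R (w - rho *\<^sub>R hess_yy P G z w)"
    using z by (simp add: hess_yy_linear algebra_simps)
next
  fix v assume v: "v \<in> Y_space P"
  show "v - rho *\<^sub>R hess_yy P G z v \<in> Y_space P"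
    using v hess_yy_mem[OF z v] by (intro subspace_diff subspace_scale) auto
  fix w assume w: "w \<in> Y_space P"
  show "inner (v - rho *\<^sub>R hess_yy P G z v) w = inner (w - rho *\<^sub>R hess_yy P G z w) v"
    using hess_yy_symmetric[OF z v w] by (simp add: inner_diff_left inner_commute[of v w])
qed (rule v)

section \<open>Minimizers, adjoint solutions and the implicit gradient\<close>

lemma stationary_ex: "x \<in> X_space P \<Longrightarrow> \<exists>y\<in>Y_space P. grad_y P G (x, y) = 0"
  using strongly_monotone_zero_ex[OF subspace_spaces(2) complete_Y_space, of P "\<lambda>y. grad_y P G (x, y)" mu L]
    grad_y_mem[OF smooth] grad_y_monotone grad_y_lipschitz_y mu_pos mu_le_L by simp

text \<open>The selection made by \<open>arg_min_on\<close> has to be identified with the stationary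
  point just found. Around that point the gradient inequality has no linear term, so the function
  grows quadratically and the minimizer is unique.\<close>

lemma minimizer:
  assumes x: "x \<in> X_space P"
  defines "y \<equiv> arg_min_on (\<lambda>y. G (x, y)) (Y_space P)"
  shows "y \<in> Y_space P" "grad_y P G (x, y) = 0"
proof -
  obtain y0 where y0: "y0 \<in> Y_space P" "grad_y P G (x, y0) = 0" using stationary_ex[OF x] by blast
  have le: "G (x, y0) + mu / 2 * (norm (y' - y0))\<^sup>2 \<le> G (x, y')" if "y' \<in> Y_space P" for y'
    using strongly_convex_on_gradient_ineq[OF subspace_spaces(2) y0(1) that convex[OF x] gradient_in_y[OF x y0(1)]]
    by (simp add: y0(2))
  then have le': "G (x, y0) \<le> G (x, y')" if "y' \<in> Y_space P" for y'
    using that mu_pos by (smt (verit) divide_nonneg_nonneg mult_nonneg_nonneg zero_le_power2)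
  have "is_arg_min (\<lambda>y. G (x, y)) (\<lambda>y. y \<in> Y_space P) y0"
    using y0 le' by (force simp: is_arg_min_def)
  moreover have "y' = y0" if "is_arg_min (\<lambda>y. G (x, y)) (\<lambda>y. y \<in> Y_space P) y'" for y'
  proof -
    have "y' \<in> Y_space P" "G (x, y') \<le> G (x, y0)"
      using that y0 by (auto simp: is_arg_min_def not_less)
    then have "mu / 2 * (norm (y' - y0))\<^sup>2 \<le> 0" using le[of y'] by linarith
    then show ?thesis using mu_pos by (simp add: mult_le_0_iff)
  qed
  ultimately have "y = y0"
    unfolding y_def arg_min_on_def arg_min_def by (rule some_equality)
  then show "y \<in> Y_space P" "grad_y P G (x, y) = 0" using y0 by auto
qed

text \<open>The map \<open>hess_yy P G z\<close> is itself strongly monotone and Lipschitz, so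
  \<open>b\<close> lies in its image, and there \<open>inv_into\<close> is a right inverse.\<close>

lemma hess_yy_solution:
  assumes z: "z \<in> Z_space P" and b: "b \<in> Y_space P"
  defines "u \<equiv> inv_into (Y_space P) (hess_yy P G z) b"
  shows "u \<in> Y_space P" "hess_yy P G z u = b" "mu * norm u \<le> norm b"
proof -
  have "\<exists>u\<in>Y_space P. hess_yy P G z u - b = 0"
  proof (rule strongly_monotone_zero_ex[OF subspace_spaces(2) complete_Y_space _ _ _ mu_pos mu_le_L])
    fix v w assume v: "v \<in> Y_space P" and w: "w \<in> Y_space P"
    show "hess_yy P G z v - b \<in> Y_space P" using hess_yy_mem[OF z v] b by (simp add: subspace_diff)
    have vw: "v - w \<in> Y_space P" using v w by (simp add: subspace_diff)
    have eq: "hess_yy P G z v - b - (hess_yy P G z w - b) = hess_yy P G z (v - w)"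
      using z by (simp add: hess_yy_linear)
    show "mu * (norm (v - w))\<^sup>2 \<le> inner (hess_yy P G z v - b - (hess_yy P G z w - b)) (v - w)"
      "norm (hess_yy P G z v - b - (hess_yy P G z w - b)) \<le> L * norm (v - w)"
      unfolding eq by (rule hess_yy_monotone[OF z vw] hess_yy_bound[OF z vw])+
  qed
  then have im: "b \<in> hess_yy P G z ` Y_space P" by force
  show u: "u \<in> Y_space P" and Hu: "hess_yy P G z u = b"
    unfolding u_def by (rule inv_into_into[OF im] f_inv_into_f[OF im])+
  have "mu * (norm u)\<^sup>2 \<le> norm b * norm u"
    using hess_yy_monotone[OF z u] norm_cauchy_schwarz[of b u] by (simp add: Hu)
  then show "mu * norm u \<le> norm b" by (cases "u = 0") (simp_all add: power2_eq_square)
qed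

lemma minimizer_lipschitz:
  assumes x: "x \<in> X_space P" "x' \<in> X_space P"
    and y: "y \<in> Y_space P" "grad_y P G (x, y) = 0" and y': "y' \<in> Y_space P" "grad_y P G (x', y') = 0"
  shows "mu * norm (y' - y) \<le> L * norm (x' - x)"
proof -
  have "mu * (norm (y' - y))\<^sup>2 \<le> inner (grad_y P G (x, y) - grad_y P G (x', y)) (y' - y)"
    using grad_y_monotone[OF x(2) y(1) y'(1)] y(2) y'(2) by simp
  also have "\<dots> \<le> norm (grad_y P G (x, y) - grad_y P G (x', y)) * norm (y' - y)"
    by (rule norm_cauchy_schwarz)
  also have "\<dots> \<le> L * norm (x' - x) * norm (y' - y)"
    using grad_y_lipschitz[OF smooth, of "(x, y)" "(x', y)"] x y
    by (intro mult_right_mono) (simp_all add: norm_minus_commute)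
  finally show ?thesis
    using mu_pos mu_le_L by (cases "y' = y") (simp_all add: power2_eq_square)
qed

text \<open>Along the stationary points \<open>F\<close> agrees with \<open>K z = F z - inner u (grad_y P G z)\<close>, whose
  derivative does not depend on the \<open>y\<close>-component if \<open>u\<close> solves the adjoint equation. So no derivative of
  \<open>ys\<close> is needed, only that \<open>ys\<close> is Lipschitz.\<close>

lemma implicit_gradient:
  assumes x: "x \<in> X_space P"
    and ys: "\<And>x. x \<in> X_space P \<Longrightarrow> ys x \<in> Y_space P" "\<And>x. x \<in> X_space P \<Longrightarrow> grad_y P G (x, ys x) = 0"
    and F: "has_gradient_on (Z_space P) F (x, ys x) D"
    and u: "u \<in> Y_space P" "hess_yy P G (x, ys x) u = snd D"
  shows "has_gradient_on (X_space P) (\<lambda>x. F (x, ys x)) x (fst D - hess_xy P G (x, ys x) u)"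
proof -
  define z where "z = (x, ys x)"
  define E where "E = fst D - hess_xy P G z u"
  define K where "K w = F w - inner u (grad_y P G w)" for w
  have z: "z \<in> Z_space P" using x ys by (simp add: z_def)
  have D: "D \<in> Z_space P" using F by (simp add: has_gradient_on_def)
  have E: "E \<in> X_space P"
    using fst_snd_mem_Z_space[OF D] hess_xy_mem[OF z u(1)] by (simp add: E_def subspace_diff)
  have K': "(K has_derivative (\<lambda>h. inner h D - inner u (snd (hess P G z h)))) (at z within Z_space P)"
    unfolding K_def grad_y_def
    by (intro has_derivative_diff has_derivative_inner_right has_derivative_snd
        hess_has_derivative[OF twice z]) (use F in \<open>simp add: has_gradient_on_def z_def\<close>)
  \<comment> \<open>Symmetry of the Hessian moves \<open>u\<close> into its argument; the adjoint
    equation then cancels the component of \<open>h\<close> in \<open>y\<close>.\<close>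
  have K'_eq: "inner h D - inner u (snd (hess P G z h)) = inner (fst h) E" if "h \<in> Z_space P" for h
  proof -
    have "inner u (snd (hess P G z h)) = inner (hess P G z h) (0, u)"
      by (simp add: inner_prod_def inner_commute[of u])
    also have "\<dots> = inner (hess P G z (0, u)) h"
      using z that u(1) by (intro hess_symmetric) simp_all
    also have "\<dots> = inner (hess_xy P G z u) (fst h) + inner (snd D) (snd h)"
      using u(2) by (simp add: inner_prod_def hess_xy_def hess_yy_def z_def)
    finally show ?thesis by (simp add: inner_prod_def E_def inner_diff_right inner_commute)
  qed
  \<comment> \<open>A Lipschitz constant of \<open>x' \<mapsto> (x', ys x')\<close> at
    \<open>x\<close>. An error that is small relative to the distance from \<open>z\<close> is
    thereby small relative to \<open>norm (x' - x)\<close>.\<close>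
  define c where "c = 1 + L / mu"
  have c: "0 < c" using mu_pos mu_le_L by (simp add: c_def add_pos_pos)
  have lip: "norm ((x', ys x') - z) \<le> c * norm (x' - x)" if "x' \<in> X_space P" for x'
  proof -
    have "norm (ys x' - ys x) \<le> L / mu * norm (x' - x)"
      using minimizer_lipschitz[OF x that ys(1)[OF x] ys(2)[OF x] ys(1)[OF that] ys(2)[OF that]] mu_pos
      by (simp add: field_simps)
    then show ?thesis
      using norm_Pair_le[of "x' - x" "ys x' - ys x"] by (simp add: z_def c_def algebra_simps)
  qed
  have "((\<lambda>x. F (x, ys x)) has_derivative (\<lambda>h. inner h E)) (at x within X_space P)"
    unfolding has_derivative_within_alt
  proof (intro conjI allI impI)
    show "bounded_linear (\<lambda>h. inner h E)" by (rule bounded_linear_inner_left)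
    fix e :: real assume e: "0 < e"
    then have "0 < e / c" using c by simp
    then obtain d where d: "0 < d" "\<And>w. w \<in> Z_space P \<Longrightarrow> norm (w - z) < d \<Longrightarrow>
        norm (K w - K z - (inner (w - z) D - inner u (snd (hess P G z (w - z))))) \<le> e / c * norm (w - z)"
      using K' unfolding has_derivative_within_alt by blast
    show "\<exists>d>0. \<forall>x'\<in>X_space P. norm (x' - x) < d \<longrightarrow>
        norm (F (x', ys x') - F (x, ys x) - inner (x' - x) E) \<le> e * norm (x' - x)"
    proof (intro exI[of _ "d / c"] conjI ballI impI)
      show "0 < d / c" using d c by simp
      fix x' assume x': "x' \<in> X_space P" "norm (x' - x) < d / c"
      let ?w = "(x', ys x')"
      have w: "?w \<in> Z_space P" using x' ys by simp
      have wz: "?w - z \<in> Z_space P" using w z by (simp add: subspace_diff)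
      have "norm (?w - z) < d" using lip[OF x'(1)] x'(2) c by (simp add: field_simps)
      from d(2)[OF w this]
      have "norm (K ?w - K z - inner (x' - x) E) \<le> e / c * norm (?w - z)"
        unfolding K'_eq[OF wz] by (simp add: z_def)
      also have "\<dots> \<le> e / c * (c * norm (x' - x))" using lip[OF x'(1)] e c by (intro mult_left_mono) auto
      finally show "norm (F (x', ys x') - F (x, ys x) - inner (x' - x) E) \<le> e * norm (x' - x)"
        using c x x' by (simp add: K_def z_def ys)
    qed
  qed
  then show ?thesis using E by (simp add: has_gradient_on_def E_def z_def)
qed

end

section \<open>From single examples to the averaged problem\<close>

lemma strongly_convex_on_mean:
  assumes "0 < n" and F: "\<And>j. j < n \<Longrightarrow> strongly_convex_on S mu (F j)"
  shows "strongly_convex_on S mu (\<lambda>y. (\<Sum>j<n. F j y) / real n)"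
  unfolding strongly_convex_on_def
proof (intro ballI)
  fix x y t assume x: "x \<in> S" and y: "y \<in> S" and t: "t \<in> {0..1::real}"
  let ?q = "mu / 2 * t * (1 - t) * (norm (x - y))\<^sup>2"
  have "(\<Sum>j<n. F j ((1 - t) *\<^sub>R x + t *\<^sub>R y)) \<le> (\<Sum>j<n. (1 - t) * F j x + t * F j y - ?q)"
    by (rule sum_mono) (use F x y t in \<open>auto simp: strongly_convex_on_def\<close>)
  also have "\<dots> = (1 - t) * (\<Sum>j<n. F j x) + t * (\<Sum>j<n. F j y) - real n * ?q"
    by (simp add: sum.distrib sum_subtractf sum_distrib_left)
  finally have "(\<Sum>j<n. F j ((1 - t) *\<^sub>R x + t *\<^sub>R y)) / real n
    \<le> ((1 - t) * (\<Sum>j<n. F j x) + t * (\<Sum>j<n. F j y) - real n * ?q) / real n"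
    by (rule divide_right_mono) simp
  also have "\<dots> = (1 - t) * ((\<Sum>j<n. F j x) / real n) + t * ((\<Sum>j<n. F j y) / real n) - ?q"
    using assms(1) by (simp add: diff_divide_distrib add_divide_distrib)
  finally show "(\<Sum>j<n. F j ((1 - t) *\<^sub>R x + t *\<^sub>R y)) / real n
    \<le> (1 - t) * ((\<Sum>j<n. F j x) / real n) + t * ((\<Sum>j<n. F j y) / real n) - ?q" .
qed

lemma strongly_convex_inner_mean:
  fixes F :: "nat \<Rightarrow> rvec \<times> rvec \<Rightarrow> real"
  assumes n: "0 < n" and F: "\<And>j. j < n \<Longrightarrow> strongly_convex_inner P (F j) L mu Lxy Lyy"
  defines "M \<equiv> \<lambda>z. (\<Sum>j<n. F j z) / real n"
  shows "strongly_convex_inner P M L mu Lxy Lyy"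
proof -
  note sm = strongly_convex_inner.smooth[OF F] and tw = strongly_convex_inner.twice[OF F]
  have hg: "has_gradient_on (Z_space P) M z ((\<Sum>j<n. grad_xy P (F j) z) /\<^sub>R real n)"
    if "z \<in> Z_space P" for z
    unfolding M_def using smooth_on_gradient[OF sm that] by (intro has_gradient_on_mean) simp_all
  have g: "grad_xy P M z = (\<Sum>j<n. grad_xy P (F j) z) /\<^sub>R real n" if "z \<in> Z_space P" for z
    unfolding grad_xy_def[of P M] by (rule grad_on_eqI[OF _ that hg[OF that]]) simp
  have hd: "(grad_xy P M has_derivative (\<lambda>v. (\<Sum>j<n. hess P (F j) z v) /\<^sub>R real n)) (at z within Z_space P)"
    if z: "z \<in> Z_space P" for z
  proof (rule has_derivative_transform[OF z g])
    show "((\<lambda>z. (\<Sum>j<n. grad_xy P (F j) z) /\<^sub>R real n) has_derivative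
      (\<lambda>v. (\<Sum>j<n. hess P (F j) z v) /\<^sub>R real n)) (at z within Z_space P)"
      using hess_has_derivative[OF tw z] by (intro has_derivative_scaleR_right has_derivative_sum) simp
  qed
  have smM: "smooth_on (Z_space P) L M"
    unfolding smooth_on_def
  proof (intro conjI ballI lipschitz_onI)
    show "\<exists>D. has_gradient_on (Z_space P) M z D" if "z \<in> Z_space P" for z using hg[OF that] ..
    show "0 \<le> L" using sm[OF n] lipschitz_on_nonneg by (auto simp: smooth_on_def)
    show "dist (grad_on (Z_space P) M z) (grad_on (Z_space P) M w) \<le> L * dist z w"
      if z: "z \<in> Z_space P" and w: "w \<in> Z_space P" for z w
    proof -
      have "grad_xy P M z - grad_xy P M w = (\<Sum>j<n. grad_xy P (F j) z - grad_xy P (F j) w) /\<^sub>R real n"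
        by (simp add: g z w sum_subtractf scaleR_diff_right)
      then show ?thesis
        using norm_mean_le[OF n, of "\<lambda>j. grad_xy P (F j) z - grad_xy P (F j) w" "L * norm (z - w)"]
          grad_xy_lipschitz[OF sm z w] by (simp add: grad_xy_def dist_norm)
    qed
  qed
  have twM: "twice_differentiable_on (Z_space P) M"
    unfolding twice_differentiable_on_def differentiable_def grad_xy_def[symmetric] using hg hd by blast
  \<comment> \<open>\<open>hess\<close> is a chosen derivative and determined only on the subspace,
    hence the restriction on \<open>v\<close>.\<close>
  have h: "hess P M z v = (\<Sum>j<n. hess P (F j) z v) /\<^sub>R real n" if "z \<in> Z_space P" "v \<in> Z_space P" for z v
    by (rule has_derivative_unique_on_subspace[OF _ that hess_has_derivative[OF twM that(1)] hd[OF that(1)]]) simp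
  show ?thesis
  proof
    show "strongly_convex_on (Y_space P) mu (\<lambda>y. M (x, y))" if "x \<in> X_space P" for x
      unfolding M_def using strongly_convex_inner.convex[OF F that] by (rule strongly_convex_on_mean[OF n])
    fix z w v assume z: "z \<in> Z_space P" and w: "w \<in> Z_space P" and v: "v \<in> Y_space P"
    have eq: "hess_xy P M z v - hess_xy P M w v = (\<Sum>j<n. hess_xy P (F j) z v - hess_xy P (F j) w v) /\<^sub>R real n"
      "hess_yy P M z v - hess_yy P M w v = (\<Sum>j<n. hess_yy P (F j) z v - hess_yy P (F j) w v) /\<^sub>R real n"
      using z w v by (simp_all add: hess_xy_def hess_yy_def h fst_sum snd_sum sum_subtractf scaleR_diff_right)
    show "norm (hess_xy P M z v - hess_xy P M w v) \<le> Lxy * norm (z - w) * norm v"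
      unfolding eq using strongly_convex_inner.hess_xy_lipschitz[OF F z w v] by (rule norm_mean_le[OF n])
    show "norm (hess_yy P M z v - hess_yy P M w v) \<le> Lyy * norm (z - w) * norm v"
      unfolding eq using strongly_convex_inner.hess_yy_lipschitz[OF F z w v] by (rule norm_mean_le[OF n])
  qed (use smM twM F[OF n] in \<open>auto simp: strongly_convex_inner_def\<close>)
qed

text \<open>Separate from the problem: constants defined in this context can depend on the five
  parameters only, as the order of quantifiers in the theorem demands.\<close>

locale cbo_constants =
  fixes L mu Cf Lxy Lyy :: real
  assumes pos: "0 < L" "0 < mu" "0 < Cf" "0 < Lxy" "0 < Lyy"

locale regular_cbo = cbo_constants L mu Cf Lxy Lyy for P :: cbo and L mu Cf Lxy Lyy +
  assumes problem: "cbo_problem P"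
    and outer: "outer_regular P L Cf"
    and inner_reg: "inner_regular P L mu Lxy Lyy"
begin

lemma inner_fun_regular:
  assumes "i < num_outer P" "j < num_inner P i"
  shows "strongly_convex_inner P (inner_fun P i j) L mu Lxy Lyy"
proof -
  let ?G = "inner_fun P i j"
  have G: "smooth_on (Z_space P) L ?G" "twice_differentiable_on (Z_space P) ?G"
    "\<And>x. x \<in> X_space P \<Longrightarrow> strongly_convex_on (Y_space P) mu (\<lambda>y. ?G (x, y))"
    "\<And>z w. z \<in> Z_space P \<Longrightarrow> w \<in> Z_space P \<Longrightarrow>
      onorm_on (Y_space P) (\<lambda>v. hess_xy P ?G z v - hess_xy P ?G w v) \<le> Lxy * norm (z - w) \<and>
      onorm_on (Y_space P) (\<lambda>v. hess_yy P ?G z v - hess_yy P ?G w v) \<le> Lyy * norm (z - w)"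
    using inner_reg assms by (auto simp: inner_regular_def Let_def)
  show ?thesis
  proof
    fix z w v assume z: "z \<in> Z_space P" and w: "w \<in> Z_space P" and v: "v \<in> Y_space P"
    note bl = bounded_linear_hess_blocks[OF G(2)]
    show "norm (hess_xy P ?G z v - hess_xy P ?G w v) \<le> Lxy * norm (z - w) * norm v"
      using norm_le_onorm_on[OF bounded_linear_sub[OF bl(1)[OF z] bl(1)[OF w]] v] G(4)[OF z w]
      by (meson mult_right_mono norm_ge_zero order.trans)
    show "norm (hess_yy P ?G z v - hess_yy P ?G w v) \<le> Lyy * norm (z - w) * norm v"
      using norm_le_onorm_on[OF bounded_linear_sub[OF bl(2)[OF z] bl(2)[OF w]] v] G(4)[OF z w]
      by (meson mult_right_mono norm_ge_zero order.trans)
  qed (use G pos problem in \<open>auto simp: cbo_problem_def\<close>)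
qed

lemma inner_obj_regular:
  assumes "i < num_outer P"
  shows "strongly_convex_inner P (inner_obj P i) L mu Lxy Lyy"
proof -
  have "inner_obj P i = (\<lambda>z. (\<Sum>j<num_inner P i. inner_fun P i j z) / real (num_inner P i))"
    by (rule ext) (simp add: inner_obj_def)
  then show ?thesis
    using strongly_convex_inner_mean[OF _ inner_fun_regular[OF assms]] problem assms
    by (simp add: cbo_problem_def)
qed

lemma outer_fun_smooth: "i < num_outer P \<Longrightarrow> smooth_on (Z_space P) L (outer_fun P i)"
  using outer by (simp add: outer_regular_def)

lemma outer_grad_y_bound: "i < num_outer P \<Longrightarrow> z \<in> Z_space P \<Longrightarrow> norm (grad_y P (outer_fun P i) z) \<le> Cf"
  using outer by (simp add: outer_regular_def)

lemma mu_le_L: "mu \<le> L"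
  using strongly_convex_inner.mu_le_L[OF inner_obj_regular[of 0]] problem by (simp add: cbo_problem_def)

lemma y_star:
  assumes "i < num_outer P" "x \<in> X_space P"
  shows "y_star P i x \<in> Y_space P" "grad_y P (inner_obj P i) (x, y_star P i x) = 0"
  unfolding y_star_def using strongly_convex_inner.minimizer[OF inner_obj_regular[OF assms(1)] assms(2)] .

lemma u_star:
  assumes i: "i < num_outer P" and x: "x \<in> X_space P"
  shows "u_star P i x \<in> Y_space P"
    and "hess_yy P (inner_obj P i) (x, y_star P i x) (u_star P i x) = grad_y P (outer_fun P i) (x, y_star P i x)"
    and "norm (u_star P i x) \<le> Cf / mu"
proof -
  have z: "(x, y_star P i x) \<in> Z_space P" using y_star[OF i x] x by simp
  note sol = strongly_convex_inner.hess_yy_solution[OF inner_obj_regular[OF i] z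
      grad_y_mem[OF outer_fun_smooth[OF i] z]]
  show "u_star P i x \<in> Y_space P"
    "hess_yy P (inner_obj P i) (x, y_star P i x) (u_star P i x) = grad_y P (outer_fun P i) (x, y_star P i x)"
    unfolding u_star_def using sol(1,2) .
  have "mu * norm (u_star P i x) \<le> Cf"
    unfolding u_star_def using sol(3) outer_grad_y_bound[OF i z] by (rule order.trans)
  then show "norm (u_star P i x) \<le> Cf / mu" using pos by (simp add: field_simps)
qed

lemma grad_h_ex_eq:
  assumes i: "i < num_outer P" and x: "x \<in> X_space P"
  defines "z \<equiv> (x, y_star P i x)"
  shows "grad_h_ex P i x = grad_x P (outer_fun P i) z - hess_xy P (inner_obj P i) z (u_star P i x)"
proof -
  have z: "z \<in> Z_space P" using y_star[OF i x] x by (simp add: z_def)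
  have "has_gradient_on (X_space P) (\<lambda>x. outer_fun P i (x, y_star P i x)) x
      (fst (grad_xy P (outer_fun P i) z) - hess_xy P (inner_obj P i) (x, y_star P i x) (u_star P i x))"
    using smooth_on_gradient[OF outer_fun_smooth[OF i] z] u_star[OF i x]
    by (intro strongly_convex_inner.implicit_gradient[OF inner_obj_regular[OF i] x y_star[OF i]])
      (simp_all add: z_def grad_y_def)
  then show ?thesis
    unfolding grad_h_ex_def h_ex_def[abs_def] using x
    by (simp add: grad_on_eqI z_def grad_x_def)
qed

end

section \<open>Blocks of SGD steps\<close>

lemma le_powr_half_of_square_le:
  assumes "a\<^sup>2 \<le> real s powr (-al) * C\<^sup>2"
  shows "a \<le> \<bar>C\<bar> * real s powr (-al / 2)"
proof (rule power2_le_imp_le)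
  have "(real s powr (-al / 2))\<^sup>2 = real s powr (-al)"
    by (simp add: power2_eq_square powr_add[symmetric])
  then show "a\<^sup>2 \<le> (\<bar>C\<bar> * real s powr (-al / 2))\<^sup>2"
    using assms by (simp only: power_mult_distrib power2_abs mult.commute)
qed simp

lemma norm_sum_of_mean:
  fixes F :: "nat \<Rightarrow> 'b::real_normed_vector"
  assumes "0 < s" "norm ((\<Sum>\<tau>=t..<t+s. F \<tau>) /\<^sub>R real s - m) \<le> b"
  shows "norm (\<Sum>\<tau>=t..<t+s. F \<tau> - m) \<le> real s * b"
proof -
  have "(\<Sum>\<tau>=t..<t+s. F \<tau> - m) = real s *\<^sub>R ((\<Sum>\<tau>=t..<t+s. F \<tau>) /\<^sub>R real s - m)"
    using assms(1) by (simp add: sum_subtractf scaleR_diff_right sum_constant_scaleR)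
  then show ?thesis using assms by (simp add: mult_left_mono)
qed

text \<open>For \<open>al > 2\<close> the bound on an interval of length \<open>s\<close> is useless for small \<open>s\<close>. A short interval is
  then treated as the difference of two long ones, of which the second is bounded at \<open>z (t + s)\<close>.\<close>

lemma short_interval_bound:
  fixes d :: "nat \<Rightarrow> 'z \<Rightarrow> 'b::real_normed_vector"
  assumes avg: "\<And>t s. t < T \<Longrightarrow> averaging_interval al T t s \<Longrightarrow>
      norm (\<Sum>\<tau>=t..<t+s. d \<tau> (z t)) \<le> real s * (c * real s powr (-al / 2))"
    and k: "0 < k" "s \<le> k" "t + s < T \<or> s = k \<and> t + k \<le> T"
    and drift: "\<And>\<tau>. norm (d \<tau> (z (t + s)) - d \<tau> (z t)) \<le> b"
    and c: "0 \<le> c"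
  shows "norm (\<Sum>\<tau>=t..<t+s. d \<tau> (z t)) \<le> real k * (2 * (c * real k powr (-al / 2)) + b)"
proof -
  define N where "N s = real s * (c * real s powr (-al / 2))" for s :: nat
  \<comment> \<open>The noise of a whole sum is increasing in its length for
    \<open>al \<le> 2\<close> and decreasing for \<open>al > 2\<close>; the case distinction rests
    on this.\<close>
  have N: "N s = c * real s powr (1 - al / 2)" if "0 < s" for s
    using that powr_add[of "real s" 1 "-al / 2"] by (simp add: N_def)
  have N0: "0 \<le> N s" for s using c by (simp add: N_def)
  have b: "0 \<le> b" using drift order.trans norm_ge_zero by blast
  have "norm (\<Sum>\<tau>=t..<t+s. d \<tau> (z t)) \<le> N k + (N k + real k * b)"
  proof (cases "s = 0 \<or> al \<le> 2 \<or> s = k")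
    case True
    have "norm (\<Sum>\<tau>=t..<t+s. d \<tau> (z t)) \<le> N k" if "0 < s"
    proof -
      have "norm (\<Sum>\<tau>=t..<t+s. d \<tau> (z t)) \<le> N s"
        unfolding N_def using k that by (intro avg) (auto simp: averaging_interval_def)
      also have "N s \<le> N k"
      proof (cases "s = k")
        case False
        then have "al \<le> 2" using True that by simp
        then show ?thesis
          using k that c by (simp add: N mult_left_mono powr_mono2)
      qed simp
      finally show ?thesis .
    qed
    then show ?thesis using N0[of k] b by (cases "s = 0") (auto intro: add_increasing2)
  next
    case False
    then have s: "0 < s" "2 < al" "t + s < T" using k by auto
    have mono: "N (s + k) \<le> N k"
      using s k c by (simp add: N mult_left_mono powr_mono2')
    have "(\<Sum>\<tau>=t..<t+s. d \<tau> (z t)) + (\<Sum>\<tau>=t+s..<t+s+k. d \<tau> (z t)) = (\<Sum>\<tau>=t..<t+(s+k). d \<tau> (z t))"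
      by (simp add: sum.atLeastLessThan_concat add.assoc)
    then have "(\<Sum>\<tau>=t..<t+s. d \<tau> (z t)) = (\<Sum>\<tau>=t..<t+(s+k). d \<tau> (z t))
      - (\<Sum>\<tau>=t+s..<t+s+k. d \<tau> (z (t + s)))
      + (\<Sum>\<tau>=t+s..<t+s+k. d \<tau> (z (t + s)) - d \<tau> (z t))"
      by (simp add: sum_subtractf algebra_simps)
    also have "norm \<dots> \<le> N (s + k) + N k + real k * b"
    proof (intro order.trans[OF norm_triangle_ineq] order.trans[OF norm_triangle_ineq4] add_mono)
      show "norm (\<Sum>\<tau>=t..<t+(s+k). d \<tau> (z t)) \<le> N (s + k)"
        unfolding N_def using s by (intro avg) (auto simp: averaging_interval_def)
      show "norm (\<Sum>\<tau>=t+s..<t+s+k. d \<tau> (z (t + s))) \<le> N k"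
        unfolding N_def using s k by (intro avg) (auto simp: averaging_interval_def)
      show "norm (\<Sum>\<tau>=t+s..<t+s+k. d \<tau> (z (t + s)) - d \<tau> (z t)) \<le> real k * b"
        using sum_norm_bound[of "{t+s..<t+s+k}" "\<lambda>\<tau>. d \<tau> (z (t + s)) - d \<tau> (z t)" b] drift by simp
    qed
    finally show ?thesis using mono by linarith
  qed
  then show ?thesis by (simp add: N_def algebra_simps)
qed

text \<open>Serves both loops: \<open>F\<close> is the sampled gradient, \<open>M\<close> its mean
  and \<open>b\<close> the bias of the estimates, which is zero for the inner variable
  \<open>y\<close>. The drift appears on both sides of its own estimate with the factor
  \<open>3 * eta * k * La \<le> 3 / 8\<close>; absorbing it produces
  \<open>1 / (1 - 3 / 8) = 8 / 5\<close>. The condition on \<open>s\<close> makes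
  \<open>t + s < T\<close> for incomplete blocks, since a second averaging interval may start at
  \<open>t + s\<close>.\<close>

lemma block_drift:
  fixes F :: "nat \<Rightarrow> 'a::real_normed_vector \<Rightarrow> 'a"
  assumes zS: "\<And>t. z t \<in> S"
    and lipF: "\<And>\<tau> v w. v \<in> S \<Longrightarrow> w \<in> S \<Longrightarrow> norm (F \<tau> v - F \<tau> w) \<le> La * norm (v - w)"
    and lipM: "\<And>v w. v \<in> S \<Longrightarrow> w \<in> S \<Longrightarrow> norm (M v - M w) \<le> La * norm (v - w)"
    and avg: "\<And>t s. t < T \<Longrightarrow> averaging_interval al T t s \<Longrightarrow>
      (norm ((\<Sum>\<tau>=t..<t+s. F \<tau> (z t)) /\<^sub>R real s - M (z t)))\<^sup>2 \<le> real s powr (-al) * C\<^sup>2"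
    and step: "\<And>\<tau>. \<tau> < T \<Longrightarrow> z (Suc \<tau>) = z \<tau> - eta *\<^sub>R (F \<tau> (z \<tau>) + b \<tau>)"
    and b: "\<And>\<tau>. \<tau> < T \<Longrightarrow> norm (b \<tau>) \<le> B"
    and par: "0 \<le> eta" "0 \<le> La" "0 < k" "8 * (eta * real k * La) \<le> 1"
    and N: "N = \<bar>C\<bar> * real k powr (-al / 2)"
  defines "D \<equiv> \<lambda>t. 8 / 5 * (eta * real k * (norm (M (z t)) + 2 * N + B))"
  shows "s \<le> k \<Longrightarrow> t + s < T \<or> s = k \<and> t + k \<le> T \<Longrightarrow> norm (z (t + s) - z t) \<le> D t"
    and "t + k \<le> T \<Longrightarrow> \<exists>e. z (t + k) = z t - (eta * real k) *\<^sub>R (M (z t) + e) \<and>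
      norm e \<le> N + B + La * D t"
proof -
  define d where "d \<tau> v = F \<tau> v - M v" for \<tau> v
  have avg': "norm (\<Sum>\<tau>=t..<t+s. d \<tau> (z t)) \<le> real s * (\<bar>C\<bar> * real s powr (-al / 2))"
    if "t < T" "averaging_interval al T t s" for t s
    unfolding d_def using that le_powr_half_of_square_le[OF avg[OF that]]
    by (intro norm_sum_of_mean) (auto simp: averaging_interval_def)
  \<comment> \<open>The telescoped displacement, split into the change of the sampled gradients, the
    noise at the start of the block, the mean gradient and the bias.\<close>
  have disp: "z (t + r) - z t = - (eta *\<^sub>R ((\<Sum>\<tau>=t..<t+r. F \<tau> (z \<tau>) - F \<tau> (z t)) +
      (\<Sum>\<tau>=t..<t+r. d \<tau> (z t)) + real r *\<^sub>R M (z t) + (\<Sum>\<tau>=t..<t+r. b \<tau>)))" if "t + r \<le> T" for t r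
    using that
  proof (induction r)
    case (Suc r)
    then have "z (t + Suc r) - z t = (z (t + r) - z t) - eta *\<^sub>R (F (t + r) (z (t + r)) + b (t + r))"
      using step[of "t + r"] by simp
    also have "z (t + r) - z t = - (eta *\<^sub>R ((\<Sum>\<tau>=t..<t+r. F \<tau> (z \<tau>) - F \<tau> (z t)) +
      (\<Sum>\<tau>=t..<t+r. d \<tau> (z t)) + real r *\<^sub>R M (z t) + (\<Sum>\<tau>=t..<t+r. b \<tau>)))"
      using Suc by simp
    finally show ?case by (simp add: d_def algebra_simps)
  qed simp
  have dev: "norm (\<Sum>\<tau>=t..<t+r. F \<tau> (z \<tau>) - F \<tau> (z t)) \<le> real k * (La * D')"
    if r: "r \<le> k" "\<And>r'. r' < r \<Longrightarrow> norm (z (t + r') - z t) \<le> D'" "0 \<le> D'" for t r D'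
  proof -
    have "norm (F \<tau> (z \<tau>) - F \<tau> (z t)) \<le> La * D'" if t: "\<tau> \<in> {t..<t+r}" for \<tau>
      using r(2)[of "\<tau> - t"] t par lipF[OF zS zS, of \<tau> \<tau> t]
      by (auto intro: order.trans[OF _ mult_left_mono])
    then have "norm (\<Sum>\<tau>=t..<t+r. F \<tau> (z \<tau>) - F \<tau> (z t)) \<le> real r * (La * D')"
      using sum_norm_bound[of "{t..<t+r}" "\<lambda>\<tau>. F \<tau> (z \<tau>) - F \<tau> (z t)" "La * D'"] by simp
    also have "\<dots> \<le> real k * (La * D')" using r par by (intro mult_right_mono) auto
    finally show ?thesis .
  qed
  have bsum: "norm (\<Sum>\<tau>=t..<t+r. b \<tau>) \<le> real k * B" if "r \<le> k" "t + r \<le> T" "0 < T" for t r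
  proof -
    have "norm (\<Sum>\<tau>=t..<t+r. b \<tau>) \<le> real r * B"
      using sum_norm_bound[of "{t..<t+r}" b B] b that by simp
    also have "\<dots> \<le> real k * B"
      using that order.trans[OF norm_ge_zero b[of 0]] by (intro mult_right_mono) auto
    finally show ?thesis .
  qed
  show drift: "norm (z (t + s) - z t) \<le> D t" if s: "s \<le> k" "t + s < T \<or> s = k \<and> t + k \<le> T" for t s
  proof -
    \<comment> \<open>The largest displacement so far bounds all terms of the sum, so that one
      inequality for \<open>D'\<close> replaces an induction over the steps.\<close>
    define D' where "D' = Max ((\<lambda>r. norm (z (t + r) - z t)) ` {..s})"
    have D': "norm (z (t + r) - z t) \<le> D'" if "r \<le> s" for r
      unfolding D'_def using that by (intro Max_ge) auto
    have D'0: "0 \<le> D'" using D'[of 0] by simp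
    have T: "t + s \<le> T" "0 < T" using s par by auto
    let ?X = "norm (M (z t)) + 2 * N + B"
    have "norm (z (t + r) - z t) \<le> eta * (real k * (?X + 3 * La * D'))" if r: "r \<le> s" for r
    proof -
      \<comment> \<open>Both \<open>F \<tau>\<close> and \<open>M\<close> contribute their Lipschitz
        constant; with the change of the sampled gradients this makes the factor
        \<open>3\<close>.\<close>
      have "norm (d \<tau> (z (t + r)) - d \<tau> (z t)) \<le> 2 * La * D'" for \<tau>
      proof -
        have "norm (F \<tau> (z (t + r)) - F \<tau> (z t)) \<le> La * D'" "norm (M (z (t + r)) - M (z t)) \<le> La * D'"
          using lipF[OF zS zS, of \<tau> "t + r" t] lipM[OF zS zS, of "t + r" t]
            mult_left_mono[OF D'[OF r] par(2)] by linarith+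
        moreover have "d \<tau> (z (t + r)) - d \<tau> (z t)
          = (F \<tau> (z (t + r)) - F \<tau> (z t)) - (M (z (t + r)) - M (z t))"
          by (simp add: d_def)
        ultimately show ?thesis
          using norm_triangle_ineq4[of "F \<tau> (z (t + r)) - F \<tau> (z t)" "M (z (t + r)) - M (z t)"]
          by simp
      qed
      then have dsum: "norm (\<Sum>\<tau>=t..<t+r. d \<tau> (z t)) \<le> real k * (2 * N + 2 * La * D')"
        unfolding N using r s par(3) by (intro short_interval_bound[where d = d and z = z, OF avg']) auto
      have "norm (z (t + r) - z t) = eta * norm ((\<Sum>\<tau>=t..<t+r. F \<tau> (z \<tau>) - F \<tau> (z t)) +
          (\<Sum>\<tau>=t..<t+r. d \<tau> (z t)) + real r *\<^sub>R M (z t) + (\<Sum>\<tau>=t..<t+r. b \<tau>))"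
        using disp[of t r] r T par by simp
      also have "\<dots> \<le> eta * (real k * (La * D') + real k * (2 * N + 2 * La * D')
          + real k * norm (M (z t)) + real k * B)"
        using par r s T D' D'0
        by (intro mult_left_mono order.trans[OF norm_triangle_ineq] add_mono dev dsum bsum)
          (auto intro!: mult_right_mono)
      also have "\<dots> = eta * (real k * (?X + 3 * La * D'))" by (simp add: algebra_simps)
      finally show ?thesis .
    qed
    then have "D' \<le> eta * (real k * (?X + 3 * La * D'))"
      unfolding D'_def[symmetric] by (subst D'_def) (auto intro!: Max.boundedI)
    also have "\<dots> = eta * real k * ?X + 3 * ((eta * real k * La) * D')" by (simp add: algebra_simps)
    also have "(eta * real k * La) * D' \<le> 1 / 8 * D'" using par D'0 by (intro mult_right_mono) auto
    finally have "D' \<le> D t" by (simp add: D_def)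
    then show ?thesis using D'[of s] by simp
  qed
  show "\<exists>e. z (t + k) = z t - (eta * real k) *\<^sub>R (M (z t) + e) \<and> norm e \<le> N + B + La * D t"
    if t: "t + k \<le> T" for t
  proof -
    define W where "W = (\<Sum>\<tau>=t..<t+k. F \<tau> (z \<tau>) - F \<tau> (z t)) + (\<Sum>\<tau>=t..<t+k. d \<tau> (z t)) +
      (\<Sum>\<tau>=t..<t+k. b \<tau>)"
    have T: "t < T" "0 < T" using t par by auto
    have D0: "0 \<le> D t" using drift[of 0 t] T by simp
    have "norm W \<le> real k * (La * D t) + real k * N + real k * B"
      unfolding W_def
    proof (intro order.trans[OF norm_triangle_ineq] add_mono dev bsum)
      show "norm (\<Sum>\<tau>=t..<t+k. d \<tau> (z t)) \<le> real k * N"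
        unfolding N using t par T by (intro avg') (auto simp: averaging_interval_def)
    qed (use drift t D0 T in auto)
    then have W: "norm W \<le> real k * (N + B + La * D t)" by (simp add: algebra_simps)
    have "z (t + k) = z t - (eta * real k) *\<^sub>R (M (z t) + W /\<^sub>R real k)"
      using disp[OF t] par(3) by (simp add: W_def algebra_simps)
    moreover have "norm (W /\<^sub>R real k) \<le> N + B + La * D t"
      using W par(3) by (simp add: field_simps)
    ultimately show ?thesis by blast
  qed
qed

lemma geometric_recursion_bound:
  fixes V :: "nat \<Rightarrow> real"
  assumes "0 \<le> th" "th < 1" "0 \<le> a" and step: "\<And>j. j < b \<Longrightarrow> V (Suc j) \<le> th * V j + a"
  shows "V b \<le> th ^ b * V 0 + a / (1 - th)"
  using step
proof (induction b)
  case (Suc b)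
  have "V (Suc b) \<le> th * V b + a" using Suc.prems by simp
  also have "th * V b \<le> th * (th ^ b * V 0 + a / (1 - th))"
    using Suc assms(1) by (intro mult_left_mono) auto
  also have "th * (th ^ b * V 0 + a / (1 - th)) + a = th ^ Suc b * V 0 + a / (1 - th)"
    using assms(2) by (simp add: field_simps)
  finally show ?case by simp
qed (use assms in simp)

section \<open>The inner loop\<close>

text \<open>Converts \<open>k\<close> stepwise contractions of \<open>u\<close> into one rate per
  block. Bernoulli's inequality bounds \<open>(1 + r) ^ k\<close> from below by
  \<open>1 + q\<close>, where \<open>q = k * r\<close>, and the product of the two powers is at most
  \<open>1\<close>. For \<open>q \<ge> 0\<close>, the condition \<open>q \<le> 1 / 3\<close> is
  exactly what gives \<open>(1 - 3 / 4 * q) * (1 + q) \<ge> 1\<close>.\<close>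

lemma power_one_minus_le:
  fixes r :: real
  assumes "0 \<le> r" "r \<le> 1" "real k * r \<le> 1 / 3"
  shows "(1 - r) ^ k \<le> 1 - 3 / 4 * (real k * r)"
proof -
  define q where "q = real k * r"
  have q: "0 \<le> q" "q \<le> 1 / 3" using assms by (auto simp: q_def)
  have "(1 - r) ^ k * (1 + q) \<le> (1 - r) ^ k * (1 + r) ^ k"
    unfolding q_def using assms by (intro mult_left_mono Bernoulli_inequality) auto
  also have "\<dots> = (1 - r * r) ^ k" by (simp add: power_mult_distrib[symmetric] algebra_simps)
  also have "\<dots> \<le> 1" using assms by (intro power_le_one) (auto simp: mult_le_one)
  also have "1 \<le> (1 - 3 / 4 * q) * (1 + q)"
  proof -
    have "q * (3 * q) \<le> q * 1" using q by (intro mult_left_mono) auto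
    then show ?thesis by (simp add: algebra_simps)
  qed
  finally have "(1 - r) ^ k * (1 + q) \<le> (1 - 3 / 4 * q) * (1 + q)" .
  then show ?thesis using q by (simp add: q_def)
qed

text \<open>The weight \<open>4 * c2 / p\<close> makes the coupling term \<open>c2 * A l\<close> small against the contraction of \<open>A\<close>, so the
  weighted sum contracts with the slower of the two rates.\<close>

lemma two_level_recursion:
  fixes v A :: "nat \<Rightarrow> real"
  assumes nonneg: "\<And>l. 0 \<le> v l" "\<And>l. 0 \<le> A l" "0 \<le> N" "0 \<le> c1" "0 < c2" "0 \<le> c3" "0 \<le> dA" "0 \<le> dN"
    and p: "0 < p" "p \<le> 1"
    and part: "\<And>r. r < k \<Longrightarrow> r < M \<Longrightarrow> v r \<le> v 0 + c1 * N + c2 * A 0 \<and> A r \<le> (1 + dA) * A 0 + dN * N"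
    and block: "\<And>l. l + k \<le> M \<Longrightarrow>
      v (l + k) \<le> (1 - 3 / 4 * p) * v l + c1 * N + c2 * A l \<and> A (l + k) \<le> (1 - p) * A l + c3 * N"
    and M: "El * k \<le> M" "0 < El" "0 < k"
    and lam: "lam = 4 * c2 / p"
  shows "v M + lam * A M \<le> (2 + dA) * (1 - 3 / 4 * p) ^ El * (v 0 + lam * A 0)
    + (c1 + lam * dN + 4 * (c1 + lam * c3) / (3 * p)) * N"
proof -
  define W where "W l = v l + lam * A l" for l
  define th where "th = 1 - 3 / 4 * p"
  have th: "0 \<le> th" "th < 1" "th \<le> 1" using p by (auto simp: th_def)
  have lam0: "0 \<le> lam" "c2 \<le> lam" and lamp: "lam * p = 4 * c2"
    using nonneg p by (auto simp: lam field_simps)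
  have W0: "0 \<le> W l" for l using nonneg lam0 by (simp add: W_def)
  \<comment> \<open>The incomplete block comes first, so that full blocks lead from \<open>r\<close>
    exactly to \<open>M\<close>; there are at least \<open>El\<close> of them.\<close>
  define r where "r = M mod k"
  define b where "b = M div k"
  have b: "El \<le> b" unfolding b_def using M by (simp add: less_eq_div_iff_mult_less_eq)
  have Mrb: "M = r + b * k" by (simp add: r_def b_def)
  have r: "r < k" using M by (simp add: r_def)
  also have "k \<le> El * k" using M by simp
  finally have rM: "r < M" using M by linarith
  have WS: "W (l + k) \<le> th * W l + (c1 + lam * c3) * N" if "l + k \<le> M" for l
  proof -
    have "W (l + k) \<le> th * v l + c1 * N + c2 * A l + lam * ((1 - p) * A l + c3 * N)"
      unfolding W_def th_def using block[OF that] lam0 by (intro add_mono mult_left_mono) auto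
    also have "\<dots> = th * v l + (c1 + lam * c3) * N + (lam - lam * p + c2) * A l"
      by (simp add: algebra_simps)
    also have "lam - lam * p + c2 = th * lam"
      using lamp by (simp add: th_def algebra_simps)
    finally show ?thesis by (simp add: W_def algebra_simps)
  qed
  have "W (r + Suc j * k) \<le> th * W (r + j * k) + (c1 + lam * c3) * N" if "j < b" for j
  proof -
    have "Suc j * k \<le> b * k" using that by (intro mult_right_mono) auto
    then have "r + j * k + k \<le> M" by (simp add: Mrb)
    from WS[OF this] show ?thesis by (simp add: algebra_simps)
  qed
  from geometric_recursion_bound[where V = "\<lambda>j. W (r + j * k)", OF th(1,2) _ this]
  have "W M \<le> th ^ b * W r + (c1 + lam * c3) * N / (1 - th)"
    using nonneg lam0 by (simp add: Mrb)
  also have "\<dots> \<le> th ^ b * ((2 + dA) * W 0 + (c1 + lam * dN) * N) + (c1 + lam * c3) * N / (1 - th)"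
  proof -
    have "W r \<le> v 0 + c1 * N + c2 * A 0 + lam * ((1 + dA) * A 0 + dN * N)"
      unfolding W_def using part[OF r rM] lam0 by (intro add_mono mult_left_mono) auto
    also have "c2 * A 0 \<le> lam * A 0" using lam0 nonneg by (intro mult_right_mono) auto
    also have "v 0 + c1 * N + lam * A 0 + lam * ((1 + dA) * A 0 + dN * N)
      = 1 * v 0 + (2 + dA) * (lam * A 0) + (c1 + lam * dN) * N" by (simp add: algebra_simps)
    also have "1 * v 0 \<le> (2 + dA) * v 0" using nonneg by (intro mult_right_mono) auto
    finally show ?thesis using th by (intro add_right_mono mult_left_mono) (simp_all add: W_def algebra_simps)
  qed
  also have "\<dots> = th ^ b * ((2 + dA) * W 0) + th ^ b * ((c1 + lam * dN) * N) + (c1 + lam * c3) * N / (1 - th)"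
    by (simp add: algebra_simps)
  also have "\<dots> \<le> th ^ El * ((2 + dA) * W 0) + 1 * ((c1 + lam * dN) * N) + (c1 + lam * c3) * N / (1 - th)"
    using th b nonneg W0 lam0
    by (intro add_mono mult_right_mono power_decreasing power_le_one) auto
  also have "\<dots> = (2 + dA) * th ^ El * W 0 + (c1 + lam * dN + 4 * (c1 + lam * c3) / (3 * p)) * N"
    using p by (simp add: th_def field_simps)
  finally show ?thesis by (simp add: W_def th_def)
qed

context cbo_constants
begin

text \<open>\<open>sg = rho * k\<close> and \<open>2 * sg = gam * k\<close> are the step lengths of a whole block.\<close>

definition "sg = mu / (512 * L\<^sup>2)"
definition "radius = Cf / mu"
text \<open>The factor \<open>8 / 5\<close> of \<open>block_drift\<close> times the block step
  \<open>2 * sg\<close>: multiplied by \<open>L\<close> for the error of \<open>y\<close>, and by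
  \<open>2\<close> in \<open>drift_noise\<close> for the noise.\<close>

definition "drift_err = 16 / 5 * sg * L"
definition "drift_noise = 32 / 5 * sg"
definition "y_noise = 2 * sg * (1 + 32 / 5 * sg * L)"
text \<open>\<open>u_coupling\<close> and \<open>u_noise\<close> are the coefficients of the error
  of \<open>y\<close> and of the noise in the block bound for \<open>u\<close>. The factor
  \<open>3 * sg\<close> counts the accumulated Hessian noise twice for a projection and once for
  undoing the shift; \<open>sg\<^sup>2 * L\<close> is the Hessian applied to that noise. The last
  summand is the Lipschitz error of the linear system.\<close>

definition "u_coupling =
  (3 * sg + sg\<^sup>2 * L) * (2 * Lyy * radius * drift_err) + sg * (Lyy * radius + L) * (1 + drift_err)"
definition "u_noise =
  (3 * sg + sg\<^sup>2 * L) * (2 * radius + 2 * Lyy * radius * drift_noise) + sg * (Lyy * radius + L) * drift_noise"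
definition "weight = 4 * u_coupling / (sg * mu)"
text \<open>\<open>inner_gain\<close> and \<open>inner_noise\<close> are the constants returned by
  \<open>two_level_recursion\<close>.\<close>

definition "inner_gain = 2 + drift_err"
definition "inner_noise =
  u_noise + weight * drift_noise + 4 * (u_noise + weight * y_noise) / (3 * (sg * mu))"
definition "rate = 1 - 3 / 4 * (sg * mu)"

lemma constants_pos:
  "0 < sg" "0 < radius" "0 < drift_err" "0 < drift_noise" "0 < y_noise" "0 < u_coupling" "0 < u_noise"
  "0 < weight" "0 < inner_gain" "0 < inner_noise"
proof -
  show sg: "0 < sg" and R: "0 < radius" using pos by (simp_all add: sg_def radius_def)
  show d: "0 < drift_err" "0 < drift_noise" "0 < y_noise"
    using sg pos by (simp_all add: drift_err_def drift_noise_def y_noise_def add_pos_pos)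
  show u: "0 < u_coupling" "0 < u_noise"
    unfolding u_coupling_def u_noise_def using sg R d pos
    by (intro add_pos_pos mult_pos_pos; simp)+
  show w: "0 < weight" using u sg pos by (simp add: weight_def)
  show "0 < inner_gain" using d by (simp add: inner_gain_def)
  show "0 < inner_noise"
    unfolding inner_noise_def using u w d sg pos
    by (intro add_pos_pos mult_pos_pos divide_pos_pos) simp_all
qed

end

text \<open>A single outer step with \<open>x\<close> fixed. Facts that do not concern noise are
  also used with \<open>N = 0\<close>, where the averaging bounds are vacuous.\<close>

locale inner_loop = regular_cbo P L mu Cf Lxy Lyy for P :: cbo and L mu Cf Lxy Lyy +
  fixes i :: nat and x y0 u0 :: rvec and ze :: "nat \<Rightarrow> nat" and k N :: nat and al C gam rho :: real
    and y u :: "nat \<Rightarrow> rvec"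
  assumes i: "i < num_outer P" and x: "x \<in> X_space P"
    and y0: "y0 \<in> Y_space P" and u0: "u0 \<in> Y_space P"
    and ze: "\<And>l. ze l < num_inner P i"
    and k: "0 < k" and rho: "rho * real k = sg" and gam: "gam = 2 * rho"
    and y_def: "\<And>l. y l = fst (inner_iter P (Cf / mu) (\<lambda>_. gam) (\<lambda>_. rho) y0 u0 i ze x l)"
    and u_def: "\<And>l. u l = snd (inner_iter P (Cf / mu) (\<lambda>_. gam) (\<lambda>_. rho) y0 u0 i ze x l)"
    and avg_grad: "\<And>l s. l < N \<Longrightarrow> averaging_interval al N l s \<Longrightarrow>
      (norm ((\<Sum>l'=l..<l+s. grad_xy P (inner_fun P i (ze l')) (x, y l)) /\<^sub>R real s
        - grad_xy P (inner_obj P i) (x, y l)))\<^sup>2 \<le> real s powr (-al) * C\<^sup>2"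
    and avg_hess: "\<And>l s. l < N \<Longrightarrow> averaging_interval al N l s \<Longrightarrow>
      (onorm_on (Z_space P) (\<lambda>v. (\<Sum>l'=l..<l+s. hess P (inner_fun P i (ze l')) (x, y l) v) /\<^sub>R real s
        - hess P (inner_obj P i) (x, y l) v))\<^sup>2 \<le> real s powr (-al) * C\<^sup>2"
begin

abbreviation "G l \<equiv> inner_fun P i (ze l)"
abbreviation "Gm \<equiv> inner_obj P i"
abbreviation "ys \<equiv> y_star P i x"
abbreviation "us \<equiv> u_star P i x"
definition "noise = \<bar>C\<bar> * real k powr (-al / 2)"
text \<open>\<open>u\<close> records the state before a projection; \<open>up l\<close> is the
  vector that step \<open>l\<close> acts on.\<close>

definition "up l = (if 0 < l \<and> num_inner P i dvd l then proj_ball radius (u l) else u l)"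

sublocale Gm: strongly_convex_inner P Gm L mu Lxy Lyy
  by (rule inner_obj_regular[OF i])

lemma G: "strongly_convex_inner P (G l) L mu Lxy Lyy"
  by (rule inner_fun_regular[OF i ze])

lemma y_Suc: "y (Suc l) = y l - gam *\<^sub>R grad_y P (G l) (x, y l)"
  by (simp add: y_def Let_def split_beta)

lemma u_Suc:
  "u (Suc l) = up l - rho *\<^sub>R (hess_yy P (G l) (x, y l) (up l) - grad_y P (outer_fun P i) (x, y l))"
  by (simp add: y_def u_def up_def radius_def Let_def split_beta)

lemma y_mem: "y l \<in> Y_space P"
proof (induction l)
  case (Suc l)
  then show ?case
    using grad_y_mem[OF strongly_convex_inner.smooth[OF G], of "(x, y l)" l] x
    unfolding y_Suc by (simp add: subspace_diff subspace_scale)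
qed (use y0 in \<open>simp add: y_def\<close>)

lemma xy_mem: "(x, y l) \<in> Z_space P"
  using x y_mem by simp

lemma up_mem: "u l \<in> Y_space P \<Longrightarrow> up l \<in> Y_space P"
  using proj_ball_mem[OF subspace_spaces(2)] constants_pos(2) by (simp add: up_def)

lemma u_mem: "u l \<in> Y_space P"
proof (induction l)
  case (Suc l)
  then show ?case
    using strongly_convex_inner.hess_yy_mem[OF G xy_mem[of l] up_mem[OF Suc], of l]
      grad_y_mem[OF outer_fun_smooth[OF i] xy_mem[of l]] up_mem
    unfolding u_Suc by (simp add: subspace_diff subspace_scale)
qed (use u0 in \<open>simp add: u_def\<close>)

text \<open>All bounds follow from \<open>sg * L * L = mu / 512\<close>, \<open>mu \<le> L\<close>
  and \<open>k \<ge> 1\<close>.\<close>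

lemma step_sizes: "0 < rho" "rho * L \<le> 1" "rho * mu \<le> 1" "sg * mu \<le> 1 / 512" "sg * L \<le> 1 / 512"
  "sg * L * L = mu / 512" "rho \<le> sg"
proof -
  show r: "0 < rho" using rho constants_pos(1) k by (metis of_nat_0_less_iff zero_less_mult_pos2)
  show le: "rho \<le> sg" using r k rho by (metis mult.right_neutral mult_left_mono of_nat_1 of_nat_le_iff
        Suc_leI One_nat_def less_imp_le)
  show eq: "sg * L * L = mu / 512" using pos by (simp add: sg_def power2_eq_square)
  have "sg * L * L \<le> 1 / 512 * L" using eq mu_le_L by simp
  then show sL: "sg * L \<le> 1 / 512" using pos by simp
  have "sg * mu \<le> sg * L" using mu_le_L constants_pos(1) by (intro mult_left_mono) auto
  then show sm: "sg * mu \<le> 1 / 512" using sL by simp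
  have "rho * L \<le> sg * L" "rho * mu \<le> sg * mu" using le pos by (auto intro: mult_right_mono)
  then show "rho * L \<le> 1" "rho * mu \<le> 1" using sL sm by auto
qed

text \<open>Since every single Hessian is at least \<open>mu\<close>, the ball of radius \<open>Cf / mu\<close> is invariant under the
  steps for \<open>u\<close>. So the only projection with an effect is the first one, at \<open>l = num_inner P i\<close>.\<close>

lemma norm_u_Suc_le:
  assumes "norm (up l) \<le> radius"
  shows "norm (u (Suc l)) \<le> radius"
proof -
  have "norm (u (Suc l)) \<le> norm (up l - rho *\<^sub>R hess_yy P (G l) (x, y l) (up l))
      + rho * norm (grad_y P (outer_fun P i) (x, y l))"
    unfolding u_Suc using step_sizes(1)
      norm_triangle_ineq[of "up l - rho *\<^sub>R hess_yy P (G l) (x, y l) (up l)" "rho *\<^sub>R grad_y P (outer_fun P i) (x, y l)"]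
    by (simp add: algebra_simps)
  also have "\<dots> \<le> (1 - rho * mu) * norm (up l) + rho * Cf"
    using strongly_convex_inner.hess_yy_step[OF G xy_mem up_mem[OF u_mem], of rho] step_sizes
      outer_grad_y_bound[OF i xy_mem] by (intro add_mono mult_left_mono) auto
  also have "\<dots> \<le> (1 - rho * mu) * radius + rho * Cf"
    using assms step_sizes by (intro add_right_mono mult_left_mono) auto
  also have "\<dots> = radius" using pos by (simp add: radius_def field_simps)
  finally show ?thesis .
qed

lemma norm_up_le: "num_inner P i \<le> l \<Longrightarrow> norm (up l) \<le> radius"
proof (induction l rule: dec_induct)
  case base
  then show ?case
    using norm_proj_ball_le[of radius] constants_pos(2) ze[of 0] by (simp add: up_def)
next
  case (step l)
  then show ?case
    using norm_u_Suc_le norm_proj_ball_le[of radius] constants_pos(2) by (simp add: up_def)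
qed

lemma up_eq: "l \<noteq> num_inner P i \<Longrightarrow> up l = u l"
proof (cases "l < num_inner P i")
  case True
  then show ?thesis by (auto simp: up_def dest: dvd_imp_le)
next
  case False
  assume "l \<noteq> num_inner P i"
  then obtain l' where l': "l = Suc l'" "num_inner P i \<le> l'" using False by (cases l) auto
  then have "norm (u l) \<le> radius" using norm_u_Suc_le[OF norm_up_le] by simp
  then show ?thesis using constants_pos(2) by (simp add: up_def proj_ball_eq)
qed

lemma norm_up_diff_le: "norm (up l - us) \<le> norm (u l - us)"
  using proj_ball_nonexpansive_to[of us radius "u l"] u_star(3)[OF i x] by (simp add: up_def radius_def)

section \<open>Blockwise contraction of the error of \<open>y\<close>\<close>

lemma grad_y_average:
  assumes "l < N" "averaging_interval al N l s"
  shows "(norm ((\<Sum>l'=l..<l+s. grad_y P (G l') (x, y l)) /\<^sub>R real s - grad_y P Gm (x, y l)))\<^sup>2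
    \<le> real s powr (-al) * C\<^sup>2"
proof -
  have "(\<Sum>l'=l..<l+s. grad_y P (G l') (x, y l)) /\<^sub>R real s - grad_y P Gm (x, y l)
    = snd ((\<Sum>l'=l..<l+s. grad_xy P (G l') (x, y l)) /\<^sub>R real s - grad_xy P Gm (x, y l))"
    by (simp add: grad_y_def snd_sum)
  then show ?thesis
    by (simp only:) (rule order.trans[OF power_mono[OF norm_snd_le norm_ge_zero] avg_grad[OF assms]])
qed

lemma gam_k: "gam * real k = 2 * sg"
  using rho by (simp add: gam)

lemma norm_grad_Gm_le: "norm (grad_y P Gm (x, y l)) \<le> L * norm (y l - ys)"
  using Gm.grad_y_lipschitz_y[OF x y_star(1)[OF i x] y_mem] by (simp add: y_star(2)[OF i x])

lemma noise_nonneg: "0 \<le> noise"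
  by (simp add: noise_def)

lemma drift_bound_le:
  "8 / 5 * (gam * real k * (norm (grad_y P Gm (x, y l)) + 2 * noise + 0))
    \<le> drift_err * norm (y l - ys) + drift_noise * noise"
proof -
  have "8 / 5 * (gam * real k * (norm (grad_y P Gm (x, y l)) + 2 * noise + 0))
    \<le> 8 / 5 * (2 * sg * (L * norm (y l - ys) + 2 * noise))"
    unfolding gam_k using norm_grad_Gm_le[of l] constants_pos(1)
    by (intro mult_left_mono) auto
  also have "\<dots> = drift_err * norm (y l - ys) + drift_noise * noise"
    by (simp add: drift_err_def drift_noise_def algebra_simps)
  finally show ?thesis .
qed

lemma y_block_drift:
  shows "s \<le> k \<Longrightarrow> l + s < N \<or> s = k \<and> l + k \<le> N \<Longrightarrow>
      norm (y (l + s) - y l) \<le> drift_err * norm (y l - ys) + drift_noise * noise"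
    and "l + k \<le> N \<Longrightarrow> \<exists>e. y (l + k) = y l - (2 * sg) *\<^sub>R (grad_y P Gm (x, y l) + e) \<and>
      norm e \<le> noise + L * (drift_err * norm (y l - ys) + drift_noise * noise)"
proof -
  have La: "0 \<le> gam" "0 \<le> L" "8 * (gam * real k * L) \<le> 1"
    using step_sizes pos unfolding gam_k by (auto simp: gam)
  note bd = block_drift[where z = y and S = "Y_space P" and F = "\<lambda>l v. grad_y P (G l) (x, v)"
      and M = "\<lambda>v. grad_y P Gm (x, v)" and La = L and T = N and b = "\<lambda>_. 0" and B = 0 and eta = gam
      and k = k and al = al and C = C and N = noise, OF y_mem
      strongly_convex_inner.grad_y_lipschitz_y[OF G x] Gm.grad_y_lipschitz_y[OF x] grad_y_average _ _
      La(1,2) k La(3) noise_def, simplified norm_zero order_refl add_0_right TrueI]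
  show "norm (y (l + s) - y l) \<le> drift_err * norm (y l - ys) + drift_noise * noise"
    if "s \<le> k" "l + s < N \<or> s = k \<and> l + k \<le> N"
    using bd(1)[of s l] that y_Suc drift_bound_le[of l] by simp
  show "\<exists>e. y (l + k) = y l - (2 * sg) *\<^sub>R (grad_y P Gm (x, y l) + e) \<and>
      norm e \<le> noise + L * (drift_err * norm (y l - ys) + drift_noise * noise)" if "l + k \<le> N"
  proof -
    have "\<exists>e. y (l + k) = y l - (gam * real k) *\<^sub>R (grad_y P Gm (x, y l) + e) \<and>
      norm e \<le> noise + L * (8 / 5 * (gam * real k * (norm (grad_y P Gm (x, y l)) + 2 * noise + 0)))"
      using bd(2)[of l] that y_Suc by simp
    then show ?thesis
      using add_left_mono[OF mult_left_mono[OF drift_bound_le[of l] La(2)], of noise]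
      unfolding gam_k by (meson order.trans)
  qed
qed

text \<open>With \<open>p = sg * mu\<close>, the exact step of length \<open>2 * sg\<close>
  contracts the norm by at least \<open>1 - 19 / 10 * p\<close>. The drift gives back only
  \<open>p / 80\<close>, which leaves more contraction than claimed.\<close>

lemma y_block:
  assumes "l + k \<le> N"
  shows "norm (y (l + k) - ys) \<le> (1 - sg * mu) * norm (y l - ys) + y_noise * noise"
proof -
  define a where "a = y l - ys"
  define p where "p = sg * mu"
  have p: "0 \<le> p" "p \<le> 1 / 512" using step_sizes(4) constants_pos(1) pos by (auto simp: p_def)
  have sgL: "sg * L * L = mu / 512" by (rule step_sizes(6))
  obtain e where e: "y (l + k) = y l - (2 * sg) *\<^sub>R (grad_y P Gm (x, y l) + e)"
    "norm e \<le> noise + L * (drift_err * norm a + drift_noise * noise)"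
    using y_block_drift(2)[OF assms] by (auto simp: a_def)
  have "(norm (a - (2 * sg) *\<^sub>R grad_y P Gm (x, y l)))\<^sup>2
    \<le> (1 - 2 * (2 * sg) * mu + (2 * sg)\<^sup>2 * L\<^sup>2) * (norm a)\<^sup>2"
    using Gm.grad_y_monotone[OF x y_star(1)[OF i x] y_mem, of l] norm_grad_Gm_le[of l] constants_pos(1)
    by (intro forward_step_norm) (auto simp: a_def y_star(2)[OF i x])
  also have "1 - 2 * (2 * sg) * mu + (2 * sg)\<^sup>2 * L\<^sup>2 = 1 - 4 * p + 4 * (sg * (sg * L * L))"
    by (simp add: p_def power2_eq_square algebra_simps)
  \<comment> \<open>The squared gradient carries \<open>sg\<^sup>2 * L\<^sup>2\<close>, which the
    choice of \<open>sg\<close> reduces to \<open>p / 512\<close>.\<close>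
  also have "\<dots> = 1 - 4 * p + p / 128" unfolding sgL by (simp add: p_def)
  also have "\<dots> \<le> (1 - 19 / 10 * p)\<^sup>2"
    using p by (simp add: power2_eq_square algebra_simps)
  finally have "(norm (a - (2 * sg) *\<^sub>R grad_y P Gm (x, y l)))\<^sup>2 \<le> ((1 - 19 / 10 * p) * norm a)\<^sup>2"
    by (simp add: power_mult_distrib mult_right_mono)
  then have main: "norm (a - (2 * sg) *\<^sub>R grad_y P Gm (x, y l)) \<le> (1 - 19 / 10 * p) * norm a"
    by (rule power2_le_imp_le) (use p in \<open>intro mult_nonneg_nonneg, simp_all\<close>)
  have "y (l + k) - ys = (a - (2 * sg) *\<^sub>R grad_y P Gm (x, y l)) - (2 * sg) *\<^sub>R e"
    unfolding e(1) a_def by (simp add: algebra_simps)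
  also have "norm \<dots> \<le> (1 - 19 / 10 * p) * norm a + 2 * sg * norm e"
    using norm_triangle_ineq4[of "a - (2 * sg) *\<^sub>R grad_y P Gm (x, y l)" "(2 * sg) *\<^sub>R e"] main
      constants_pos(1) by simp
  also have "2 * sg * norm e \<le> 2 * sg * (noise + L * (drift_err * norm a + drift_noise * noise))"
    using e(2) constants_pos(1) by (intro mult_left_mono) auto
  also have "\<dots> = y_noise * noise + 32 / 5 * (sg * (sg * L * L)) * norm a"
    by (simp add: y_noise_def drift_err_def drift_noise_def algebra_simps)
  also have "\<dots> = y_noise * noise + p / 80 * norm a" unfolding sgL by (simp add: p_def)
  finally have "norm (y (l + k) - ys) \<le> (1 - 19 / 10 * p + p / 80) * norm a + y_noise * noise"
    by (simp add: algebra_simps)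
  also have "\<dots> \<le> (1 - p) * norm a + y_noise * noise"
    using p by (intro add_right_mono mult_right_mono) auto
  finally show ?thesis by (simp add: a_def p_def)
qed

section \<open>Blockwise contraction of the error of \<open>u\<close>\<close>

lemma hess_average:
  assumes "l < N" "averaging_interval al N l s" "w \<in> Y_space P"
  shows "norm (\<Sum>l'=l..<l+s. hess_yy P (G l') (x, y l) w - hess_yy P Gm (x, y l) w)
    \<le> real s * (norm w * \<bar>C\<bar> * real s powr (-al / 2))"
proof (rule norm_sum_of_mean)
  show s: "0 < s" using assms by (simp add: averaging_interval_def)
  let ?A = "\<lambda>v. (\<Sum>l'=l..<l+s. hess P (G l') (x, y l) v) /\<^sub>R real s - hess P Gm (x, y l) v"
  have bl: "bounded_linear ?A"
    by (intro bounded_linear_sub bounded_linear_sum bounded_linear_hess[OF _ xy_mem] Gm.twice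
        strongly_convex_inner.twice[OF G] bounded_linear_compose[OF bounded_linear_scaleR_right])
  have "(\<Sum>l'=l..<l+s. hess_yy P (G l') (x, y l) w) /\<^sub>R real s - hess_yy P Gm (x, y l) w = snd (?A (0, w))"
    by (simp add: hess_yy_def snd_sum)
  also have "norm \<dots> \<le> norm (?A (0, w))" by (rule norm_snd_le)
  also have "\<dots> \<le> onorm_on (Z_space P) ?A * norm (0::rvec, w)"
    using assms(3) by (intro norm_le_onorm_on[OF bl]) simp
  also have "\<dots> \<le> \<bar>C\<bar> * real s powr (-al / 2) * norm (0::rvec, w)"
    using le_powr_half_of_square_le[OF avg_hess[OF assms(1,2)]] by (rule mult_right_mono) simp
  finally show "norm ((\<Sum>l'=l..<l+s. hess_yy P (G l') (x, y l) w) /\<^sub>R real s - hess_yy P Gm (x, y l) w)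
    \<le> norm w * \<bar>C\<bar> * real s powr (-al / 2)" by (simp add: mult_ac)
qed

definition "drift l = drift_err * norm (y l - ys) + drift_noise * noise"
text \<open>The bound \<open>2 * N + b\<close> of \<open>short_interval_bound\<close> for the
  Hessian noise on \<open>us\<close>, whose norm is at most \<open>radius\<close>. The drift term is
  doubled because the example and the mean Hessian both move.\<close>

definition "hess_noise l = 2 * radius * noise + 2 * Lyy * radius * drift l"

lemma drift_nonneg: "0 \<le> drift l" and hess_noise_nonneg: "0 \<le> hess_noise l"
  using constants_pos noise_nonneg pos by (simp_all add: drift_def hess_noise_def)

lemma us: "us \<in> Y_space P" "norm us \<le> radius"
  using u_star[OF i x] by (auto simp: radius_def)

lemma hess_yy_us_lipschitz:
  assumes "strongly_convex_inner P H L mu Lxy Lyy" "v \<in> Y_space P" "w \<in> Y_space P" "norm (v - w) \<le> D"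
  shows "norm (hess_yy P H (x, v) us - hess_yy P H (x, w) us) \<le> Lyy * radius * D"
proof -
  have "norm (hess_yy P H (x, v) us - hess_yy P H (x, w) us) \<le> Lyy * norm (v - w) * norm us"
    using strongly_convex_inner.hess_yy_lipschitz[OF assms(1), of "(x, v)" "(x, w)" us] assms x us by simp
  also have "\<dots> \<le> Lyy * D * radius"
    using assms us pos constants_pos(2) order.trans[OF norm_ge_zero assms(4)] by (intro mult_mono) auto
  finally show ?thesis by (simp add: mult_ac)
qed

lemma hess_noise_sum:
  assumes s: "s \<le> k" "l + s < N \<or> s = k \<and> l + k \<le> N"
  shows "norm (\<Sum>l'=l..<l+s. hess_yy P (G l') (x, y l) us - hess_yy P Gm (x, y l) us)
    \<le> real k * hess_noise l"
proof -
  let ?d = "\<lambda>l' v. hess_yy P (G l') (x, v) us - hess_yy P Gm (x, v) us"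
  have D: "norm (y (l + s) - y l) \<le> drift l" using y_block_drift(1)[OF s] by (simp add: drift_def)
  have "norm (\<Sum>l'=l..<l+s. ?d l' (y l))
    \<le> real k * (2 * (norm us * \<bar>C\<bar> * real k powr (-al / 2)) + 2 * Lyy * radius * drift l)"
  proof (rule short_interval_bound[where d = ?d and z = y, OF hess_average[OF _ _ us(1)] k s])
    show "norm (?d l' (y (l + s)) - ?d l' (y l)) \<le> 2 * Lyy * radius * drift l" for l'
    proof -
      have "?d l' (y (l + s)) - ?d l' (y l)
        = (hess_yy P (G l') (x, y (l + s)) us - hess_yy P (G l') (x, y l) us)
          - (hess_yy P Gm (x, y (l + s)) us - hess_yy P Gm (x, y l) us)" by simp
      then show ?thesis
        using hess_yy_us_lipschitz[OF G y_mem y_mem D, of l']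
          hess_yy_us_lipschitz[OF inner_obj_regular[OF i] y_mem y_mem D]
          norm_triangle_ineq4[of "hess_yy P (G l') (x, y (l + s)) us - hess_yy P (G l') (x, y l) us"
            "hess_yy P Gm (x, y (l + s)) us - hess_yy P Gm (x, y l) us"] by (simp only:)
    qed
  qed (auto intro: mult_nonneg_nonneg)
  also have "\<dots> \<le> real k * hess_noise l"
    unfolding hess_noise_def noise_def mult.assoc using us(2)
    by (intro mult_left_mono add_right_mono mult_right_mono) auto
  finally show ?thesis .
qed

text \<open>Subtracting the accumulated noise \<open>rho * Q r\<close> (summation by parts) leaves a recursion with the exact
  contraction factor of \<open>I - rho * H\<close>. A projection costs at most \<open>2 * rho * Q\<close>, and it occurs at
  most once.\<close>

lemma u_block_aux:
  assumes s: "s \<le> k" "l + s < N \<or> s = k \<and> l + k \<le> N"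
  defines "Q \<equiv> \<lambda>r. \<Sum>l'=l..<l+r. hess_yy P (G l') (x, y l) us - hess_yy P Gm (x, y l) us"
    and "q \<equiv> rho * (real k * hess_noise l)"
    and "c \<equiv> rho * L * (rho * (real k * hess_noise l)) + rho * ((Lyy * radius + L) * (norm (y l - ys) + drift l))"
  shows "r \<le> s \<Longrightarrow> norm (u (l + r) - us + rho *\<^sub>R Q r)
    \<le> (1 - rho * mu) ^ r * norm (u l - us) + (if l \<le> num_inner P i \<and> num_inner P i < l + r then 2 * q else 0)
      + real r * c"
proof (induction r)
  case 0
  then show ?case by (simp add: Q_def)
next
  case (Suc r)
  let ?l = "l + r"
  let ?H = "hess_yy P (G ?l) (x, y ?l)"
  let ?b = "\<lambda>v. grad_y P (outer_fun P i) (x, v)"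
  define p where "p = up ?l - us"
  define e where "e = hess_yy P (G ?l) (x, y l) us - hess_yy P Gm (x, y l) us"
  have rho: "0 \<le> rho" "0 \<le> 1 - rho * mu" "1 - rho * mu \<le> 1"
    using step_sizes pos by auto
  have rk: "r \<le> k" "l + r < N \<or> r = k \<and> l + k \<le> N" using Suc.prems s by auto
  have Qr: "norm (rho *\<^sub>R Q r) \<le> q"
    using hess_noise_sum[OF rk] rho unfolding Q_def q_def by (simp add: mult_left_mono)
  have Qmem: "Q r \<in> Y_space P"
    unfolding Q_def
    using strongly_convex_inner.hess_yy_mem[OF G xy_mem us(1)] Gm.hess_yy_mem[OF xy_mem us(1)]
    by (intro subspace_sum subspace_diff) simp_all
  have pmem: "p \<in> Y_space P" unfolding p_def using up_mem[OF u_mem] us(1) by (simp add: subspace_diff)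
  have mem: "p + rho *\<^sub>R Q r \<in> Y_space P" using pmem Qmem by (simp add: subspace_add subspace_scale)
  have QS: "Q (Suc r) = Q r + e" by (simp add: Q_def e_def)
  note lin = strongly_convex_inner.hess_yy_linear[OF G xy_mem]
  define f where "f = ?H us - ?b (y ?l) - e"
  \<comment> \<open>The noise \<open>e\<close> joins the shift in the step in which it occurs and
    cancels there. Of the earlier noise only \<open>?H\<close> applied to the shift remains, smaller
    by a factor \<open>rho * L\<close>.\<close>
  have "u (l + Suc r) - us + rho *\<^sub>R Q (Suc r)
    = (p + rho *\<^sub>R Q r) - rho *\<^sub>R ?H (p + rho *\<^sub>R Q r) + rho *\<^sub>R ?H (rho *\<^sub>R Q r) - rho *\<^sub>R f"
    by (simp add: u_Suc QS f_def p_def lin algebra_simps)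
  also have "norm \<dots> \<le> norm ((p + rho *\<^sub>R Q r) - rho *\<^sub>R ?H (p + rho *\<^sub>R Q r))
      + rho * norm (?H (rho *\<^sub>R Q r)) + rho * norm f"
    using norm_triangle_ineq4[of "(p + rho *\<^sub>R Q r) - rho *\<^sub>R ?H (p + rho *\<^sub>R Q r) + rho *\<^sub>R ?H (rho *\<^sub>R Q r)" "rho *\<^sub>R f"]
      norm_triangle_ineq[of "(p + rho *\<^sub>R Q r) - rho *\<^sub>R ?H (p + rho *\<^sub>R Q r)" "rho *\<^sub>R ?H (rho *\<^sub>R Q r)"] rho
    by simp
  also have "norm ((p + rho *\<^sub>R Q r) - rho *\<^sub>R ?H (p + rho *\<^sub>R Q r)) \<le> (1 - rho * mu) * norm (p + rho *\<^sub>R Q r)"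
    using strongly_convex_inner.hess_yy_step[OF G xy_mem mem rho(1) step_sizes(2)] .
  also have "rho * norm (?H (rho *\<^sub>R Q r)) \<le> rho * (L * q)"
    using order.trans[OF strongly_convex_inner.hess_yy_bound[OF G xy_mem] mult_left_mono[OF Qr]] Qmem rho pos
    by (intro mult_left_mono) (auto simp: subspace_scale)
  also have "rho * norm f \<le> rho * ((Lyy * radius + L) * (norm (y l - ys) + drift l))"
  proof (intro mult_left_mono rho)
    have D: "norm (y ?l - y l) \<le> drift l" using y_block_drift(1)[OF rk] by (simp add: drift_def)
    \<comment> \<open>\<open>us\<close> solves the averaged system at \<open>ys\<close>; adding that
      equation leaves differences of Lipschitz maps only.\<close>
    have f: "f = (?H us - hess_yy P (G ?l) (x, y l) us) + (hess_yy P Gm (x, y l) us - hess_yy P Gm (x, ys) us)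
      - (?b (y ?l) - ?b ys)"
      using u_star(2)[OF i x] by (simp add: f_def e_def)
    have f1: "norm (?H us - hess_yy P (G ?l) (x, y l) us) \<le> Lyy * radius * drift l"
      by (rule hess_yy_us_lipschitz[OF G y_mem y_mem D])
    have f2: "norm (hess_yy P Gm (x, y l) us - hess_yy P Gm (x, ys) us) \<le> Lyy * radius * norm (y l - ys)"
      by (rule hess_yy_us_lipschitz[OF inner_obj_regular[OF i] y_mem y_star(1)[OF i x]]) simp
    have "norm (?b (y ?l) - ?b ys) \<le> L * norm (y ?l - ys)"
      using grad_y_lipschitz[OF outer_fun_smooth[OF i] xy_mem, of "(x, ys)" ?l] x y_star(1)[OF i x]
      by simp
    also have "\<dots> \<le> L * (norm (y l - ys) + drift l)"
      using norm_triangle_ineq[of "y ?l - y l" "y l - ys"] D pos by (intro mult_left_mono) simp_all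
    finally have f3: "norm (?b (y ?l) - ?b ys) \<le> L * (norm (y l - ys) + drift l)" .
    have "norm f \<le> Lyy * radius * drift l + Lyy * radius * norm (y l - ys) + L * (norm (y l - ys) + drift l)"
      unfolding f by (intro order.trans[OF norm_triangle_ineq4] order.trans[OF norm_triangle_ineq] add_mono f1 f2 f3)
    then show "norm f \<le> (Lyy * radius + L) * (norm (y l - ys) + drift l)"
      by (simp add: algebra_simps)
  qed
  also have "(1 - rho * mu) * norm (p + rho *\<^sub>R Q r) + rho * (L * q)
      + rho * ((Lyy * radius + L) * (norm (y l - ys) + drift l)) = (1 - rho * mu) * norm (p + rho *\<^sub>R Q r) + c"
    by (simp add: c_def q_def)
  also have "(1 - rho * mu) * norm (p + rho *\<^sub>R Q r)
    \<le> (1 - rho * mu) * (norm (u ?l - us + rho *\<^sub>R Q r) + (if ?l = num_inner P i then 2 * q else 0))"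
  proof (intro mult_left_mono rho)
    show "norm (p + rho *\<^sub>R Q r) \<le> norm (u ?l - us + rho *\<^sub>R Q r) + (if ?l = num_inner P i then 2 * q else 0)"
    proof (cases "?l = num_inner P i")
      case True
      \<comment> \<open>The projection is nonexpansive towards \<open>us\<close> for the unshifted
        vector, so the shift is taken off before it and restored after it, at a cost of
        \<open>q\<close> each time.\<close>
      have "norm (p + rho *\<^sub>R Q r) \<le> norm (u ?l - us) + q"
        using norm_triangle_ineq[of p "rho *\<^sub>R Q r"] norm_up_diff_le[of ?l] Qr by (simp add: p_def)
      also have "norm (u ?l - us) \<le> norm (u ?l - us + rho *\<^sub>R Q r) + q"
        using norm_triangle_ineq4[of "u ?l - us + rho *\<^sub>R Q r" "rho *\<^sub>R Q r"] Qr by simp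
      finally show ?thesis using True by simp
    qed (simp add: p_def up_eq)
  qed
  also have "\<dots> \<le> (1 - rho * mu) * ((1 - rho * mu) ^ r * norm (u l - us)
      + (if l \<le> num_inner P i \<and> num_inner P i < l + r then 2 * q else 0) + real r * c
      + (if ?l = num_inner P i then 2 * q else 0))"
    using Suc rho by (intro mult_left_mono add_right_mono) auto
  also have "\<dots> \<le> (1 - rho * mu) ^ Suc r * norm (u l - us)
      + (if l \<le> num_inner P i \<and> num_inner P i < l + Suc r then 2 * q else 0) + real r * c"
  proof -
    let ?X = "(if l \<le> num_inner P i \<and> num_inner P i < l + r then 2 * q else 0) + real r * c
      + (if ?l = num_inner P i then 2 * q else 0)"
    have q: "0 \<le> q" using rho hess_noise_nonneg by (simp add: q_def)
    have "0 \<le> c" unfolding c_def using rho hess_noise_nonneg[of l] drift_nonneg[of l] pos constants_pos(2)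
      by (intro add_nonneg_nonneg mult_nonneg_nonneg) auto
    then have "0 \<le> ?X" using q by (intro add_nonneg_nonneg) auto
    then have "(1 - rho * mu) * ?X \<le> ?X" using rho by (simp add: mult_left_le_one_le)
    moreover have "?X = (if l \<le> num_inner P i \<and> num_inner P i < l + Suc r then 2 * q else 0) + real r * c"
      by auto
    ultimately show ?thesis by (simp add: algebra_simps)
  qed
  finally show ?case by (simp add: algebra_simps)
qed

lemma u_block:
  assumes s: "s \<le> k" "l + s < N \<or> s = k \<and> l + k \<le> N"
  shows "norm (u (l + s) - us)
    \<le> (1 - rho * mu) ^ s * norm (u l - us) + u_noise * noise + u_coupling * norm (y l - ys)"
proof -
  let ?Q = "\<Sum>l'=l..<l+s. hess_yy P (G l') (x, y l) us - hess_yy P Gm (x, y l) us"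
  let ?c = "rho * L * (rho * (real k * hess_noise l)) + rho * ((Lyy * radius + L) * (norm (y l - ys) + drift l))"
  have r: "0 \<le> rho" using step_sizes by simp
  have c: "0 \<le> ?c" using r hess_noise_nonneg[of l] drift_nonneg[of l] pos constants_pos(2)
    by (intro add_nonneg_nonneg mult_nonneg_nonneg) auto
  have q: "rho * (real k * hess_noise l) = sg * hess_noise l" using rho by (simp add: mult.assoc[symmetric])
  have "norm (u (l + s) - us) \<le> norm (u (l + s) - us + rho *\<^sub>R ?Q) + rho * norm ?Q"
    using norm_triangle_ineq4[of "u (l + s) - us + rho *\<^sub>R ?Q" "rho *\<^sub>R ?Q"] r by simp
  also have "\<dots> \<le> ((1 - rho * mu) ^ s * norm (u l - us) + 2 * (rho * (real k * hess_noise l)) + real k * ?c)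
      + rho * (real k * hess_noise l)"
  proof (rule add_mono)
    have "real s * ?c \<le> real k * ?c" using s c by (intro mult_right_mono) auto
    moreover have "0 \<le> rho * (real k * hess_noise l)" using r hess_noise_nonneg by simp
    ultimately show "norm (u (l + s) - us + rho *\<^sub>R ?Q)
      \<le> (1 - rho * mu) ^ s * norm (u l - us) + 2 * (rho * (real k * hess_noise l)) + real k * ?c"
      using u_block_aux[OF s order_refl] by (auto split: if_splits)
    show "rho * norm ?Q \<le> rho * (real k * hess_noise l)"
      using hess_noise_sum[OF s] r by (rule mult_left_mono)
  qed
  also have "\<dots> = (1 - rho * mu) ^ s * norm (u l - us) + (3 * sg + sg * sg * L) * hess_noise l
      + sg * ((Lyy * radius + L) * (norm (y l - ys) + drift l))"
    unfolding q rho[symmetric] by (simp add: algebra_simps)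
  also have "\<dots> = (1 - rho * mu) ^ s * norm (u l - us) + u_noise * noise + u_coupling * norm (y l - ys)"
    by (simp add: hess_noise_def drift_def u_noise_def u_coupling_def power2_eq_square algebra_simps)
  finally show ?thesis .
qed

lemma inner_error:
  assumes El: "El * k \<le> N" "0 < El"
  shows "norm (u N - us) + weight * norm (y N - ys)
    \<le> inner_gain * rate ^ El * (norm (u0 - us) + weight * norm (y0 - ys)) + inner_noise * noise"
proof -
  have p: "0 < sg * mu" "sg * mu \<le> 1" using constants_pos pos step_sizes by auto
  have zero: "y 0 = y0" "u 0 = u0" by (simp_all add: y_def u_def)
  have rm: "0 \<le> rho * mu" using step_sizes pos by simp
  have kr: "real k * (rho * mu) = sg * mu" using rho by (simp add: mult_ac)
  note tl = two_level_recursion[where v = "\<lambda>l. norm (u l - us)" and A = "\<lambda>l. norm (y l - ys)" and N = noise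
      and ?c1.0 = u_noise and ?c2.0 = u_coupling and ?c3.0 = y_noise and dA = drift_err and dN = drift_noise
      and p = "sg * mu" and M = N and lam = weight and k = k and El = El]
  have "norm (u N - us) + weight * norm (y N - ys)
    \<le> (2 + drift_err) * (1 - 3 / 4 * (sg * mu)) ^ El * (norm (u 0 - us) + weight * norm (y 0 - ys))
    + (u_noise + weight * drift_noise + 4 * (u_noise + weight * y_noise) / (3 * (sg * mu))) * noise"
  proof (rule tl)
    fix r assume r: "r < k" "r < N"
    have "norm (u r - us) \<le> (1 - rho * mu) ^ r * norm (u 0 - us) + u_noise * noise + u_coupling * norm (y 0 - ys)"
      using u_block[of r 0] r by simp
    also have "(1 - rho * mu) ^ r * norm (u 0 - us) \<le> 1 * norm (u 0 - us)"
      using rm step_sizes by (intro mult_right_mono power_le_one) auto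
    finally have 1: "norm (u r - us) \<le> norm (u 0 - us) + u_noise * noise + u_coupling * norm (y 0 - ys)" by simp
    have "norm (y r - ys) \<le> norm (y r - y 0) + norm (y 0 - ys)"
      using norm_triangle_ineq[of "y r - y 0" "y 0 - ys"] by simp
    also have "norm (y r - y 0) \<le> drift_err * norm (y 0 - ys) + drift_noise * noise"
      using y_block_drift(1)[of r 0] r by simp
    finally show "norm (u r - us) \<le> norm (u 0 - us) + u_noise * noise + u_coupling * norm (y 0 - ys) \<and>
      norm (y r - ys) \<le> (1 + drift_err) * norm (y 0 - ys) + drift_noise * noise"
      using 1 by (simp add: algebra_simps)
  next
    fix l assume l: "l + k \<le> N"
    have "norm (u (l + k) - us) \<le> (1 - rho * mu) ^ k * norm (u l - us) + u_noise * noise + u_coupling * norm (y l - ys)"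
      using u_block[of k l] l by simp
    also have "(1 - rho * mu) ^ k * norm (u l - us) \<le> (1 - 3 / 4 * (sg * mu)) * norm (u l - us)"
      using power_one_minus_le[of "rho * mu" k] rm step_sizes unfolding kr by (intro mult_right_mono) auto
    finally show "norm (u (l + k) - us) \<le> (1 - 3 / 4 * (sg * mu)) * norm (u l - us) + u_noise * noise
        + u_coupling * norm (y l - ys) \<and>
      norm (y (l + k) - ys) \<le> (1 - sg * mu) * norm (y l - ys) + y_noise * noise"
      using y_block[OF l] by simp
  qed (use constants_pos p k El noise_nonneg in \<open>auto simp: weight_def\<close>)
  then show ?thesis by (simp add: zero rate_def inner_gain_def inner_noise_def)
qed

end

section \<open>The outer loop\<close>

context cbo_constants
begin

text \<open>At least \<open>L\<close>, as the error of \<open>u\<close> requires, and at least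
  \<open>(L + Lxy * radius) / weight\<close>, as the weighted error of \<open>y\<close>
  requires.\<close>

definition "bias_factor = L + (L + Lxy * radius) / weight"

lemma bias_factor_pos: "0 < bias_factor"
  unfolding bias_factor_def using pos constants_pos by (intro add_pos_pos divide_pos_pos mult_pos_pos)

text \<open>The factor \<open>3 / 4\<close> in \<open>rate\<close> leaves room for squaring. As
  \<open>rho * k = sg\<close> and \<open>gam = 2 * rho\<close>, the bound \<open>1 - sg * mu\<close>
  is the rate of the theorem for \<open>y\<close> and lies below the one for
  \<open>u\<close>.\<close>

lemma rate_bounds:
  assumes "sg * mu \<le> 1 / 512"
  shows "0 \<le> rate" "rate\<^sup>2 \<le> 1 - sg * mu"
proof -
  define p where "p = sg * mu"
  have p: "0 \<le> p" "p \<le> 1 / 512" using assms constants_pos(1) pos by (simp_all add: p_def)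
  show "0 \<le> rate" using p by (simp add: rate_def p_def)
  have "p * p \<le> p * (1 / 512)" using p by (intro mult_left_mono) auto
  then have "(1 - 3 / 4 * p)\<^sup>2 \<le> 1 - p" using p by (simp add: power2_eq_square algebra_simps)
  then show "rate\<^sup>2 \<le> 1 - sg * mu" by (simp add: rate_def p_def)
qed

end

context inner_loop
begin

definition "estimate l = grad_x P (outer_fun P i) (x, y l) - hess_xy P Gm (x, y l) (u l)"

lemma estimate_mem: "estimate l \<in> X_space P"
  unfolding estimate_def
  using grad_x_mem[OF outer_fun_smooth[OF i] xy_mem] Gm.hess_xy_mem[OF xy_mem u_mem]
  by (simp add: subspace_diff)

text \<open>The hypergradient formula is compared at \<open>(y l, u l)\<close> and
  \<open>(ys, us)\<close>. The change of the Hessian is applied to the bounded vector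
  \<open>us\<close> and the current Hessian to \<open>u l - us\<close>, so the size of
  \<open>u l\<close> never enters.\<close>

lemma bias_le:
  "norm (estimate l - grad_h_ex P i x) \<le> bias_factor * (norm (u l - us) + weight * norm (y l - ys))"
proof -
  let ?a = "norm (y l - ys)"
  have z: "(x, ys) \<in> Z_space P" using x y_star(1)[OF i x] by simp
  have uv: "u l - us \<in> Y_space P" using u_mem us(1) by (simp add: subspace_diff)
  have eq: "estimate l - grad_h_ex P i x
    = (grad_x P (outer_fun P i) (x, y l) - grad_x P (outer_fun P i) (x, ys))
      - hess_xy P Gm (x, y l) (u l - us) - (hess_xy P Gm (x, y l) us - hess_xy P Gm (x, ys) us)"
    unfolding estimate_def grad_h_ex_eq[OF i x] Gm.hess_xy_diff[OF xy_mem] by simp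
  have 1: "norm (grad_x P (outer_fun P i) (x, y l) - grad_x P (outer_fun P i) (x, ys)) \<le> L * ?a"
    using grad_x_lipschitz[OF outer_fun_smooth[OF i] xy_mem z, of l] by simp
  have 2: "norm (hess_xy P Gm (x, y l) (u l - us)) \<le> L * norm (u l - us)"
    by (rule Gm.hess_xy_bound[OF xy_mem uv])
  have "norm (hess_xy P Gm (x, y l) us - hess_xy P Gm (x, ys) us) \<le> Lxy * ?a * norm us"
    using Gm.hess_xy_lipschitz[OF xy_mem z us(1), of l] by simp
  also have "\<dots> \<le> Lxy * ?a * radius" using us(2) pos by (intro mult_left_mono) auto
  finally have 3: "norm (hess_xy P Gm (x, y l) us - hess_xy P Gm (x, ys) us) \<le> Lxy * ?a * radius" .
  have "norm (estimate l - grad_h_ex P i x) \<le> L * ?a + L * norm (u l - us) + Lxy * ?a * radius"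
    unfolding eq by (intro order.trans[OF norm_triangle_ineq4] add_mono 1 2 3)
  also have "\<dots> = L * norm (u l - us) + (bias_factor - L) * (weight * ?a)"
    using constants_pos by (simp add: bias_factor_def field_simps)
  also have "\<dots> \<le> bias_factor * norm (u l - us) + bias_factor * (weight * ?a)"
    using bias_factor_pos pos constants_pos
    by (intro add_mono mult_right_mono) (auto simp: bias_factor_def)
  finally show ?thesis by (simp add: algebra_simps)
qed

end

section \<open>Descent of the outer objective\<close>

lemma square_sum2_le: "(a + b)\<^sup>2 \<le> 2 * a\<^sup>2 + 2 * b\<^sup>2" for a b :: real
  using sum_squares_bound[of a b] by (simp add: power2_sum)

lemma square_sum3_le: "(a + b + c)\<^sup>2 \<le> 3 * (a\<^sup>2 + b\<^sup>2 + c\<^sup>2)" for a b c :: real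
  using sum_squares_bound[of a b] sum_squares_bound[of a c] sum_squares_bound[of b c]
  by (simp add: power2_eq_square algebra_simps)

text \<open>Polarizing \<open>inner (g + e) g\<close> produces half of
  \<open>(norm (g + e))\<^sup>2\<close>, which dominates the smoothness term with factor
  \<open>c * La = 1 / 8\<close>. In the bound for \<open>e\<close>, \<open>1 / 5\<close> is the
  factor \<open>8 / 5\<close> of \<open>block_drift\<close> times \<open>1 / 8\<close>. Half of the
  resulting \<open>2 / 25\<close> is lost from \<open>1 / 2\<close>, which leaves
  \<open>23 / 50\<close>.\<close>

lemma block_descent:
  fixes h :: "'a::real_inner \<Rightarrow> real"
  assumes S: "subspace S" "z \<in> S" "z' \<in> S" and sm: "smooth_on S La h"
    and c: "0 < c" "c * La = 1 / 8"
    and step: "z' = z - c *\<^sub>R (grad_on S h z + e)"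
    and e: "norm e \<le> N + B + 1 / 5 * (norm (grad_on S h z) + 2 * N + B)"
  shows "23 / 50 * (norm (grad_on S h z))\<^sup>2 \<le> (h z - h z') / c + 4 * N\<^sup>2 + 3 * B\<^sup>2"
proof -
  define g where "g = grad_on S h z"
  have "h z' \<le> h z + inner (z' - z) g + La * (norm (z' - z))\<^sup>2"
    unfolding g_def by (rule smooth_on_upper_bound[OF S sm])
  also have "z' - z = - (c *\<^sub>R (g + e))" by (simp add: step g_def)
  also have "h z + inner (- (c *\<^sub>R (g + e))) g + La * (norm (- (c *\<^sub>R (g + e))))\<^sup>2
    = h z - c * (inner (g + e) g - c * La * (norm (g + e))\<^sup>2)"
    unfolding norm_minus_cancel norm_scaleR by (simp add: power_mult_distrib power2_eq_square algebra_simps)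
  also have "inner (g + e) g = ((norm (g + e))\<^sup>2 + (norm g)\<^sup>2 - (norm e)\<^sup>2) / 2"
    using dot_norm_neg[of "g + e" g] by simp
  finally have "c * (((norm (g + e))\<^sup>2 + (norm g)\<^sup>2 - (norm e)\<^sup>2) / 2 - 1 / 8 * (norm (g + e))\<^sup>2) \<le> h z - h z'"
    by (simp add: c(2))
  then have "((norm (g + e))\<^sup>2 + (norm g)\<^sup>2 - (norm e)\<^sup>2) / 2 - 1 / 8 * (norm (g + e))\<^sup>2 \<le> (h z - h z') / c"
    using c(1) by (simp add: pos_le_divide_eq mult.commute)
  moreover have "X / 2 - Y / 2 \<le> (W + X - Y) / 2 - 1 / 8 * W" if "0 \<le> W" for W X Y :: real
    using that by (simp add: field_simps)
  ultimately have 1: "(norm g)\<^sup>2 / 2 - (norm e)\<^sup>2 / 2 \<le> (h z - h z') / c"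
    using order.trans zero_le_power2 by blast
  have "(norm e)\<^sup>2 \<le> (1 / 5 * norm g + (7 / 5 * N + 6 / 5 * B))\<^sup>2"
    using e by (intro power_mono) (simp_all add: g_def field_simps)
  also have "\<dots> \<le> 2 * (1 / 5 * norm g)\<^sup>2 + 2 * (7 / 5 * N + 6 / 5 * B)\<^sup>2"
    by (rule square_sum2_le)
  also have "(7 / 5 * N + 6 / 5 * B)\<^sup>2 \<le> 2 * (7 / 5 * N)\<^sup>2 + 2 * (6 / 5 * B)\<^sup>2"
    by (rule square_sum2_le)
  finally have "(norm e)\<^sup>2 \<le> 2 / 25 * (norm g)\<^sup>2 + 196 / 25 * N\<^sup>2 + 144 / 25 * B\<^sup>2"
    by (simp add: power_mult_distrib power_divide)
  moreover have "0 \<le> N\<^sup>2" "0 \<le> B\<^sup>2" by simp_all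
  ultimately show ?thesis
    using 1 unfolding g_def by linarith
qed

lemma averaged_descent:
  fixes h :: "'a::real_inner \<Rightarrow> real"
  assumes S: "subspace S" and zS: "\<And>t. z t \<in> S" and sm: "smooth_on S La h"
    and lipF: "\<And>\<tau> v w. v \<in> S \<Longrightarrow> w \<in> S \<Longrightarrow> norm (F \<tau> v - F \<tau> w) \<le> La * norm (v - w)"
    and avg: "\<And>t s. t < T \<Longrightarrow> averaging_interval al T t s \<Longrightarrow>
      (norm ((\<Sum>\<tau>=t..<t+s. F \<tau> (z t)) /\<^sub>R real s - grad_on S h (z t)))\<^sup>2 \<le> real s powr (-al) * C\<^sup>2"
    and step: "\<And>\<tau>. \<tau> < T \<Longrightarrow> z (Suc \<tau>) = z \<tau> - eta *\<^sub>R (F \<tau> (z \<tau>) + b \<tau>)"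
    and b: "\<And>\<tau>. \<tau> < T \<Longrightarrow> norm (b \<tau>) \<le> B"
    and par: "0 < La" "0 < k" "0 < E" "T = E * k" "eta = 1 / (8 * real k * La)"
    and low: "\<And>t. low \<le> h (z t)"
  shows "(\<Sum>e<E. (norm (grad_on S h (z (k * e))))\<^sup>2) / real E
    \<le> 8 * (h (z 0) - low) / (real k * real E * eta) + 9 * (C\<^sup>2 * real k powr (-al)) + 7 * B\<^sup>2"
proof -
  let ?g = "\<lambda>e. (norm (grad_on S h (z (k * e))))\<^sup>2"
  define N where "N = \<bar>C\<bar> * real k powr (-al / 2)"
  have N2: "N\<^sup>2 = C\<^sup>2 * real k powr (-al)"
    by (simp add: N_def power_mult_distrib power2_eq_square[of "real k powr _"] powr_add[symmetric])
  have eta: "0 < eta" using par by simp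
  define c where "c = eta * real k"
  have c: "0 < c" "c * La = 1 / 8" using par eta by (simp_all add: c_def)
  have lipM: "norm (grad_on S h v - grad_on S h w) \<le> La * norm (v - w)" if "v \<in> S" "w \<in> S" for v w
    using sm lipschitz_onD that by (fastforce simp: smooth_on_def dist_norm)
  have block: "23 / 50 * ?g e \<le> (h (z (k * e)) - h (z (k * Suc e))) / c + 4 * N\<^sup>2 + 3 * B\<^sup>2" if e: "e < E" for e
  proof -
    have "k * e + k \<le> T" using mult_le_mono2[of "Suc e" E k] e par(4) by (simp add: mult.commute)
    moreover have "8 * (eta * real k * La) \<le> 1" using c by (simp add: c_def)
    ultimately obtain w where w: "z (k * e + k) = z (k * e) - c *\<^sub>R (grad_on S h (z (k * e)) + w)"
      "norm w \<le> N + B + La * (8 / 5 * (c * (norm (grad_on S h (z (k * e))) + 2 * N + B)))"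
      using block_drift(2)[where z = z and S = S and F = F and M = "grad_on S h" and La = La and T = T
          and b = b and B = B and eta = eta and k = k and al = al and C = C and N = N,
          OF zS lipF lipM avg step b, of "k * e"] eta par(1,2)
      unfolding N_def c_def by auto
    have "La * (8 / 5 * (c * (norm (grad_on S h (z (k * e))) + 2 * N + B)))
      = 8 / 5 * (c * La) * (norm (grad_on S h (z (k * e))) + 2 * N + B)" by simp
    then have "norm w \<le> N + B + 1 / 5 * (norm (grad_on S h (z (k * e))) + 2 * N + B)"
      using w(2) by (simp only: c(2))
    from block_descent[OF S zS zS sm c w(1) this] show ?thesis by (simp add: add.commute)
  qed
  have "(\<Sum>e<E. 23 / 50 * ?g e) \<le> (\<Sum>e<E. (h (z (k * e)) - h (z (k * Suc e))) / c + 4 * N\<^sup>2 + 3 * B\<^sup>2)"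
    by (rule sum_mono) (use block in simp)
  also have "\<dots> = (\<Sum>e<E. h (z (k * e)) - h (z (k * Suc e))) / c + real E * (4 * N\<^sup>2 + 3 * B\<^sup>2)"
    by (simp add: sum.distrib sum_divide_distrib algebra_simps)
  also have "(\<Sum>e<E. h (z (k * e)) - h (z (k * Suc e))) = h (z 0) - h (z T)"
    using sum_lessThan_telescope'[of "\<lambda>e. h (z (k * e))" E] par(4) by (simp add: mult.commute)
  finally have "23 / 50 * (\<Sum>e<E. ?g e) \<le> (h (z 0) - h (z T)) / c + real E * (4 * N\<^sup>2 + 3 * B\<^sup>2)"
    by (simp add: sum_distrib_left)
  also have "\<dots> \<le> (h (z 0) - low) / c + real E * (4 * N\<^sup>2 + 3 * B\<^sup>2)"
    using low c by (intro add_right_mono divide_right_mono) auto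
  finally have main: "23 / 50 * (\<Sum>e<E. ?g e) \<le> (h (z 0) - low) / c + real E * (4 * N\<^sup>2 + 3 * B\<^sup>2)" .
  have "0 \<le> (h (z 0) - low) / c" using low[of 0] c by simp
  moreover have "0 \<le> real E * N\<^sup>2" "0 \<le> real E * B\<^sup>2" by simp_all
  \<comment> \<open>Multiplication by \<open>50 / 23\<close> gives the coefficients
    \<open>50 / 23\<close>, \<open>200 / 23\<close> and \<open>150 / 23\<close>, rounded up to
    \<open>8\<close>, \<open>9\<close> and \<open>7\<close>.\<close>
  ultimately have "(\<Sum>e<E. ?g e) \<le> 8 * ((h (z 0) - low) / c) + real E * (9 * N\<^sup>2 + 7 * B\<^sup>2)"
    using main unfolding distrib_left by linarith
  then have "(\<Sum>e<E. ?g e) / real E \<le> (8 * ((h (z 0) - low) / c) + real E * (9 * N\<^sup>2 + 7 * B\<^sup>2)) / real E"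
    by (rule divide_right_mono) simp
  also have "\<dots> = 8 * (h (z 0) - low) / (real k * real E * eta) + 9 * N\<^sup>2 + 7 * B\<^sup>2"
    using par eta by (simp add: c_def add_divide_distrib mult_ac)
  finally show ?thesis by (simp add: N2)
qed

theorem theorem4p8:
  fixes L mu Cf Lxy Lyy kappa :: real
  assumes "0 < L" "0 < mu" "0 < Cf" "0 < Lxy" "0 < Lyy"
    and "kappa = L / mu"
  shows "\<exists>Cu Cy C'. 0 < Cu \<and> 0 < Cy \<and> 0 < C' \<and>
    (\<forall>(P::cbo) A Lbar xi ze x0 y0 u0 R S T Tl E El k eta gam rho x y al C Dh Dy Du.
      cbo_problem P \<longrightarrow>
      outer_regular P L Cf \<longrightarrow>
      inner_regular P L mu Lxy Lyy \<longrightarrow>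
      bounded_deviation P A \<longrightarrow>
      h_smoothness_constant P Lbar \<longrightarrow>
      example_order P xi ze \<longrightarrow>
      x0 \<in> X_space P \<longrightarrow> y0 \<in> Y_space P \<longrightarrow> u0 \<in> Y_space P \<longrightarrow>
      T = R * num_outer P \<longrightarrow>
      common_inner_steps P S Tl \<longrightarrow>
      0 < E \<longrightarrow> 0 < El \<longrightarrow> 0 < k \<longrightarrow>
      T = E * k \<longrightarrow>
      Tl = El * k \<longrightarrow>
      eta = 1 / (8 * real k * Lbar) \<longrightarrow>
      gam = 1 / (256 * real k * L * kappa) \<longrightarrow>
      rho = 1 / (512 * real k * L * kappa) \<longrightarrow>
      x = outer_iter P (Cf / mu) S (\<lambda>_. eta) (\<lambda>_. gam) (\<lambda>_. rho) y0 u0 xi ze x0 \<longrightarrow>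
      y = (\<lambda>t l. fst (inner_iter P (Cf / mu) (\<lambda>_. gam) (\<lambda>_. rho) y0 u0 (xi t) (ze t) (x t) l)) \<longrightarrow>
      averaged_bounds P al C xi ze x y T (\<lambda>t. S * num_inner P (xi t)) \<longrightarrow>
      Dh = h_obj P x0 - (INF v\<in>X_space P. h_obj P v) \<longrightarrow>
      (\<forall>t<T. (norm (y0 - y_star P (xi t) (x t)))\<^sup>2 \<le> Dy) \<longrightarrow>
      (\<forall>t<T. (norm (u0 - u_star P (xi t) (x t)))\<^sup>2 \<le> Du) \<longrightarrow>
      (\<Sum>e<E. (norm (grad_h P (x (k * e))))\<^sup>2) / real E
        \<le> 8 * Dh / (real k * real E * eta)
          + Cu * (1 - real k * mu * rho / 2) ^ El * Du
          + Cy * (1 - real k * mu * gam / 2) ^ El * Dy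
          + C'\<^sup>2 * C\<^sup>2 * real k powr (-al))"
proof -
  interpret cbo_constants L mu Cf Lxy Lyy using assms by unfold_locales
  \<comment> \<open>\<open>7\<close> is the coefficient of \<open>B\<^sup>2\<close> in
    \<open>averaged_descent\<close>, and \<open>3\<close> comes from squaring a sum of three terms.
    In \<open>C'\<close> the \<open>9\<close> is the outer noise and the rest the inner
    noise.\<close>
  define K where "K = 21 * bias_factor\<^sup>2"
  have K: "0 < K" using bias_factor_pos by (simp add: K_def)
  define C' where "C' = sqrt (9 + K * inner_noise\<^sup>2)"
  have "0 < 9 + K * inner_noise\<^sup>2" using K by (intro add_pos_nonneg) auto
  then have C': "0 < C'" "C'\<^sup>2 = 9 + K * inner_noise\<^sup>2" by (simp_all add: C'_def)
  show ?thesis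
  proof (rule exI[of _ "K * inner_gain\<^sup>2"], rule exI[of _ "K * (inner_gain * weight)\<^sup>2"], rule exI[of _ C'],
      intro conjI allI impI)
    show "0 < K * inner_gain\<^sup>2" "0 < K * (inner_gain * weight)\<^sup>2" "0 < C'"
      using K C' constants_pos by simp_all
  next
    fix P :: cbo and A Lbar :: real and xi :: "nat \<Rightarrow> nat" and ze :: "nat \<Rightarrow> nat \<Rightarrow> nat"
      and x0 y0 u0 :: rvec and R S T Tl E El k :: nat and eta gam rho :: real
      and x :: "nat \<Rightarrow> rvec" and y :: "nat \<Rightarrow> nat \<Rightarrow> rvec" and al C Dh Dy Du :: real
    assume prob: "cbo_problem P" and outer_r: "outer_regular P L Cf" and inner_r: "inner_regular P L mu Lxy Lyy"
      and Lbar: "h_smoothness_constant P Lbar" and order: "example_order P xi ze"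
      and x0: "x0 \<in> X_space P" and y0: "y0 \<in> Y_space P" and u0: "u0 \<in> Y_space P"
      and Tl: "common_inner_steps P S Tl" "Tl = El * k"
      and E: "0 < E" and El: "0 < El" and k: "0 < k" and T: "T = E * k"
      and eta: "eta = 1 / (8 * real k * Lbar)"
      and gam: "gam = 1 / (256 * real k * L * kappa)" and rho: "rho = 1 / (512 * real k * L * kappa)"
      and x: "x = outer_iter P (Cf / mu) S (\<lambda>_. eta) (\<lambda>_. gam) (\<lambda>_. rho) y0 u0 xi ze x0"
      and y: "y = (\<lambda>t l. fst (inner_iter P (Cf / mu) (\<lambda>_. gam) (\<lambda>_. rho) y0 u0 (xi t) (ze t) (x t) l))"
      and avg: "averaged_bounds P al C xi ze x y T (\<lambda>t. S * num_inner P (xi t))"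
      and Dh: "Dh = h_obj P x0 - (INF v\<in>X_space P. h_obj P v)"
      and Dy: "\<forall>t<T. (norm (y0 - y_star P (xi t) (x t)))\<^sup>2 \<le> Dy"
      and Du: "\<forall>t<T. (norm (u0 - u_star P (xi t) (x t)))\<^sup>2 \<le> Du"
    interpret regular_cbo P L mu Cf Lxy Lyy
      using prob outer_r inner_r by unfold_locales
    define u where "u t l = snd (inner_iter P (Cf / mu) (\<lambda>_. gam) (\<lambda>_. rho) y0 u0 (xi t) (ze t) (x t) l)" for t l
    define N where "N t = S * num_inner P (xi t)" for t
    have rk: "rho * real k = sg" using k pos by (simp add: rho assms(6) sg_def power2_eq_square)
    have gr: "gam = 2 * rho" by (simp add: gam rho)
    have xi: "xi t < num_outer P" and ze: "ze t l < num_inner P (xi t)" for t l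
      using order by (auto simp: example_order_def)
    \<comment> \<open>The case \<open>M = 0\<close> gives \<open>x t \<in> X_space P\<close> for all
      \<open>t\<close> by induction; the averaging bounds are available only for
      \<open>t < T\<close>.\<close>
    have loop: "inner_loop P L mu Cf Lxy Lyy (xi t) (x t) y0 u0 (ze t) k M al C gam rho (y t) (u t)"
      if "x t \<in> X_space P" "M = 0 \<or> t < T \<and> M = N t" for t M
    proof unfold_locales
      fix l s assume "l < M" "averaging_interval al M l s"
      then have t: "t < T" "l < N t" "averaging_interval al (N t) l s" using that by auto
      from avg t show "(norm ((\<Sum>l'=l..<l+s. grad_xy P (inner_fun P (xi t) (ze t l')) (x t, y t l)) /\<^sub>R real s
          - grad_xy P (inner_obj P (xi t)) (x t, y t l)))\<^sup>2 \<le> real s powr (-al) * C\<^sup>2"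
        unfolding averaged_bounds_def N_def Let_def by blast
      from avg t show "(onorm_on (Z_space P) (\<lambda>v. (\<Sum>l'=l..<l+s. hess P (inner_fun P (xi t) (ze t l')) (x t, y t l) v) /\<^sub>R real s
          - hess P (inner_obj P (xi t)) (x t, y t l) v))\<^sup>2 \<le> real s powr (-al) * C\<^sup>2"
        unfolding averaged_bounds_def N_def Let_def by blast
    qed (use that xi ze y0 u0 k rk gr in \<open>simp_all add: y u_def\<close>)
    define est where "est t = grad_x P (outer_fun P (xi t)) (x t, y t (N t))
      - hess_xy P (inner_obj P (xi t)) (x t, y t (N t)) (u t (N t))" for t
    have x_Suc: "x (Suc t) = x t - eta *\<^sub>R est t" for t
      by (simp add: x est_def y u_def N_def Let_def split_beta)
    have x_mem: "x t \<in> X_space P" for t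
    proof (induction t)
      case (Suc t)
      then show ?case
        using inner_loop.estimate_mem[OF loop[OF Suc, of 0], of "N t"] inner_loop.estimate_def[OF loop[OF Suc, of 0], of "N t"]
        unfolding x_Suc by (simp add: est_def subspace_diff subspace_scale)
    qed (simp add: x x0)
    have L0: "0 < Lbar" and smh: "smooth_on (X_space P) Lbar (h_obj P)"
      and sme: "\<And>i. i < num_outer P \<Longrightarrow> smooth_on (X_space P) Lbar (h_ex P i)"
      using Lbar by (auto simp: h_smoothness_constant_def)
    have T0: "0 < T" using E k T by simp
    have D0: "0 \<le> Dy" "0 \<le> Du" using Dy Du T0 order.trans[OF zero_le_power2] by blast+
    have sgmu: "sg * mu \<le> 1 / 512"
      using inner_loop.step_sizes(4)[OF loop[OF x_mem, of 0]] by simp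
    define nz where "nz = \<bar>C\<bar> * real k powr (-al / 2)"
    define B where "B = bias_factor * (inner_gain * rate ^ El * (sqrt Du + weight * sqrt Dy) + inner_noise * nz)"
    have bias: "norm (est t - grad_h_ex P (xi t) (x t)) \<le> B" if t: "t < T" for t
    proof -
      interpret il: inner_loop P L mu Cf Lxy Lyy "xi t" "x t" y0 u0 "ze t" k "N t" al C gam rho "y t" "u t"
        using loop[OF x_mem] t by simp
      have "El * k \<le> N t" using Tl xi by (simp add: common_inner_steps_def N_def)
      have "norm (est t - grad_h_ex P (xi t) (x t))
        \<le> bias_factor * (norm (u t (N t) - u_star P (xi t) (x t)) + weight * norm (y t (N t) - y_star P (xi t) (x t)))"
        using il.bias_le[of "N t"] by (simp add: est_def il.estimate_def)
      also have "\<dots> \<le> bias_factor * (inner_gain * rate ^ El * (norm (u0 - u_star P (xi t) (x t))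
          + weight * norm (y0 - y_star P (xi t) (x t))) + inner_noise * nz)"
        using il.inner_error[OF \<open>El * k \<le> N t\<close> El] bias_factor_pos
        by (intro mult_left_mono) (auto simp: il.noise_def nz_def)
      also have "\<dots> \<le> B"
        unfolding B_def using Dy Du t bias_factor_pos constants_pos rate_bounds[OF sgmu]
        by (intro mult_left_mono add_mono add_right_mono real_le_rsqrt) auto
      finally show ?thesis .
    qed
    have Du_sq: "(inner_gain * rate ^ El * sqrt Du)\<^sup>2 = inner_gain\<^sup>2 * (rate\<^sup>2) ^ El * Du"
      and Dy_sq: "(inner_gain * rate ^ El * (weight * sqrt Dy))\<^sup>2 = (inner_gain * weight)\<^sup>2 * (rate\<^sup>2) ^ El * Dy"
      using D0 by (simp_all add: power_mult_distrib flip: power_mult) (simp_all add: mult.commute[of El])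
    have low: "(INF v\<in>X_space P. h_obj P v) \<le> h_obj P (x t)" for t
      using prob x_mem by (intro cINF_lower) (auto simp: cbo_problem_def)
    have "(\<Sum>e<E. (norm (grad_on (X_space P) (h_obj P) (x (k * e))))\<^sup>2) / real E
      \<le> 8 * (h_obj P (x 0) - (INF v\<in>X_space P. h_obj P v)) / (real k * real E * eta)
        + 9 * (C\<^sup>2 * real k powr (-al)) + 7 * B\<^sup>2"
    proof (rule averaged_descent[OF subspace_spaces(1) x_mem smh _ _ _ bias L0 k E T eta low])
      show "norm (grad_h_ex P (xi t) v - grad_h_ex P (xi t) w) \<le> Lbar * norm (v - w)"
        if "v \<in> X_space P" "w \<in> X_space P" for t v w
        using sme[OF xi] lipschitz_onD that unfolding grad_h_ex_def smooth_on_def dist_norm[symmetric] by blast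
      show "(norm ((\<Sum>\<tau>=t..<t+s. grad_h_ex P (xi \<tau>) (x t)) /\<^sub>R real s - grad_on (X_space P) (h_obj P) (x t)))\<^sup>2
        \<le> real s powr (-al) * C\<^sup>2" if "t < T" "averaging_interval al T t s" for t s
        using avg that unfolding averaged_bounds_def grad_h_def by blast
    qed (simp add: x_Suc algebra_simps)
    also have "B\<^sup>2 \<le> bias_factor\<^sup>2 * (3 * ((inner_gain * rate ^ El * sqrt Du)\<^sup>2
        + (inner_gain * rate ^ El * (weight * sqrt Dy))\<^sup>2 + (inner_noise * nz)\<^sup>2))"
      unfolding B_def power_mult_distrib[of bias_factor] distrib_left[of "inner_gain * rate ^ El"]
      by (intro mult_left_mono square_sum3_le) simp
    also have "7 * \<dots> = K * inner_gain\<^sup>2 * (rate\<^sup>2) ^ El * Du + K * (inner_gain * weight)\<^sup>2 * (rate\<^sup>2) ^ El * Dy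
        + K * inner_noise\<^sup>2 * nz\<^sup>2"
      unfolding Du_sq Dy_sq by (simp add: K_def power_mult_distrib algebra_simps)
    also have "K * inner_gain\<^sup>2 * (rate\<^sup>2) ^ El * Du \<le> K * inner_gain\<^sup>2 * (1 - real k * mu * rho / 2) ^ El * Du"
    proof (intro mult_right_mono mult_left_mono power_mono D0)
      have "real k * mu * rho = sg * mu" using rk by (simp add: mult_ac)
      then show "rate\<^sup>2 \<le> 1 - real k * mu * rho / 2"
        using rate_bounds[OF sgmu] constants_pos(1) pos by (smt (verit) mult_pos_pos field_sum_of_halves)
    qed (use K in auto)
    also have "K * (inner_gain * weight)\<^sup>2 * (rate\<^sup>2) ^ El * Dy
      \<le> K * (inner_gain * weight)\<^sup>2 * (1 - real k * mu * gam / 2) ^ El * Dy"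
    proof (intro mult_right_mono mult_left_mono power_mono D0)
      have "real k * mu * gam / 2 = mu * (rho * real k)" by (simp add: gr)
      then show "rate\<^sup>2 \<le> 1 - real k * mu * gam / 2"
        using rate_bounds[OF sgmu] by (simp only: rk mult.commute)
    qed (use K in auto)
    also have "nz\<^sup>2 = C\<^sup>2 * real k powr (-al)"
      by (simp add: nz_def power_mult_distrib power2_eq_square[of "real k powr _"] powr_add[symmetric])
    finally show "(\<Sum>e<E. (norm (grad_h P (x (k * e))))\<^sup>2) / real E
        \<le> 8 * Dh / (real k * real E * eta)
          + K * inner_gain\<^sup>2 * (1 - real k * mu * rho / 2) ^ El * Du
          + K * (inner_gain * weight)\<^sup>2 * (1 - real k * mu * gam / 2) ^ El * Dy
          + C'\<^sup>2 * C\<^sup>2 * real k powr (-al)"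
      unfolding C'(2) grad_h_def Dh by (simp add: x algebra_simps)
  qed
qed

end
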